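(* Let $v:\mathbb{R}/\mathbb{Z}\to\mathbb{R}$ be analytic, $\alpha\in\mathrm{DC}$, $|\lambda|<\lambda_0(v)$ (setting as in the context). There exist constants $C,c>0$ depending only on $v,\lambda,\alpha$ such that the following holds for every $E\in\Sigma_{\lambda v,\alpha}$, with $\theta=\theta(E)$, $\{n_j\}$ the $\epsilon_0$-resonances of $\theta$, and $A=S_{\lambda v,E}$. Fix some $n=|n_j|+1<\infty$ and let $N=|n_{j+1}|$. Then there exists an analytic $\Phi:\mathbb{R}/\mathbb{Z}\to\mathrm{SL}(2,\mathbb{C})$ with $\|\Phi\|_{cn^{-C}}\le Cn^C$ such that $$\Phi(x+\alpha)A(x)\Phi(x)^{-1}=\begin{pmatrix} e^{2\pi i\theta} & 0 \\ 0 & e^{-2\pi i\theta} \end{pmatrix}+\begin{pmatrix} q_1(x) & q(x) \\ q_3(x) & q_4(x) \end{pmatrix},$$ with $\|q_1\|_{cn^{-C}},\|q_3\|_{cn^{-C}},\|q_4\|_{cn^{-C}}\le Ce^{-cN}$ and $\|q\|_{cn^{-C}}\le Ce^{-cn(\ln(1+n))^{-C}}$.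
   Context: $\mathrm{DC}(\kappa,\tau)$ is the set of $\alpha\in\mathbb{R}$ with $|\alpha-p/q|\ge \kappa |q|^{-\tau}$ for all $p,q\in\mathbb{Z}$, $q\ne0$; $\mathrm{DC}=\bigcup_{\kappa>0,\tau>0}\mathrm{DC}(\kappa,\tau)$. $\|x\|_{\mathbb{R}/\mathbb{Z}}$ is the distance from $x$ to $\mathbb{Z}$. $\|f\|_\epsilon=\sup_{|\Im z|<\epsilon}\|f(z)\|$ for a function (scalar or matrix valued) that extends to a bounded holomorphic function on $\{|\Im z|<\epsilon\}$. $S_{\lambda v,E}(x)=\begin{pmatrix} E-\lambda v(x) & -1 \\ 1 & 0 \end{pmatrix}$. $\Sigma_{\lambda v,\alpha}$ is the ($\theta$-independent) spectrum of $(H_{\lambda v,\alpha,\theta}u)_n=u_{n+1}+u_{n-1}+\lambda v(\theta+n\alpha)u_n$ on $\ell^2(\mathbb{Z})$. Dual model: with $v(x)=\sum_k \hat v_k e^{2\pi i kx}$, $(\hat H_{\lambda v,\alpha,\theta}\hat u)_n=\sum_{k}\lambda\hat v_k\hat u_{n-k}+2\cos(2\pi(\theta+n\alpha))\hat u_n$. Resonances: an integer $k$ is an $\epsilon_0$-resonance of $\theta$ if $\|2\theta-k\alpha\|_{\mathbb{R}/\mathbb{Z}}\le e^{-|k|\epsilon_0}$ and $\|2\theta-k\alpha\|_{\mathbb{R}/\mathbb{Z}}=\min_{|j|\le|k|}\|2\theta-j\alpha\|_{\mathbb{R}/\mathbb{Z}}$. They are ordered $0=n_0<|n_1|\le|n_2|\le\cdots$;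 if there are only finitely many, $n_0,\dots,n_j$, set $n_{j+1}=\infty$ (and then $e^{-c|n_{j+1}|}=0$). Almost localization with parameters $C_0,C_1,\epsilon_0,\epsilon_1>0$: for every $\theta,E\in\mathbb{R}$ and every solution $\hat u$ of $\hat H_{\lambda v,\alpha,\theta}\hat u=E\hat u$ with $\hat u_0=1$ and $|\hat u_k|\le 1+|k|$, one has $|\hat u_k|\le C_1e^{-\epsilon_1|k|}$ whenever $C_0(1+|n_j|)<|k|<C_0^{-1}|n_{j+1}|$ for some $j$, $\{n_j\}$ being the $\epsilon_0$-resonances of $\theta$. Setting: $\lambda_0(v)>0$ is a constant (it exists for every analytic $v$, and equals $1$ for $v(x)=2\cos 2\pi x$) such that for all $|\lambda|<\lambda_0(v)$ and $\alpha\in\mathrm{DC}$ the family $\{\hat H_{\lambda v,\alpha,\theta}\}_{\theta}$ is almost localized; for given $v,\lambda,\alpha$ fix parameters $(C_0,C_1,\epsilon_0,\epsilon_1)$ of almost localization. For $E\in\Sigma_{\lambda v,\alpha}$, $\theta(E)$ is some fixed choice (one always exists, not necessarily unique) of $\theta\in\mathbb{R}$ for which $\hat H_{\lambda v,\alpha,\theta}\hat u=E\hat u$ has a solution with $\hat u_0=1$ and $|\hat u_k|\le1$ for all $k$. The constants $C,c$ do not depend on $E$ or $\theta$. *)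

theory Defs
  imports "HOL-Complex_Analysis.Complex_Analysis"
begin

section \<open>Arithmetic of the frequency\<close>

definition DC_param :: "real \<Rightarrow> real \<Rightarrow> real set" where
  "DC_param \<kappa> \<tau> =
     {\<alpha>. \<forall>p q :: int. q \<noteq> 0 \<longrightarrow>
        \<bar>\<alpha> - real_of_int p / real_of_int q\<bar> \<ge> \<kappa> * \<bar>real_of_int q\<bar> powr (- \<tau>)}"

definition DC :: "real set" where
  "DC = (\<Union>\<kappa>\<in>{0<..}. \<Union>\<tau>\<in>{0<..}. DC_param \<kappa> \<tau>)"

definition circle_norm :: "real \<Rightarrow> real" where
  "circle_norm x = infdist x \<int>"

section \<open>Analytic functions on the circle and norms on strips\<close>

text \<open>Functions on the circle R/Z are 1-periodic functions on the line. Real analyticity is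
  expressed by the existence of a complex analytic extension to a neighbourhood of the line.\<close>

definition analytic_circle :: "(real \<Rightarrow> complex) \<Rightarrow> bool" where
  "analytic_circle f \<longleftrightarrow>
     (\<forall>x. f (x + 1) = f x) \<and>
     (\<exists>F. F analytic_on \<real> \<and> (\<forall>x. F (complex_of_real x) = f x))"

definition strip :: "real \<Rightarrow> complex set" where
  "strip \<epsilon> = {z. \<bar>Im z\<bar> < \<epsilon>}"

definition is_strip_ext :: "real \<Rightarrow> (real \<Rightarrow> complex) \<Rightarrow> (complex \<Rightarrow> complex) \<Rightarrow> bool" where
  "is_strip_ext \<epsilon> f F \<longleftrightarrow>
     F holomorphic_on strip \<epsilon> \<and> bounded (F ` strip \<epsilon>) \<and> (\<forall>x. F (complex_of_real x) = f x)"

text \<open>On the strip the extension is unique by the identity theorem, so the choice below only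
  concerns irrelevant values outside it. It is meaningless, and so are the norms, for functions
  that have no bounded extension; every use of the norms is guarded by
  \<open>extends_to_strip\<close> or \<open>mat_extends_to_strip\<close>.\<close>

definition extends_to_strip :: "real \<Rightarrow> (real \<Rightarrow> complex) \<Rightarrow> bool" where
  "extends_to_strip \<epsilon> f \<longleftrightarrow> (\<exists>F. is_strip_ext \<epsilon> f F)"

definition strip_ext :: "real \<Rightarrow> (real \<Rightarrow> complex) \<Rightarrow> complex \<Rightarrow> complex" where
  "strip_ext \<epsilon> f = (SOME F. is_strip_ext \<epsilon> f F)"

definition strip_norm :: "real \<Rightarrow> (real \<Rightarrow> complex) \<Rightarrow> real" where
  "strip_norm \<epsilon> f = (SUP z\<in>strip \<epsilon>. norm (strip_ext \<epsilon> f z))"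

definition mat_extends_to_strip :: "real \<Rightarrow> (real \<Rightarrow> complex^2^2) \<Rightarrow> bool" where
  "mat_extends_to_strip \<epsilon> M \<longleftrightarrow> (\<forall>i j. extends_to_strip \<epsilon> (\<lambda>x. M x $ i $ j))"

text \<open>The norm of a matrix is the operator norm for the Euclidean norm on the plane.\<close>

definition mat_strip_norm :: "real \<Rightarrow> (real \<Rightarrow> complex^2^2) \<Rightarrow> real" where
  "mat_strip_norm \<epsilon> M =
     (SUP z\<in>strip \<epsilon>. onorm ((*v) (\<chi> i j. strip_ext \<epsilon> (\<lambda>x. M x $ i $ j) z)))"

definition mat2 :: "complex \<Rightarrow> complex \<Rightarrow> complex \<Rightarrow> complex \<Rightarrow> complex^2^2" where
  "mat2 a b c d = vector [vector [a, b], vector [c, d]]"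

section \<open>The Schroedinger operator, its cocycle and its spectrum\<close>

definition schroedinger_cocycle :: "(real \<Rightarrow> real) \<Rightarrow> real \<Rightarrow> real \<Rightarrow> real \<Rightarrow> complex^2^2" where
  "schroedinger_cocycle v lam E x = mat2 (complex_of_real (E - lam * v x)) (-1) 1 0"

definition schroedinger_op ::
    "(real \<Rightarrow> real) \<Rightarrow> real \<Rightarrow> real \<Rightarrow> real \<Rightarrow> (int \<Rightarrow> complex) \<Rightarrow> int \<Rightarrow> complex" where
  "schroedinger_op v lam \<alpha> \<theta> u n =
     u (n + 1) + u (n - 1) + complex_of_real (lam * v (\<theta> + real_of_int n * \<alpha>)) * u n"

definition ell2 :: "(int \<Rightarrow> complex) set" where
  "ell2 = {u. (\<lambda>n. (norm (u n))\<^sup>2) summable_on UNIV}"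

definition ell2_norm :: "(int \<Rightarrow> complex) \<Rightarrow> real" where
  "ell2_norm u = sqrt (\<Sum>\<^sub>\<infinity>n. (norm (u n))\<^sup>2)"

text \<open>The complement of the resolvent set, that is, of the set of those z for which T - z is a
  bijection of l2(Z) with bounded inverse.\<close>

definition ell2_spectrum :: "((int \<Rightarrow> complex) \<Rightarrow> int \<Rightarrow> complex) \<Rightarrow> complex set" where
  "ell2_spectrum T =
     {z. \<not> (bij_betw (\<lambda>u n. T u n - z * u n) ell2 ell2 \<and>
             (\<exists>K. \<forall>u\<in>ell2. ell2_norm u \<le> K * ell2_norm (\<lambda>n. T u n - z * u n)))}"

text \<open>For irrational \<open>\<alpha>\<close> and continuous \<open>v\<close> the spectrum does not depend on the phase, and all the
  sets in the union are equal.\<close>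

definition Sigma_spec :: "(real \<Rightarrow> real) \<Rightarrow> real \<Rightarrow> real \<Rightarrow> real set" where
  "Sigma_spec v lam \<alpha> =
     {E. \<exists>\<theta>. complex_of_real E \<in> ell2_spectrum (schroedinger_op v lam \<alpha> \<theta>)}"

section \<open>The dual model\<close>

definition fourier_coeff :: "(real \<Rightarrow> real) \<Rightarrow> int \<Rightarrow> complex" where
  "fourier_coeff v k =
     integral {0..1}
       (\<lambda>x. complex_of_real (v x) * exp (- (2 * of_real pi * \<i> * of_int k * of_real x)))"

text \<open>The eigenvalue equation of the dual operator. Stating it with \<open>has_sum\<close> makes
  the convergence of the convolution part of the equation.\<close>

definition dual_solution ::
    "(real \<Rightarrow> real) \<Rightarrow> real \<Rightarrow> real \<Rightarrow> real \<Rightarrow> real \<Rightarrow> (int \<Rightarrow> complex) \<Rightarrow> bool" where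
  "dual_solution v lam \<alpha> \<theta> E u \<longleftrightarrow>
     (\<forall>n. ((\<lambda>k. complex_of_real lam * fourier_coeff v k * u (n - k)) has_sum
            (complex_of_real E * u n
              - complex_of_real (2 * cos (2 * pi * (\<theta> + real_of_int n * \<alpha>))) * u n)) UNIV)"

definition dual_phase :: "(real \<Rightarrow> real) \<Rightarrow> real \<Rightarrow> real \<Rightarrow> real \<Rightarrow> real \<Rightarrow> bool" where
  "dual_phase v lam \<alpha> E \<theta> \<longleftrightarrow>
     (\<exists>u. dual_solution v lam \<alpha> \<theta> E u \<and> u 0 = 1 \<and> (\<forall>k. norm (u k) \<le> 1))"

section \<open>Resonances\<close>

definition resonances :: "real \<Rightarrow> real \<Rightarrow> real \<Rightarrow> int set" where
  "resonances \<alpha> \<epsilon>0 \<theta> =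
     {k. circle_norm (2 * \<theta> - real_of_int k * \<alpha>) \<le> exp (- (\<bar>real_of_int k\<bar> * \<epsilon>0)) \<and>
         circle_norm (2 * \<theta> - real_of_int k * \<alpha>) =
           Min ((\<lambda>j. circle_norm (2 * \<theta> - real_of_int j * \<alpha>)) ` {- \<bar>k\<bar>..\<bar>k\<bar>})}"

text \<open>The indices j for which there is a j-th resonance, counting from 0.\<close>

definition res_index :: "real \<Rightarrow> real \<Rightarrow> real \<Rightarrow> nat set" where
  "res_index \<alpha> \<epsilon>0 \<theta> =
     {j. infinite (resonances \<alpha> \<epsilon>0 \<theta>) \<or> j < card (resonances \<alpha> \<epsilon>0 \<theta>)}"

text \<open>Listing of all resonances by increasing absolute value. It is unique up to the order of
  k and -k when both are resonances, so that the absolute values are determined. The values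
  \<open>r j\<close> for \<open>j \<notin> res_index \<alpha> \<epsilon>0 \<theta>\<close> are irrelevant.\<close>

definition resonance_enum :: "real \<Rightarrow> real \<Rightarrow> real \<Rightarrow> (nat \<Rightarrow> int) \<Rightarrow> bool" where
  "resonance_enum \<alpha> \<epsilon>0 \<theta> r \<longleftrightarrow>
     r 0 = 0 \<and>
     bij_betw r (res_index \<alpha> \<epsilon>0 \<theta>) (resonances \<alpha> \<epsilon>0 \<theta>) \<and>
     (\<forall>i\<in>res_index \<alpha> \<epsilon>0 \<theta>. \<forall>j\<in>res_index \<alpha> \<epsilon>0 \<theta>. i \<le> j \<longrightarrow> \<bar>r i\<bar> \<le> \<bar>r j\<bar>)"

text \<open>The absolute value of the j-th resonance, infinite if there is none.\<close>

definition res_abs :: "real \<Rightarrow> real \<Rightarrow> real \<Rightarrow> (nat \<Rightarrow> int) \<Rightarrow> nat \<Rightarrow> enat" where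
  "res_abs \<alpha> \<epsilon>0 \<theta> r j = (if j \<in> res_index \<alpha> \<epsilon>0 \<theta> then enat (nat \<bar>r j\<bar>) else \<infinity>)"

definition exp_neg :: "real \<Rightarrow> enat \<Rightarrow> real" where
  "exp_neg c N = (case N of enat m \<Rightarrow> exp (- c * real m) | \<infinity> \<Rightarrow> 0)"

lemma zero_mem_resonances: "0 \<in> resonances \<alpha> \<epsilon>0 \<theta>"
proof -
  have "circle_norm (2 * \<theta>) \<le> 1"
  proof -
    have "circle_norm (2 * \<theta>) \<le> dist (2 * \<theta>) (of_int \<lfloor>2 * \<theta>\<rfloor>)"
      unfolding circle_norm_def by (rule infdist_le) simp
    also have "\<dots> \<le> 1"
      unfolding dist_real_def by linarith
    finally show ?thesis .
  qed
  then show ?thesis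
    by (simp add: resonances_def)
qed

lemma int_encode_le_abs:
  assumes "int_encode a \<le> int_encode b"
  shows "\<bar>a\<bar> \<le> \<bar>b\<bar>"
  using assms by (auto simp: int_encode_def sum_encode_def split: if_splits)

lemma resonance_enum_exists: "\<exists>r. resonance_enum \<alpha> \<epsilon>0 \<theta> r"
proof -
  define R where "R = resonances \<alpha> \<epsilon>0 \<theta>"
  define S where "S = int_encode ` R"
  define I where "I = res_index \<alpha> \<epsilon>0 \<theta>"
  define r where "r j = int_decode (enumerate S j)" for j
  have inj: "inj_on int_encode R" by (simp add: inj_int_encode inj_on_subset)
  have fin: "finite S = finite R" unfolding S_def by (simp add: finite_image_iff inj)
  have card: "card S = card R" unfolding S_def by (simp add: card_image inj)
  have bijS: "bij_betw (enumerate S) I S"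
  proof (cases "finite R")
    case True
    then have "I = {..<card S}" by (auto simp: I_def res_index_def R_def card)
    then show ?thesis using True fin finite_bij_enumerate by auto
  next
    case False
    then have "I = UNIV" by (auto simp: I_def res_index_def R_def)
    then show ?thesis using False fin bij_enumerate by auto
  qed
  have mono: "enumerate S i \<le> enumerate S j" if "i \<in> I" "j \<in> I" "i \<le> j" for i j
  proof (cases "finite R")
    case True
    then have "j < card S" using that by (auto simp: I_def res_index_def R_def card)
    then show ?thesis using True fin that(3) by (cases "i = j") (auto intro!: less_imp_le finite_enumerate_mono)
  next
    case False
    then show ?thesis using fin that(3) by simp
  qed
  have "bij_betw int_decode S R"
    unfolding S_def by (rule bij_betw_byWitness[where f' = int_encode]) auto
  then have "bij_betw r I R"
    using bij_betw_trans[OF bijS] by (simp add: r_def[abs_def] comp_def)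
  moreover have "\<bar>r i\<bar> \<le> \<bar>r j\<bar>" if "i \<in> I" "j \<in> I" "i \<le> j" for i j
    using mono[OF that] by (auto intro!: int_encode_le_abs simp: r_def)
  moreover have "r 0 = 0"
  proof -
    have "int_encode 0 = 0" by (simp add: int_encode_def sum_encode_def)
    moreover have "int_encode 0 \<in> S"
      using zero_mem_resonances by (auto simp: S_def R_def)
    ultimately have "0 \<in> S" by simp
    then have "enumerate S 0 = 0" by (simp add: enumerate_0)
    then show ?thesis by (simp add: r_def int_decode_def sum_decode_def)
  qed
  ultimately show ?thesis
    unfolding resonance_enum_def I_def R_def by blast
qed

section \<open>Almost localization\<close>

definition almost_localized ::
    "(real \<Rightarrow> real) \<Rightarrow> real \<Rightarrow> real \<Rightarrow> real \<Rightarrow> real \<Rightarrow> real \<Rightarrow> real \<Rightarrow> bool" where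
  "almost_localized v lam \<alpha> C0 C1 \<epsilon>0 \<epsilon>1 \<longleftrightarrow>
     C0 > 0 \<and> C1 > 0 \<and> \<epsilon>0 > 0 \<and> \<epsilon>1 > 0 \<and>
     (\<forall>\<theta> E u r. dual_solution v lam \<alpha> \<theta> E u \<and> u 0 = 1 \<and>
        (\<forall>k. norm (u k) \<le> 1 + \<bar>real_of_int k\<bar>) \<and> resonance_enum \<alpha> \<epsilon>0 \<theta> r \<longrightarrow>
        (\<forall>k. \<forall>j\<in>res_index \<alpha> \<epsilon>0 \<theta>.
           C0 * (1 + \<bar>real_of_int (r j)\<bar>) < \<bar>real_of_int k\<bar> \<and>
           (case res_abs \<alpha> \<epsilon>0 \<theta> r (Suc j) of
              enat m \<Rightarrow> \<bar>real_of_int k\<bar> < inverse C0 * real m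
            | \<infinity> \<Rightarrow> True) \<longrightarrow>
           norm (u k) \<le> C1 * exp (- \<epsilon>1 * \<bar>real_of_int k\<bar>)))"

text \<open>What is required of the constant \<open>\<lambda>\<^sub>0(v)\<close>; the last clause is its normalization for
  the almost Mathieu operator.\<close>

definition is_lambda0 :: "(real \<Rightarrow> real) \<Rightarrow> real \<Rightarrow> bool" where
  "is_lambda0 v l0 \<longleftrightarrow>
     l0 > 0 \<and>
     (\<forall>lam \<alpha>. \<bar>lam\<bar> < l0 \<and> \<alpha> \<in> DC \<longrightarrow>
        (\<exists>C0 C1 \<epsilon>0 \<epsilon>1. almost_localized v lam \<alpha> C0 C1 \<epsilon>0 \<epsilon>1)) \<and>
     (v = (\<lambda>x. 2 * cos (2 * pi * x)) \<longrightarrow> l0 = 1)"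

end

theory Submission imports Defs
begin

text \<open>A dual solution, truncated between consecutive resonances, is the Fourier transform of a function u
  for which U(x) = (e u(x), u(x - alpha)), e = exp(2 pi i theta), satisfies A(x) U(x) = e U(x + alpha) up to an
  error exp(-c N), on a strip of width about 1/n. On the real line U cannot be small: some point of every long
  enough orbit has |u| at least 1/2, because u has mean 1 and the small divisors of alpha are bounded below, and the
  transfer matrices along the orbit grow polynomially. Hence U can be completed to a unimodular frame by the
  explicit vector (-conj U2, conj U1)/(U . conj U), continued to a strip of width n^(-C). In this frame A is
  triangular with diagonal e, 1/e up to exp(-c N).

  The polynomial growth comes from the triangular form at the preceding resonance, used twice, since
  consecutive resonances are exponentially separated. The preceding resonance has size at
  most C ln n, and the small divisors below the present one are bounded below by n^(-C). Solving the
  cohomological equation for these modes in the preceding frame gives products of size n^C on a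
  strip of width (ln n)^(-C) up to time exp(c n (ln n)^(-C)). Averaging the Birkhoff sums of the
  off-diagonal entry over that time and conjugating by the resulting shear makes this entry as
  small as a power of n divided by that time.\<close>

subsection \<open>Fourier series on strips\<close>

text \<open>The growth bound M of the transfer matrices fixes everything else: the components of U
  satisfy |U1| + |U2| >= 1/(4 M), the frame has size about n M^2, and it survives on a strip of
  width about 1/(n^3 M^2). So M has to be a power of n, and the trivial bound exp(C n^(\<tau>+1)) is
  far from that. In the present frame the cohomological equation cannot be solved: at the mode l =
  n_j the divisor 1 - exp(2 pi i (l \<alpha> - 2 \<theta>)) may be exponentially small, while on a
  strip of width n^(-C) this mode has not decayed. In the preceding frame the strip is only
  logarithmically thin in n, so the unsolved modes |l| >= |n_j| have size exp(-c n (ln n)^(-C));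
  this is the origin of the bound for q. Growth over a given time does not depend on the frame, so
  it can be used in the present one, where it bounds the Birkhoff sums of the off-diagonal entry.
  Their mean is an approximate solution that involves no division and no shrinking of the
  strip.\<close>

definition ep :: "complex \<Rightarrow> complex" where
  "ep z = exp (2 * of_real pi * \<i> * z)"

lemma ep_add: "ep (z + w) = ep z * ep w"
  by (simp add: ep_def ring_distribs exp_add)

lemma ep_0 [simp]: "ep 0 = 1"
  by (simp add: ep_def)

lemma ep_nonzero [simp]: "ep z \<noteq> 0"
  by (simp add: ep_def)

lemma ep_of_int [simp]: "ep (of_int k) = 1"
  using exp_integer_2pi[of "of_int k"] by (simp add: ep_def mult_ac)

lemma norm_ep: "norm (ep z) = exp (- 2 * pi * Im z)"
  by (simp add: ep_def norm_exp_eq_Re)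

lemma norm_ep_real [simp]: "norm (ep (of_real x)) = 1"
  by (simp add: norm_ep)

lemma holomorphic_on_ep [holomorphic_intros]:
  "f holomorphic_on S \<Longrightarrow> (\<lambda>z. ep (f z)) holomorphic_on S"
  unfolding ep_def by (intro holomorphic_intros)

lemma norm_ep_int_mult_le:
  "norm (ep (of_int k * z)) \<le> exp (2 * pi * \<bar>Im z\<bar> * \<bar>real_of_int k\<bar>)"
proof -
  have "- (real_of_int k * Im z) \<le> \<bar>Im z\<bar> * \<bar>real_of_int k\<bar>"
    by (metis abs_ge_minus_self abs_mult mult.commute)
  then have "(2 * pi) * (- (real_of_int k * Im z)) \<le> (2 * pi) * (\<bar>Im z\<bar> * \<bar>real_of_int k\<bar>)"
    by (intro mult_left_mono) auto
  then show ?thesis by (simp add: norm_ep mult_ac)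
qed

lemma open_strip [simp]: "open (strip h)"
proof -
  have "strip h = {z. Im z < h} \<inter> {z. Im z > - h}" by (auto simp: strip_def)
  then show ?thesis by (auto simp: open_halfspace_Im_lt open_halfspace_Im_gt)
qed

lemma convex_strip [simp]: "convex (strip h)"
proof -
  have "strip h = {z. Im z < h} \<inter> {z. Im z > - h}" by (auto simp: strip_def)
  then show ?thesis by (auto intro!: convex_Int convex_halfspace_Im_lt convex_halfspace_Im_gt)
qed

lemma strip_mono: "h \<le> h' \<Longrightarrow> strip h \<subseteq> strip h'"
  by (auto simp: strip_def)

lemma of_real_in_strip [simp]: "of_real x \<in> strip h \<longleftrightarrow> h > 0"
  by (auto simp: strip_def)

lemma add_of_real_in_strip [simp]:
  "z + of_real x \<in> strip h \<longleftrightarrow> z \<in> strip h" "z - of_real x \<in> strip h \<longleftrightarrow> z \<in> strip h"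
  "z + 1 \<in> strip h \<longleftrightarrow> z \<in> strip h"
  by (auto simp: strip_def)

lemma cnj_in_strip [simp]: "cnj z \<in> strip h \<longleftrightarrow> z \<in> strip h"
  by (auto simp: strip_def)

lemma exp_abs_int_summable:
  fixes \<rho> :: real
  assumes "\<rho> > 0"
  shows "(\<lambda>k::int. exp (- \<rho> * \<bar>real_of_int k\<bar>)) summable_on UNIV"
    and "(\<Sum>\<^sub>\<infinity>k::int. exp (- \<rho> * \<bar>real_of_int k\<bar>)) \<le> 2 + 2 / \<rho>"
proof -
  let ?f = "\<lambda>k::int. exp (- \<rho> * \<bar>real_of_int k\<bar>)"
  define q where "q = exp (- \<rho>)"
  have q: "0 < q" "q < 1" using assms by (auto simp: q_def)
  have f_nat: "?f (int n) = q ^ n" "?f (- int n) = q ^ n" for n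
    by (auto simp: q_def exp_of_nat_mult[symmetric] mult_ac)
  have "exp \<rho> \<ge> 1 + \<rho>" by simp
  then have "q \<le> 1 / (1 + \<rho>)"
    using assms by (auto simp: q_def exp_minus field_simps)
  then have "1 - q \<ge> \<rho> / (1 + \<rho>)" using assms by (auto simp: field_simps)
  then have "1 / (1 - q) \<le> 1 / (\<rho> / (1 + \<rho>))"
    using assms q by (intro divide_left_mono) auto
  then have inv: "1 / (1 - q) \<le> 1 + 1 / \<rho>" using assms by (auto simp: field_simps)
  have geo: "(\<Sum>n<N. q ^ n) \<le> 1 + 1 / \<rho>" for N
  proof -
    have "(\<Sum>n<N. q ^ n) \<le> (\<Sum>n. q ^ n)"
      using q by (intro sum_le_suminf) (auto intro: summable_geometric)
    also have "\<dots> = 1 / (1 - q)" using q by (simp add: suminf_geometric)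
    finally show ?thesis using inv by simp
  qed
  have bound: "sum ?f F \<le> 2 + 2 / \<rho>" if F: "finite F" for F
  proof -
    obtain N where N: "\<And>k. k \<in> F \<Longrightarrow> nat \<bar>k\<bar> < N"
      using finite_nat_set_iff_bounded[of "(\<lambda>k. nat \<bar>k\<bar>) ` F"] F by auto
    have sub: "F \<subseteq> int ` {..<N} \<union> (\<lambda>n. - int n) ` {..<N}"
    proof
      fix k assume "k \<in> F"
      then have "nat \<bar>k\<bar> < N" by (rule N)
      then show "k \<in> int ` {..<N} \<union> (\<lambda>n. - int n) ` {..<N}"
        by (cases "k \<ge> 0") (auto intro!: image_eqI[of _ _ "nat \<bar>k\<bar>"])
    qed
    have "sum ?f F \<le> sum ?f (int ` {..<N} \<union> (\<lambda>n. - int n) ` {..<N})"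
      by (rule sum_mono2[OF _ sub]) auto
    also have "\<dots> \<le> sum ?f (int ` {..<N}) + sum ?f ((\<lambda>n. - int n) ` {..<N})"
      by (subst sum_Un) (auto intro!: sum_nonneg)
    also have "\<dots> = (\<Sum>n<N. q ^ n) + (\<Sum>n<N. q ^ n)"
      by (subst (1 2) sum.reindex) (auto simp: inj_on_def f_nat[unfolded of_int_of_nat_eq of_int_minus] 
         o_def q_def exp_of_nat_mult[symmetric] mult_ac)
    also have "\<dots> \<le> (1 + 1 / \<rho>) + (1 + 1 / \<rho>)"
      by (intro add_mono geo)
    finally show ?thesis by simp
  qed
  show "?f summable_on UNIV"
    by (rule nonneg_bdd_above_summable_on) (use bound in \<open>auto intro!: bdd_aboveI[of _ "2 + 2 / \<rho>"]\<close>)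
  then show "infsum ?f UNIV \<le> 2 + 2 / \<rho>"
    by (rule infsum_le_finite_sums) (use bound in auto)
qed

definition exp_decay :: "real \<Rightarrow> real \<Rightarrow> (int \<Rightarrow> complex) \<Rightarrow> bool" where
  "exp_decay C \<rho> a \<longleftrightarrow> (\<forall>k. norm (a k) \<le> C * exp (- \<rho> * \<bar>real_of_int k\<bar>))"

lemma exp_decayD: "exp_decay C \<rho> a \<Longrightarrow> norm (a k) \<le> C * exp (- \<rho> * \<bar>real_of_int k\<bar>)"
  by (simp add: exp_decay_def)

lemma exp_decay_nonneg: "exp_decay C \<rho> a \<Longrightarrow> C \<ge> 0"
  using order_trans[OF norm_ge_zero exp_decayD[of C \<rho> a 0]] by simp

lemma exp_decay_mono:
  assumes "exp_decay C \<rho> a" "C \<le> C'" "\<rho>' \<le> \<rho>"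
  shows "exp_decay C' \<rho>' a"
  unfolding exp_decay_def
proof
  fix k
  have "norm (a k) \<le> C * exp (- \<rho> * \<bar>real_of_int k\<bar>)" by (rule exp_decayD[OF assms(1)])
  also have "\<dots> \<le> C' * exp (- \<rho>' * \<bar>real_of_int k\<bar>)"
    using assms exp_decay_nonneg[OF assms(1)] by (intro mult_mono) (auto intro!: mult_right_mono)
  finally show "norm (a k) \<le> C' * exp (- \<rho>' * \<bar>real_of_int k\<bar>)" .
qed

lemma exp_decay_infsum:
  assumes "exp_decay C \<rho> a" "\<rho> > 0"
  shows "(\<lambda>k. norm (a k)) summable_on UNIV" "a summable_on UNIV"
    and "norm (infsum a UNIV) \<le> C * (2 + 2 / \<rho>)" "(\<Sum>\<^sub>\<infinity>k. norm (a k)) \<le> C * (2 + 2 / \<rho>)"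
proof -
  note s = exp_abs_int_summable[OF assms(2)]
  have sC: "(\<lambda>k. C * exp (- \<rho> * \<bar>real_of_int k\<bar>)) summable_on UNIV"
    by (rule summable_on_cmult_right[OF s(1)])
  show 1: "(\<lambda>k. norm (a k)) summable_on UNIV"
    by (rule Infinite_Sum.abs_summable_on_comparison_test'[OF sC]) (rule exp_decayD[OF assms(1)])
  then show "a summable_on UNIV" by (rule abs_summable_summable)
  have "(\<Sum>\<^sub>\<infinity>k. norm (a k)) \<le> (\<Sum>\<^sub>\<infinity>k. C * exp (- \<rho> * \<bar>real_of_int k\<bar>))"
    by (rule infsum_mono[OF 1 sC]) (rule exp_decayD[OF assms(1)])
  also have "\<dots> = C * (\<Sum>\<^sub>\<infinity>k. exp (- \<rho> * \<bar>real_of_int k\<bar>))"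
    by (rule infsum_cmult_right') 
  also have "\<dots> \<le> C * (2 + 2 / \<rho>)"
    by (rule mult_left_mono[OF s(2) exp_decay_nonneg[OF assms(1)]])
  finally show 2: "(\<Sum>\<^sub>\<infinity>k. norm (a k)) \<le> C * (2 + 2 / \<rho>)" .
  have "norm (infsum a UNIV) \<le> (\<Sum>\<^sub>\<infinity>k. norm (a k))"
    by (rule norm_infsum_bound[OF 1])
  with 2 show "norm (infsum a UNIV) \<le> C * (2 + 2 / \<rho>)" by simp
qed

definition fs :: "(int \<Rightarrow> complex) \<Rightarrow> complex \<Rightarrow> complex" where
  "fs a z = (\<Sum>\<^sub>\<infinity>k. a k * ep (of_int k * z))"

text \<open>Half of the decay rate pays for the growth of the exponentials off the real line, the
  other half remains for the summation. All strip widths of the form rate/(4 pi) below come from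
  this split.\<close>

lemma exp_decay_ep:
  assumes "exp_decay C \<rho> a" and z: "z \<in> strip (\<rho> / (4 * pi))"
  shows "exp_decay C (\<rho> / 2) (\<lambda>k. a k * ep (of_int k * z))"
  unfolding exp_decay_def
proof
  fix k
  have "2 * pi * \<bar>Im z\<bar> \<le> \<rho> / 2"
    using z by (simp add: strip_def field_simps)
  then have "2 * pi * \<bar>Im z\<bar> * \<bar>real_of_int k\<bar> \<le> \<rho> / 2 * \<bar>real_of_int k\<bar>"
    by (intro mult_right_mono) auto
  then have "norm (ep (of_int k * z)) \<le> exp (\<rho> / 2 * \<bar>real_of_int k\<bar>)"
    using norm_ep_int_mult_le[of k z] by (meson exp_le_cancel_iff order_trans)
  then have "norm (a k * ep (of_int k * z)) \<le> (C * exp (- \<rho> * \<bar>real_of_int k\<bar>)) * exp (\<rho> / 2 * \<bar>real_of_int k\<bar>)"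
    unfolding norm_mult by (intro mult_mono exp_decayD[OF assms(1)]) (auto intro!: mult_nonneg_nonneg exp_decay_nonneg[OF assms(1)])
  also have "\<dots> = C * exp (- (\<rho> / 2) * \<bar>real_of_int k\<bar>)"
    by (simp add: mult.assoc exp_add[symmetric])
  finally show "norm (a k * ep (of_int k * z)) \<le> C * exp (- (\<rho> / 2) * \<bar>real_of_int k\<bar>)" .
qed

lemma fs_has_sum:
  assumes "exp_decay C \<rho> a" "\<rho> > 0" "z \<in> strip (\<rho> / (4 * pi))"
  shows "((\<lambda>k. a k * ep (of_int k * z)) has_sum fs a z) UNIV"
  using exp_decay_infsum(2)[OF exp_decay_ep[OF assms(1,3)]] assms(2) by (simp add: fs_def)

lemma norm_fs_le:
  assumes "exp_decay C \<rho> a" "\<rho> > 0" "z \<in> strip (\<rho> / (4 * pi))"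
  shows "norm (fs a z) \<le> C * (2 + 4 / \<rho>)"
  using exp_decay_infsum(3)[OF exp_decay_ep[OF assms(1,3)]] assms(2) by (simp add: fs_def)

lemma fs_holomorphic:
  assumes "exp_decay C \<rho> a" "\<rho> > 0"
  shows "fs a holomorphic_on strip (\<rho> / (4 * pi))"
proof -
  let ?S = "strip (\<rho> / (4 * pi))"
  have ul: "uniform_limit ?S (\<lambda>X z. \<Sum>k\<in>X. a k * ep (of_int k * z)) (fs a) (finite_subsets_at_top UNIV)"
    unfolding fs_def
  proof (rule Weierstrass_m_test_general)
    show "(\<lambda>k. C * exp (- (\<rho> / 2) * \<bar>real_of_int k\<bar>)) summable_on UNIV"
      by (rule summable_on_cmult_right[OF exp_abs_int_summable(1)]) (use assms in auto)
  next
    fix k z assume "z \<in> ?S"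
    from exp_decayD[OF exp_decay_ep[OF assms(1) this]]
    show "norm (a k * ep (of_int k * z)) \<le> C * exp (- (\<rho> / 2) * \<bar>real_of_int k\<bar>)" .
  qed
  have "fs a analytic_on ?S"
    unfolding analytic_on_def
  proof
    fix z assume "z \<in> ?S"
    then obtain r where r: "r > 0" "cball z r \<subseteq> ?S"
      using open_contains_cball[of ?S] by auto
    have "fs a holomorphic_on ball z r"
    proof (rule holomorphic_uniform_limit)
      show "uniform_limit (cball z r) (\<lambda>X z. \<Sum>k\<in>X. a k * ep (of_int k * z)) (fs a) (finite_subsets_at_top UNIV)"
        by (rule uniform_limit_on_subset[OF ul r(2)])
    qed (auto intro!: always_eventually holomorphic_intros holomorphic_on_imp_continuous_on)
    then show "\<exists>e>0. fs a holomorphic_on ball z e" using r by auto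
  qed
  then show ?thesis by (rule analytic_imp_holomorphic)
qed

lemma fs_periodic: "fs a (z + 1) = fs a z"
  unfolding fs_def by (simp add: ring_distribs ep_add)

subsection \<open>Fourier coefficients of functions on a strip\<close>

lemma has_sum_diff:
  fixes f g :: "'a \<Rightarrow> 'b::{topological_ab_group_add}"
  assumes "(f has_sum a) A" "(g has_sum b) A"
  shows "((\<lambda>x. f x - g x) has_sum (a - b)) A"
proof -
  have "((\<lambda>x. - g x) has_sum - b) A" using assms(2) by (simp add: has_sum_uminus)
  from has_sum_add[OF assms(1) this] show ?thesis by simp
qed

text \<open>With a primitive P the integral over a segment of length one is P (z + 1) - P z, whose
  derivative vanishes by periodicity; on the convex set of admissible z it is therefore constant.
  Contours can thus be shifted vertically without a rectangle whose sides have to cancel.\<close>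

lemma contour_integral_period_constant:
  assumes S: "convex S" "open S" and F: "F holomorphic_on S"
    and per: "\<And>w. w \<in> S \<Longrightarrow> w + 1 \<in> S \<Longrightarrow> F (w + 1) = F w"
    and w: "w \<in> S" "w + 1 \<in> S" and w': "w' \<in> S" "w' + 1 \<in> S"
  shows "contour_integral (linepath w (w + 1)) F = contour_integral (linepath w' (w' + 1)) F"
proof -
  obtain P where P: "\<And>x. x \<in> S \<Longrightarrow> (P has_field_derivative F x) (at x within S)"
    using holomorphic_convex_primitive'[OF S F] by blast
  have P': "(P has_field_derivative F x) (at x)" if "x \<in> S" for x
    using P[OF that] at_within_open[OF that S(2)] by simp
  have int: "contour_integral (linepath z (z + 1)) F = P (z + 1) - P z" if "z \<in> S" "z + 1 \<in> S" for z
  proof -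
    have "path_image (linepath z (z + 1)) \<subseteq> S"
      using S(1) that by (simp add: closed_segment_subset)
    from contour_integral_primitive[OF P _ this] show ?thesis
      by (intro contour_integral_unique) simp
  qed
  define T where "T = {z \<in> S. z + 1 \<in> S}"
  have T_eq: "T = S \<inter> (\<lambda>z. z - 1) ` S"
    by (auto simp: T_def image_iff algebra_simps)
  have "convex T"
    unfolding T_eq using S(1) convex_translation_subtract[of S 1] by (intro convex_Int) auto
  moreover have "((\<lambda>z. P (z + 1) - P z) has_field_derivative 0) (at x within T)" if "x \<in> T" for x
  proof -
    have x: "x \<in> S" "x + 1 \<in> S" using that by (auto simp: T_def)
    have "((\<lambda>z. P (z + 1)) has_field_derivative F (x + 1)) (at x)"
      using P'[OF x(2)] by (simp add: DERIV_shift)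
    then have "((\<lambda>z. P (z + 1) - P z) has_field_derivative F (x + 1) - F x) (at x)"
      using P'[OF x(1)] by (rule DERIV_diff)
    then show ?thesis using per[OF x] by (simp add: has_field_derivative_at_within)
  qed
  ultimately obtain c where "\<forall>x\<in>T. P (x + 1) - P x = c"
    using has_field_derivative_zero_constant by blast
  then show ?thesis using int w w' by (simp add: T_def)
qed

definition strip_coeff :: "(complex \<Rightarrow> complex) \<Rightarrow> int \<Rightarrow> complex" where
  "strip_coeff f k = contour_integral (linepath 0 1) (\<lambda>w. f w * ep (- of_int k * w))"

lemma periodic_times_ep:
  "f (w + 1) = f w \<Longrightarrow> f (w + 1) * ep (- of_int k * (w + 1)) = f w * ep (- of_int k * w)"
  using ep_of_int[of "- k"] by (simp add: ring_distribs ep_add del: ep_of_int)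
    (metis add.commute diff_conv_add_uminus ep_add mult.right_neutral)

lemma ep_eq_1_iff: "ep z = 1 \<longleftrightarrow> z \<in> \<int>"
proof
  assume "ep z = 1"
  then obtain n :: int where n: "Re (2 * of_real pi * \<i> * z) = 0" "Im (2 * of_real pi * \<i> * z) = of_int (2 * n) * pi"
    unfolding ep_def exp_eq_1 by blast
  then have "Im z = 0" "Re z = of_int n" by auto
  then have "z = of_int n" by (simp add: complex_eq_iff)
  then show "z \<in> \<int>" by simp
qed (auto elim: Ints_cases)

text \<open>The contour is moved to height H/2, to the side on which ep (- k w) decays. Stopping at
  half the width keeps the segment inside the open strip and gives the rate 2 pi H/2.\<close>

lemma norm_strip_coeff_le:
  assumes f: "f holomorphic_on strip H" and per: "\<And>z. z \<in> strip H \<Longrightarrow> f (z + 1) = f z"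
    and bd: "\<And>z. z \<in> strip H \<Longrightarrow> norm (f z) \<le> M" and H: "H > 0"
  shows "exp_decay M (pi * H) (strip_coeff f)"
  unfolding exp_decay_def
proof
  fix k :: int
  let ?F = "\<lambda>w. f w * ep (- of_int k * w)"
  define w where "w = \<i> * of_real (- sgn (real_of_int k) * (H / 2))"
  have Im_w: "Im w = - sgn (real_of_int k) * (H / 2)" by (simp add: w_def)
  have w: "w \<in> strip H" using H by (auto simp: strip_def Im_w sgn_if)
  have F: "?F holomorphic_on strip H" by (intro holomorphic_intros f)
  have "strip_coeff f k = contour_integral (linepath w (w + 1)) ?F"
    unfolding strip_coeff_def
    using contour_integral_period_constant[OF convex_strip open_strip F _ _ _ w, of 0] periodic_times_ep per H w
      of_real_in_strip[of 0 H] of_real_in_strip[of 1 H] by simp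
  also have "norm \<dots> \<le> (M * exp (- (pi * H) * \<bar>real_of_int k\<bar>)) * norm (w + 1 - w)"
  proof (rule contour_integral_bound_linepath)
    have sub: "closed_segment w (w + 1) \<subseteq> strip H"
      by (rule closed_segment_subset) (use w in auto)
    show "?F contour_integrable_on linepath w (w + 1)"
      by (intro contour_integrable_continuous_linepath holomorphic_on_imp_continuous_on holomorphic_on_subset[OF F sub])
    show "0 \<le> M * exp (- (pi * H) * \<bar>real_of_int k\<bar>)"
      using order_trans[OF norm_ge_zero bd[OF w]] by simp
    fix x assume x: "x \<in> closed_segment w (w + 1)"
    then have "Im x = Im w" by (auto simp: closed_segment_def algebra_simps)
    then have "norm (ep (- of_int k * x)) = exp (- (pi * H) * \<bar>real_of_int k\<bar>)"
      by (simp add: norm_ep Im_w abs_sgn mult_ac)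
    then show "norm (?F x) \<le> M * exp (- (pi * H) * \<bar>real_of_int k\<bar>)"
      using bd[of x] x sub by (auto simp: norm_mult intro!: mult_right_mono)
  qed
  finally show "norm (strip_coeff f k) \<le> M * exp (- (pi * H) * \<bar>real_of_int k\<bar>)" by simp
qed

text \<open>Chernoff's argument: with g w = (f w - f z0) / (ep (w - z0) - 1), the k-th term of the
  Fourier series of f at z0 differs from f z0 (for k = 0) or 0 by a telescoping difference of
  coefficients of g.\<close>

lemma fs_strip_coeff:
  assumes f: "f holomorphic_on strip H" and per: "\<And>z. z \<in> strip H \<Longrightarrow> f (z + 1) = f z"
    and bd: "\<And>z. z \<in> strip H \<Longrightarrow> norm (f z) \<le> M" and H: "H > 0" and z0: "z0 \<in> strip (H / 4)"
  shows "fs (strip_coeff f) z0 = f z0"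
proof -
  \<comment> \<open>A window of two periods centred at \<open>z0\<close>: among the zeros z0 + m of
    ep (w - z0) - 1 it contains only \<open>z0\<close> itself.\<close>
  define R where "R = strip H \<inter> ({w. Re w < Re z0 + 1} \<inter> {w. Re w > Re z0 - 1})"
  have R: "convex R" "open R"
    unfolding R_def
    by (auto intro!: convex_Int convex_halfspace_Re_lt convex_halfspace_Re_gt open_Int open_halfspace_Re_lt open_halfspace_Re_gt)
  have z0': "z0 \<in> strip H" "\<bar>Im z0\<bar> < H / 4" using z0 H by (auto simp: strip_def)
  \<comment> \<open>Numerator and denominator of Chernoff's quotient are both divided by w - z0, so
    that the removable singularity at \<open>z0\<close> disappears and \<open>g\<close> is
    holomorphic on all of \<open>R\<close>.\<close>
  define s where "s w = (if w = z0 then deriv f z0 else (f w - f z0) / (w - z0))" for w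
  define t where "t w = (if w = z0 then deriv (\<lambda>w. ep (w - z0)) z0 else (ep (w - z0) - ep (z0 - z0)) / (w - z0))" for w
  have s: "s holomorphic_on strip H"
    unfolding s_def by (rule pole_lemma[OF f]) (use z0' in \<open>simp add: interior_open\<close>)
  have t: "t holomorphic_on strip H"
    unfolding t_def by (rule pole_lemma) (use z0' in \<open>auto simp: interior_open intro!: holomorphic_intros\<close>)
  have "((\<lambda>w. ep (w - z0)) has_field_derivative 2 * of_real pi * \<i>) (at z0)"
    unfolding ep_def by (auto intro!: derivative_eq_intros)
  then have dz: "deriv (\<lambda>w. ep (w - z0)) z0 \<noteq> 0" by (simp add: DERIV_imp_deriv)
  have ne1: "ep (w - z0) \<noteq> 1" if "w \<in> R" "w \<noteq> z0" for w
  proof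
    assume "ep (w - z0) = 1"
    then obtain n :: int where n: "w - z0 = of_int n" by (auto simp: ep_eq_1_iff elim: Ints_cases)
    then have "Re w - Re z0 = of_int n" by (metis Re_complex_of_real minus_complex.simps(1) of_real_of_int_eq)
    moreover have "\<bar>Re w - Re z0\<bar> < 1" using that(1) by (auto simp: R_def)
    ultimately have "n = 0" by linarith
    with n that(2) show False by simp
  qed
  have t_ne: "t w \<noteq> 0" if "w \<in> R" for w
    using ne1[OF that] dz by (auto simp: t_def)
  define g where "g w = s w / t w" for w
  have g: "g holomorphic_on R"
    unfolding g_def using t_ne
    by (intro holomorphic_on_divide holomorphic_on_subset[OF s] holomorphic_on_subset[OF t]) (auto simp: R_def)
  have g_eq: "g w * (ep (w - z0) - 1) = f w - f z0" if "w \<in> R" for w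
    using ne1[OF that] t_ne[OF that] by (auto simp: g_def s_def t_def)
  have g_per: "g (w + 1) = g w" if "w \<in> R" "w + 1 \<in> R" for w
  proof -
    have "w \<noteq> z0" using that by (auto simp: R_def)
    then have ne: "ep (w - z0) \<noteq> 1" using ne1 that by blast
    have "ep (w + 1 - z0) = ep (w - z0)"
      using ep_add[of "w - z0" 1] ep_of_int[of 1] by (simp add: algebra_simps del: ep_of_int)
    moreover have "f (w + 1) = f w" using per that by (auto simp: R_def)
    ultimately have "g (w + 1) * (ep (w - z0) - 1) = g w * (ep (w - z0) - 1)"
      using g_eq[OF that(1)] g_eq[OF that(2)] by simp
    with ne show ?thesis by simp
  qed
  \<comment> \<open>Left end of a unit segment centred at height y above \<open>z0\<close>; it stays
    at horizontal distance at most 1/2 from \<open>z0\<close>, hence inside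
    \<open>R\<close>.\<close>
  define line where "line y = z0 - 1 / 2 + \<i> * of_real y" for y
  have line: "line y \<in> R" "line y + 1 \<in> R" if "\<bar>y\<bar> \<le> H / 2" for y
    using that z0' H by (auto simp: line_def R_def strip_def)
  have seg: "closed_segment (line y) (line y + 1) \<subseteq> R" if "\<bar>y\<bar> \<le> H / 2" for y
    by (rule closed_segment_subset) (use line[OF that] R in auto)
  define G where "G k w = g w * ep (- of_int k * w)" for k :: int and w
  have G: "G k holomorphic_on R" for k
    unfolding G_def by (intro holomorphic_intros g)
  have G_per: "G k (w + 1) = G k w" if "w \<in> R" "w + 1 \<in> R" for k w
    unfolding G_def by (rule periodic_times_ep) (rule g_per[OF that])
  define gh where "gh k = contour_integral (linepath (line 0) (line 0 + 1)) (G k)" for k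
  have gh: "gh k = contour_integral (linepath (line y) (line y + 1)) (G k)" if "\<bar>y\<bar> \<le> H / 2" for k y
    unfolding gh_def by (rule contour_integral_period_constant[OF R G G_per]) (use line[OF that] line[of 0] H in auto)
  have G_int: "G k contour_integrable_on linepath (line y) (line y + 1)" if "\<bar>y\<bar> \<le> H / 2" for k y
    by (intro contour_integrable_continuous_linepath holomorphic_on_imp_continuous_on holomorphic_on_subset[OF G seg] that)
  \<comment> \<open>The factor ep (k z0) compensates the height of \<open>z0\<close>: only the
    vertical distance between contour and \<open>z0\<close> matters, and it may be H/2 in either
    direction. This makes \<open>T\<close> summable, so that the telescoping differences add up to
    0.\<close>
  define T where "T k = ep (of_int k * z0) * gh k" for k
  obtain B where B: "\<And>y w. y \<in> {H / 2, 0, - (H / 2)} \<Longrightarrow> w \<in> closed_segment (line y) (line y + 1) \<Longrightarrow> norm (g w) \<le> B"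
  proof -
    let ?K = "\<Union>y\<in>{H / 2, 0, - (H / 2)}. closed_segment (line y) (line y + 1)"
    have "compact ?K" by (rule compact_UN) auto
    moreover have "continuous_on ?K g"
      by (rule holomorphic_on_imp_continuous_on[OF holomorphic_on_subset[OF g]]) (use seg H in auto)
    ultimately have "bounded (g ` ?K)"
      by (intro compact_imp_bounded compact_continuous_image)
    then obtain B where "\<forall>x\<in>g ` ?K. norm x \<le> B" by (auto simp: bounded_iff)
    then show ?thesis by (intro that[of B]) auto
  qed
  have T: "exp_decay B (pi * H) T"
    unfolding exp_decay_def
  proof
    fix k :: int
    define y where "y = - sgn (real_of_int k) * (H / 2)"
    have y: "\<bar>y\<bar> \<le> H / 2" "y \<in> {H / 2, 0, - (H / 2)}" using H by (auto simp: y_def sgn_if)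
    have "norm (ep (of_int k * z0) * gh k) = norm (contour_integral (linepath (line y) (line y + 1)) (\<lambda>w. ep (of_int k * z0) * G k w))"
      by (simp add: gh[OF y(1)] contour_integral_lmul[OF G_int[OF y(1)]])
    also have "\<dots> \<le> (B * exp (- (pi * H) * \<bar>real_of_int k\<bar>)) * norm (line y + 1 - line y)"
    proof (rule contour_integral_bound_linepath)
      show "(\<lambda>w. ep (of_int k * z0) * G k w) contour_integrable_on linepath (line y) (line y + 1)"
        by (rule contour_integrable_lmul[OF G_int[OF y(1)]])
      show "0 \<le> B * exp (- (pi * H) * \<bar>real_of_int k\<bar>)"
        using order_trans[OF norm_ge_zero B[OF y(2), of "line y"]] by auto
      fix x assume x: "x \<in> closed_segment (line y) (line y + 1)"
      then have "Im x = Im (line y)" by (auto simp: closed_segment_def algebra_simps)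
      then have "Im x - Im z0 = y" by (simp add: line_def)
      then have "norm (ep (of_int k * z0)) * norm (ep (- of_int k * x)) = exp (2 * pi * (of_int k * y))"
        by (simp add: norm_ep exp_add[symmetric] algebra_simps)
      also have "\<dots> = exp (- (pi * H) * \<bar>real_of_int k\<bar>)"
        by (simp add: y_def abs_sgn mult_ac)
      finally show "norm (ep (of_int k * z0) * G k x) \<le> B * exp (- (pi * H) * \<bar>real_of_int k\<bar>)"
        using B[OF y(2) x] by (simp add: G_def norm_mult mult_ac mult_left_mono mult_right_mono)
    qed
    finally show "norm (T k) \<le> B * exp (- (pi * H) * \<bar>real_of_int k\<bar>)" by (simp add: T_def)
  qed
  have coeff: "strip_coeff f k * ep (of_int k * z0) = (if k = 0 then f z0 else 0) + (T (k - 1) - T k)" for k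
  proof -
    let ?F = "\<lambda>w. f w * ep (- of_int k * w)"
    have F: "?F holomorphic_on strip H" by (intro holomorphic_intros f)
    have l0: "line 0 \<in> R" "line 0 + 1 \<in> R" using line[of 0] H by auto
    have segS: "closed_segment (line 0) (line 0 + 1) \<subseteq> strip H"
      using seg[of 0] H by (auto simp: R_def)
    have "strip_coeff f k = contour_integral (linepath (line 0) (line 0 + 1)) ?F"
      unfolding strip_coeff_def
      using contour_integral_period_constant[OF convex_strip open_strip F, of 0 "line 0"] periodic_times_ep per H l0
        of_real_in_strip[of 0 H] of_real_in_strip[of 1 H] by (simp add: R_def)
    also have "\<dots> = contour_integral (linepath (line 0) (line 0 + 1))
        (\<lambda>w. f z0 * ep (- of_int k * w) + (ep (- z0) * G (k - 1) w - G k w))"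
    proof (rule contour_integral_cong)
      fix w assume "w \<in> path_image (linepath (line 0) (line 0 + 1))"
      then have w: "w \<in> R" using seg[of 0] H by auto
      have 1: "f w = f z0 + g w * (ep (w - z0) - 1)" using g_eq[OF w] by simp
      have 2: "ep (w - z0) * ep (- of_int k * w) = ep (- z0) * ep (- of_int (k - 1) * w)"
        by (simp add: ep_add[symmetric] algebra_simps)
      have "?F w = f z0 * ep (- of_int k * w) + (g w * (ep (w - z0) * ep (- of_int k * w)) - g w * ep (- of_int k * w))"
        unfolding 1 by (simp only: ring_distribs mult.assoc mult_1_left)
      then show "?F w = f z0 * ep (- of_int k * w) + (ep (- z0) * G (k - 1) w - G k w)"
        unfolding 2 G_def by (simp only: mult_ac)
    qed simp
    also have "\<dots> = contour_integral (linepath (line 0) (line 0 + 1)) (\<lambda>w. f z0 * ep (- of_int k * w))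
        + (ep (- z0) * gh (k - 1) - gh k)"
    proof -
      have 1: "(\<lambda>w. f z0 * ep (- of_int k * w)) contour_integrable_on linepath (line 0) (line 0 + 1)"
        by (intro contour_integrable_continuous_linepath holomorphic_on_imp_continuous_on holomorphic_intros)
      have 2: "G k contour_integrable_on linepath (line 0) (line 0 + 1)" for k
        using G_int[of 0] H by simp
      show ?thesis unfolding gh_def
        by (rule contour_integral_unique, rule has_contour_integral_add, rule has_contour_integral_integral[OF 1],
            rule has_contour_integral_diff, rule has_contour_integral_lmul)
           (rule has_contour_integral_integral[OF 2])+
    qed
    also have "contour_integral (linepath (line 0) (line 0 + 1)) (\<lambda>w. f z0 * ep (- of_int k * w))
        = (if k = 0 then f z0 else 0)"
    proof (cases "k = 0")
      case False
      define c where "c = - (2 * of_real pi * \<i> * of_int k :: complex)"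
      have "c \<noteq> 0" using False by (simp add: c_def)
      have ev: "ep (- of_int k * w) = exp (c * w)" for w by (simp add: c_def ep_def mult_ac)
      have "((\<lambda>w. f z0 * exp (c * w)) has_contour_integral
          (f z0 * exp (c * (pathfinish (linepath (line 0) (line 0 + 1)))) / c
           - f z0 * exp (c * (pathstart (linepath (line 0) (line 0 + 1)))) / c)) (linepath (line 0) (line 0 + 1))"
        by (rule contour_integral_primitive[of UNIV]) (use \<open>c \<noteq> 0\<close> in \<open>auto intro!: derivative_eq_intros\<close>)
      moreover have "exp (c * (line 0 + 1)) = exp (c * line 0)"
        unfolding ev[symmetric] using periodic_times_ep[of "\<lambda>_. 1" "line 0" k] by simp
      ultimately show ?thesis using False by (simp add: ev[symmetric] contour_integral_unique)
    qed simp
    finally have fin: "strip_coeff f k = (if k = 0 then f z0 else 0) + (ep (- z0) * gh (k - 1) - gh k)" .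
    have E: "ep (of_int k * z0) * ep (- z0) = ep (of_int (k - 1) * z0)"
      by (simp add: ep_add[symmetric] algebra_simps)
    have "strip_coeff f k * ep (of_int k * z0) = (if k = 0 then f z0 else 0) * ep (of_int k * z0)
        + ((ep (of_int k * z0) * ep (- z0)) * gh (k - 1) - ep (of_int k * z0) * gh k)"
      unfolding fin by (simp only: ring_distribs mult_ac)
    then show ?thesis unfolding E T_def by simp
  qed
  have "pi * H > 0" using H by simp
  then obtain S where S: "(T has_sum S) UNIV"
    using exp_decay_infsum(2)[OF T] by (auto simp: summable_on_def)
  then have S': "((\<lambda>k. T (k - 1)) has_sum S) UNIV"
    by (simp add: has_sum_reindex_bij_witness[of UNIV "\<lambda>k. k + 1" "\<lambda>k. k - 1" UNIV T])
  have "((\<lambda>k::int. if k = 0 then f z0 else 0) has_sum f z0) UNIV"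
    by (rule has_sum_finite_neutralI[of "{0}"]) auto
  from has_sum_add[OF this has_sum_diff[OF S' S]]
  have "((\<lambda>k. strip_coeff f k * ep (of_int k * z0)) has_sum f z0) UNIV"
    by (simp add: coeff)
  then show ?thesis unfolding fs_def by (rule infsumI)
qed

section \<open>Continuation of analytic functions on the circle to strips\<close>

lemma analytic_zero_from_reals:
  assumes f: "f holomorphic_on S" and S: "open S" "connected S" and r: "r > 0"
    and sub: "\<And>x::real. \<bar>x\<bar> < r \<Longrightarrow> of_real x \<in> S \<and> f (of_real x) = 0" and w: "w \<in> S"
  shows "f w = 0"
proof (rule analytic_continuation[OF f S])
  show "of_real ` {-r<..<r} \<subseteq> S" using sub by auto
  show "(0::complex) \<in> S" using sub[of 0] r by simp
  show "(0::complex) islimpt of_real ` {-r<..<r}"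
    unfolding islimpt_approachable
  proof (intro allI impI)
    fix e :: real assume "e > 0"
    define x where "x = min (e / 2) (r / 2)"
    have "x > 0" "x < e" "x < r" using \<open>e > 0\<close> r by (auto simp: x_def)
    then show "\<exists>x'\<in>complex_of_real ` {-r<..<r}. x' \<noteq> 0 \<and> dist x' 0 < e"
      by (intro bexI[of _ "of_real x"]) auto
  qed
qed (use sub w in auto)

text \<open>The neighbourhood of the line on which the given extension is holomorphic may become
  thin at infinity. Compactness gives a uniform width over [-1, 2], and the periodic continuation of
  this piece is holomorphic and bounded on a whole strip.\<close>

lemma analytic_circle_periodic_strip:
  assumes "analytic_circle f"
  obtains H F where "H > 0" "F holomorphic_on strip H" "\<And>z. F (z + 1) = F z"
    "bounded (F ` strip H)" "\<And>x. F (of_real x) = f x"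
proof -
  from assms obtain F where per: "\<And>x. f (x + 1) = f x" and F: "F analytic_on \<real>" "\<And>x. F (of_real x) = f x"
    by (auto simp: analytic_circle_def)
  from F(1) obtain S where S: "open S" "\<real> \<subseteq> S" "F holomorphic_on S"
    by (auto simp: analytic_on_holomorphic)
  have "compact (closed_segment (-1) 2 :: complex set)" by simp
  moreover have seg_eq: "closed_segment (-1) (2::complex) = of_real ` {-1..2}"
    using closed_segment_of_real[of "-1" 2, where ?'a = complex] by (simp add: closed_segment_eq_real_ivl)
  have Re_seg: "of_real x \<in> closed_segment (-1) (2::complex)" if "-1 \<le> x" "x \<le> 2" for x
    using that by (auto simp: seg_eq)
  have "closed_segment (-1) (2::complex) \<subseteq> S"
    using S(2) by (auto simp: seg_eq subset_iff)
  ultimately obtain e where e: "e > 0" "(\<Union>x\<in>closed_segment (-1) 2. cball x e) \<subseteq> S"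
    using compact_subset_open_imp_cball_epsilon_subset[of "closed_segment (-1) 2" S] S(1) by metis
  define D where "D = strip e \<inter> ({z. Re z < 2} \<inter> {z. Re z > -1})"
  have in_S: "z \<in> S" if "-1 \<le> Re z" "Re z \<le> 2" "\<bar>Im z\<bar> \<le> e" for z
  proof -
    have "dist (of_real (Re z)) z = \<bar>Im z\<bar>"
      by (simp add: dist_norm cmod_def)
    then have "z \<in> cball (of_real (Re z)) e" using that by simp
    then show ?thesis using e Re_seg that by blast
  qed
  have FD: "F holomorphic_on D" by (rule holomorphic_on_subset[OF S(3)]) (auto simp: D_def strip_def intro!: in_S)
  have openD: "open D" unfolding D_def by (intro open_Int open_strip open_halfspace_Re_lt open_halfspace_Re_gt)
  define D1 where "D1 = strip e \<inter> ({z. Re z < 1} \<inter> {z. Re z > -1})"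
  have D1: "open D1" "convex D1" unfolding D1_def
    by (auto intro!: open_Int open_halfspace_Re_lt open_halfspace_Re_gt convex_Int convex_halfspace_Re_lt convex_halfspace_Re_gt)
  have F_per: "F (z + 1) = F z" if "z \<in> D1" for z
  proof -
    have "F (z + 1) - F z = 0"
    proof (rule analytic_zero_from_reals[OF _ D1(1) convex_connected[OF D1(2)] _ _ that])
      have "(F \<circ> (\<lambda>z. z + 1)) holomorphic_on D1"
        by (rule holomorphic_on_compose_gen[OF _ FD]) (auto simp: D_def D1_def intro!: holomorphic_intros)
      then show "(\<lambda>z. F (z + 1) - F z) holomorphic_on D1"
        by (intro holomorphic_on_diff holomorphic_on_subset[OF FD]) (auto simp: o_def D_def D1_def)
      show "of_real x \<in> D1 \<and> F (of_real x + 1) - F (of_real x) = 0" if "\<bar>x\<bar> < 1" for x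
        using that e F(2)[of "x + 1"] F(2)[of x] per[of x] by (auto simp: D1_def)
    qed simp
    then show ?thesis by simp
  qed
  define G where "G z = F (z - of_int \<lfloor>Re z\<rfloor>)" for z
  have G_per: "G (z + 1) = G z" for z
    by (simp add: G_def algebra_simps)
  \<comment> \<open>The jumps of the floor function are harmless: over an interval of length three
    around [k, k + 1], \<open>F_per\<close> identifies the neighbouring translates of
    \<open>F\<close>, so that \<open>G\<close> agrees locally with a single translate.\<close>
  have G_loc: "G z = F (z - of_int k)" if "z \<in> strip e" "of_int k - 1 < Re z" "Re z < of_int k + 2" for z k
  proof -
    have "\<lfloor>Re z\<rfloor> = k - 1 \<or> \<lfloor>Re z\<rfloor> = k \<or> \<lfloor>Re z\<rfloor> = k + 1" using that by linarith
    moreover have "\<lfloor>Re z\<rfloor> = k - 1 \<Longrightarrow> z - of_int k \<in> D1" using that by (auto simp: D1_def strip_def) linarith+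
    moreover have "\<lfloor>Re z\<rfloor> = k + 1 \<Longrightarrow> z - of_int k - 1 \<in> D1" using that by (auto simp: D1_def strip_def) linarith+
    ultimately show ?thesis using F_per[of "z - of_int k"] F_per[of "z - of_int k - 1"]
      by (auto simp: G_def algebra_simps)
  qed
  have "G holomorphic_on strip e"
    unfolding holomorphic_on_def
  proof
    fix z assume z: "z \<in> strip e"
    define k where "k = \<lfloor>Re z\<rfloor>"
    define T where "T = strip e \<inter> ({w. Re w < of_int k + 2} \<inter> {w. Re w > of_int k - 1})"
    have T: "open T" "z \<in> T" using z
      by (auto simp: T_def k_def intro!: open_Int open_halfspace_Re_lt open_halfspace_Re_gt) linarith+
    have "(F \<circ> (\<lambda>z. z - of_int k)) holomorphic_on T"
      by (rule holomorphic_on_compose_gen[OF _ FD]) (auto simp: D_def T_def strip_def intro!: holomorphic_intros)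
    then have "G holomorphic_on T"
      by (rule holomorphic_transform) (auto simp: T_def G_loc)
    then show "G field_differentiable at z within strip e"
      using T holomorphic_on_imp_differentiable_at field_differentiable_at_within by blast
  qed
  moreover have "bounded (G ` strip e)"
  proof -
    define K where "K = cbox (Complex 0 (-e)) (Complex 1 e)"
    have "F ` K = F ` K" ..
    have "continuous_on K F"
      by (rule holomorphic_on_imp_continuous_on[OF holomorphic_on_subset[OF S(3)]])
         (auto simp: K_def in_cbox_complex_iff intro!: in_S)
    then have "bounded (F ` K)"
      by (intro compact_imp_bounded compact_continuous_image) (auto simp: K_def)
    moreover have "G ` strip e \<subseteq> F ` K"
    proof
      fix y assume "y \<in> G ` strip e"
      then obtain z where z: "z \<in> strip e" "y = F (z - of_int \<lfloor>Re z\<rfloor>)" by (auto simp: G_def)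
      have "z - of_int \<lfloor>Re z\<rfloor> \<in> K"
        using z(1) by (auto simp: K_def in_cbox_complex_iff strip_def) linarith
      then show "y \<in> F ` K" using z by blast
    qed
    ultimately show ?thesis by (rule bounded_subset)
  qed
  moreover have "G (of_real x) = f x" for x
  proof -
    have "f (y + of_nat n) = f y" for n y
      by (induction n) (auto simp: per add.assoc[symmetric] add.commute[of 1])
    then have "f (y + of_int k) = f y" for k y
      by (cases k rule: int_cases2) (use \<open>\<And>n y. f (y + of_nat n) = f y\<close> in \<open>auto\<close>, metis diff_add_cancel)
    from this[of "x - of_int \<lfloor>x\<rfloor>" "\<lfloor>x\<rfloor>"] show ?thesis
      using F(2)[of "x - of_int \<lfloor>x\<rfloor>"] by (simp add: G_def)
  qed
  ultimately show ?thesis using that e(1) G_per by blast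
qed

lemma fourier_coeff_decay:
  assumes "analytic_circle (\<lambda>x. complex_of_real (v x))"
  obtains C \<rho> where "\<rho> > 0" "exp_decay C \<rho> (fourier_coeff v)"
    "\<And>x. fs (fourier_coeff v) (of_real x) = of_real (v x)"
proof -
  obtain H F where H: "H > 0" and F: "F holomorphic_on strip H" "\<And>z. F (z + 1) = F z"
    "bounded (F ` strip H)" "\<And>x. F (of_real x) = of_real (v x)"
    using analytic_circle_periodic_strip[OF assms] by metis
  obtain M where M: "\<And>z. z \<in> strip H \<Longrightarrow> norm (F z) \<le> M"
    using F(3) by (auto simp: bounded_iff)
  have eq: "strip_coeff F = fourier_coeff v"
  proof
    fix k
    let ?f = "\<lambda>w. F w * ep (- of_int k * w)"
    have hol: "?f holomorphic_on strip H" by (intro holomorphic_intros F(1))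
    have "closed_segment 0 1 \<subseteq> strip H"
      using of_real_in_strip[of 0 H] of_real_in_strip[of 1 H] H by (simp add: closed_segment_subset)
    then have "?f contour_integrable_on linepath 0 1"
      by (intro contour_integrable_continuous_linepath holomorphic_on_imp_continuous_on holomorphic_on_subset[OF hol])
    then have "(?f has_contour_integral strip_coeff F k) (linepath 0 1)"
      unfolding strip_coeff_def by (rule has_contour_integral_integral)
    then have "((\<lambda>x. ?f (of_real x)) has_integral strip_coeff F k) {0..1}"
      by (subst (asm) has_contour_integral_linepath_Reals_iff) auto
    moreover have "?f (of_real x) = of_real (v x) * exp (- (2 * of_real pi * \<i> * of_int k * of_real x))" for x
      by (simp add: F(4) ep_def mult_ac)
    ultimately show "strip_coeff F k = fourier_coeff v k"
      unfolding fourier_coeff_def by (simp add: integral_unique)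
  qed
  show ?thesis
  proof (rule that)
    show "exp_decay M (pi * H) (fourier_coeff v)"
      unfolding eq[symmetric] by (rule norm_strip_coeff_le[OF F(1,2) M H])
    show "fs (fourier_coeff v) (of_real x) = of_real (v x)" for x
      unfolding eq[symmetric] F(4)[symmetric] by (rule fs_strip_coeff[OF F(1,2) M H]) (use H in auto)
  qed (use H in simp)
qed

subsection \<open>Strip norms and conjugacies\<close>

lemma strip_ext_eq:
  assumes F: "is_strip_ext \<epsilon> f F" and \<epsilon>: "\<epsilon> > 0" and z: "z \<in> strip \<epsilon>"
  shows "strip_ext \<epsilon> f z = F z"
proof -
  have G: "is_strip_ext \<epsilon> f (strip_ext \<epsilon> f)"
    unfolding strip_ext_def by (rule someI[where P = "is_strip_ext \<epsilon> f", OF F])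
  have "strip_ext \<epsilon> f z - F z = 0"
    by (rule analytic_zero_from_reals[OF _ open_strip convex_connected[OF convex_strip] zero_less_one _ z])
       (use F G \<epsilon> in \<open>auto simp: is_strip_ext_def intro!: holomorphic_intros\<close>)
  then show ?thesis by simp
qed

lemma is_strip_extI:
  assumes "F holomorphic_on strip \<epsilon>" "\<And>z. z \<in> strip \<epsilon> \<Longrightarrow> norm (F z) \<le> B" "\<And>x. F (of_real x) = f x"
  shows "is_strip_ext \<epsilon> f F"
  using assms by (auto simp: is_strip_ext_def bounded_iff)

lemma strip_norm_le:
  assumes "F holomorphic_on strip \<epsilon>" "\<And>z. z \<in> strip \<epsilon> \<Longrightarrow> norm (F z) \<le> B" "\<And>x. F (of_real x) = f x"
    and "\<epsilon> > 0"
  shows "extends_to_strip \<epsilon> f" "strip_norm \<epsilon> f \<le> B"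
proof -
  note F = is_strip_extI[of F \<epsilon> B f, OF assms(1-3)]
  then show "extends_to_strip \<epsilon> f" by (auto simp: extends_to_strip_def)
  have "strip \<epsilon> \<noteq> {}" using of_real_in_strip[of 0 \<epsilon>] assms(4) by auto
  then show "strip_norm \<epsilon> f \<le> B"
    unfolding strip_norm_def by (rule cSUP_least) (use assms F strip_ext_eq in simp)
qed

lemma norm_matrix_vector_mult_le:
  fixes M :: "complex^2^2"
  assumes "\<And>i k. norm (M $ i $ k) \<le> B"
  shows "norm (M *v x) \<le> 4 * B * norm x"
proof -
  have B: "B \<ge> 0" using order_trans[OF norm_ge_zero assms] .
  have "norm ((M *v x) $ i) \<le> 2 * (B * norm x)" for i
  proof -
    have "norm ((M *v x) $ i) \<le> (\<Sum>j\<in>UNIV. norm (M $ i $ j * x $ j))"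
      unfolding matrix_vector_mult_def by (simp add: norm_sum)
    also have "\<dots> \<le> (\<Sum>j\<in>(UNIV::2 set). B * norm x)"
      unfolding norm_mult by (intro sum_mono mult_mono assms Finite_Cartesian_Product.norm_nth_le) (use B in auto)
    finally show ?thesis by simp
  qed
  then have "(\<Sum>i\<in>UNIV. norm ((M *v x) $ i)) \<le> (\<Sum>i\<in>(UNIV::2 set). 2 * (B * norm x))"
    by (intro sum_mono)
  moreover have "norm (M *v x) \<le> (\<Sum>i\<in>UNIV. norm ((M *v x) $ i))"
    unfolding norm_vec_def by (rule L2_set_le_sum) simp
  ultimately show ?thesis by simp
qed

text \<open>The factor 4 is the crude passage from entries of a 2 x 2 matrix to its operator
  norm.\<close>

lemma mat_strip_norm_le:
  fixes M :: "real \<Rightarrow> complex^2^2"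
  assumes "\<And>i k. F i k holomorphic_on strip \<epsilon>" "\<And>i k z. z \<in> strip \<epsilon> \<Longrightarrow> norm (F i k z) \<le> B"
    "\<And>i k x. F i k (of_real x) = M x $ i $ k" and "\<epsilon> > 0"
  shows "mat_extends_to_strip \<epsilon> M" "mat_strip_norm \<epsilon> M \<le> 4 * B"
proof -
  have F: "is_strip_ext \<epsilon> (\<lambda>x. M x $ i $ k) (F i k)" for i k
    by (rule is_strip_extI) (use assms in auto)
  then show "mat_extends_to_strip \<epsilon> M"
    by (auto simp: mat_extends_to_strip_def extends_to_strip_def)
  have "strip \<epsilon> \<noteq> {}" using of_real_in_strip[of 0 \<epsilon>] assms(4) by auto
  then show "mat_strip_norm \<epsilon> M \<le> 4 * B"
    unfolding mat_strip_norm_def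
  proof (rule cSUP_least)
    fix z assume z: "z \<in> strip \<epsilon>"
    show "onorm ((*v) (\<chi> i j. strip_ext \<epsilon> (\<lambda>x. M x $ i $ j) z)) \<le> 4 * B"
      by (rule onorm_le, rule norm_matrix_vector_mult_le)
         (use strip_ext_eq[OF F assms(4) z] assms(2)[OF z] in simp)
  qed
qed

lemma analytic_circleI:
  assumes "F holomorphic_on strip \<epsilon>" "\<epsilon> > 0" "\<And>x. F (of_real x) = f x" "\<And>x. F (of_real x + 1) = F (of_real x)"
  shows "analytic_circle f"
  unfolding analytic_circle_def
proof (intro conjI exI)
  show "F analytic_on \<real>"
    by (rule analytic_on_subset[of _ "strip \<epsilon>"]) (use assms in \<open>auto simp: analytic_on_open elim!: Reals_cases\<close>)
  show "\<forall>x. f (x + 1) = f x" using assms(4) by (metis assms(3) of_real_1 of_real_add)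
qed (use assms in auto)

lemma mat2_nth [simp]:
  "mat2 a b c d $ 1 $ 1 = a" "mat2 a b c d $ 1 $ 2 = b" "mat2 a b c d $ 2 $ 1 = c" "mat2 a b c d $ 2 $ 2 = d"
  by (simp_all add: mat2_def)

text \<open>The conclusion of the theorem with strip width h and the three bounds as free
  parameters. Different ranges of resonances give it with different constants, which
  \<open>conjugable_mono\<close> then unifies.\<close>

definition conjugable :: "(real \<Rightarrow> real) \<Rightarrow> real \<Rightarrow> real \<Rightarrow> real \<Rightarrow> real \<Rightarrow> real \<Rightarrow> real \<Rightarrow> real \<Rightarrow> real \<Rightarrow> bool" where
  "conjugable v lam \<alpha> E \<theta> h B \<beta> b \<longleftrightarrow>
     (\<exists>(\<Phi> :: real \<Rightarrow> complex^2^2) q1 q q3 q4.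
          (\<forall>i k. analytic_circle (\<lambda>x. \<Phi> x $ i $ k)) \<and>
          (\<forall>x. det (\<Phi> x) = 1) \<and>
          mat_extends_to_strip h \<Phi> \<and> mat_strip_norm h \<Phi> \<le> B \<and>
          (\<forall>x. \<Phi> (x + \<alpha>) ** schroedinger_cocycle v lam E x ** matrix_inv (\<Phi> x) =
             mat2 (exp (2 * of_real pi * \<i> * of_real \<theta>)) 0 0 (exp (- (2 * of_real pi * \<i> * of_real \<theta>)))
             + mat2 (q1 x) (q x) (q3 x) (q4 x)) \<and>
          extends_to_strip h q1 \<and> strip_norm h q1 \<le> \<beta> \<and>
          extends_to_strip h q3 \<and> strip_norm h q3 \<le> \<beta> \<and>
          extends_to_strip h q4 \<and> strip_norm h q4 \<le> \<beta> \<and>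
          extends_to_strip h q \<and> strip_norm h q \<le> b)"

lemma conjugable_mono:
  assumes "conjugable v lam \<alpha> E \<theta> h B \<beta> b" "B \<le> B'" "\<beta> \<le> \<beta>'" "b \<le> b'"
  shows "conjugable v lam \<alpha> E \<theta> h B' \<beta>' b'"
proof -
  from assms(1) show ?thesis
    unfolding conjugable_def
    apply (elim exE)
    subgoal for \<Phi> q1 q q3 q4
      by (rule exI[of _ \<Phi>], rule exI[of _ q1], rule exI[of _ q], rule exI[of _ q3], rule exI[of _ q4])
         (use assms(2-4) in auto)
    done
qed

text \<open>The conjugacy equation is multiplied by \<Phi> x from the right and written out
  entrywise, so that the hypotheses contain no inverse matrix; the determinant condition restores
  it.\<close>

lemma conjugation_from_strip_functions:
  fixes P11 P12 P21 P22 Q1 Q Q3 Q4 :: "complex \<Rightarrow> complex"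
  assumes \<epsilon>: "\<epsilon> > 0"
    and hol: "P11 holomorphic_on strip \<epsilon>" "P12 holomorphic_on strip \<epsilon>" "P21 holomorphic_on strip \<epsilon>" "P22 holomorphic_on strip \<epsilon>"
      "Q1 holomorphic_on strip \<epsilon>" "Q holomorphic_on strip \<epsilon>" "Q3 holomorphic_on strip \<epsilon>" "Q4 holomorphic_on strip \<epsilon>"
    and per: "\<And>z. P11 (z + 1) = P11 z" "\<And>z. P12 (z + 1) = P12 z" "\<And>z. P21 (z + 1) = P21 z" "\<And>z. P22 (z + 1) = P22 z"
    and bdP: "\<And>z. z \<in> strip \<epsilon> \<Longrightarrow> norm (P11 z) \<le> B" "\<And>z. z \<in> strip \<epsilon> \<Longrightarrow> norm (P12 z) \<le> B"
      "\<And>z. z \<in> strip \<epsilon> \<Longrightarrow> norm (P21 z) \<le> B" "\<And>z. z \<in> strip \<epsilon> \<Longrightarrow> norm (P22 z) \<le> B" and B': "4 * B \<le> B'"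
    and bdQ: "\<And>z. z \<in> strip \<epsilon> \<Longrightarrow> norm (Q1 z) \<le> \<beta>" "\<And>z. z \<in> strip \<epsilon> \<Longrightarrow> norm (Q3 z) \<le> \<beta>"
      "\<And>z. z \<in> strip \<epsilon> \<Longrightarrow> norm (Q4 z) \<le> \<beta>" "\<And>z. z \<in> strip \<epsilon> \<Longrightarrow> norm (Q z) \<le> b"
    and det: "\<And>x::real. P11 x * P22 x - P12 x * P21 x = 1"
    and conj: "\<And>x::real. P11 (x + \<alpha>) * (E - lam * v x) + P12 (x + \<alpha>) = (ep \<theta> + Q1 x) * P11 x + Q x * P21 x"
      "\<And>x::real. - P11 (x + \<alpha>) = (ep \<theta> + Q1 x) * P12 x + Q x * P22 x"
      "\<And>x::real. P21 (x + \<alpha>) * (E - lam * v x) + P22 (x + \<alpha>) = Q3 x * P11 x + (ep (-\<theta>) + Q4 x) * P21 x"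
      "\<And>x::real. - P21 (x + \<alpha>) = Q3 x * P12 x + (ep (-\<theta>) + Q4 x) * P22 x"
  shows "conjugable v lam \<alpha> E \<theta> \<epsilon> B' \<beta> b"
proof -
  define \<Phi> :: "real \<Rightarrow> complex^2^2" where "\<Phi> x = mat2 (P11 x) (P12 x) (P21 x) (P22 x)" for x
  define F :: "2 \<Rightarrow> 2 \<Rightarrow> complex \<Rightarrow> complex" where
    "F i k = (if i = 1 then if k = 1 then P11 else P12 else if k = 1 then P21 else P22)" for i k
  have F: "F i k holomorphic_on strip \<epsilon>" "z \<in> strip \<epsilon> \<Longrightarrow> norm (F i k z) \<le> B" "F i k (of_real x) = \<Phi> x $ i $ k"
    "F i k (w + 1) = F i k w" for i k z x w
    using exhaust_2[of i] exhaust_2[of k] by (auto simp: F_def \<Phi>_def hol bdP per)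
  have mn: "mat_extends_to_strip \<epsilon> \<Phi>" "mat_strip_norm \<epsilon> \<Phi> \<le> B'"
    using mat_strip_norm_le[of F \<epsilon> B \<Phi>, OF F(1-3) \<epsilon>] B' by auto
  have an: "analytic_circle (\<lambda>x. \<Phi> x $ i $ k)" for i k
    by (rule analytic_circleI[of "F i k" \<epsilon>]) (use F \<epsilon> in auto)
  have d: "det (\<Phi> x) = 1" for x
    using det[of x] by (simp add: det_2 \<Phi>_def)
  let ?D = "mat2 (exp (2 * of_real pi * \<i> * of_real \<theta>)) 0 0 (exp (- (2 * of_real pi * \<i> * of_real \<theta>)))"
  have cj: "\<Phi> (x + \<alpha>) ** schroedinger_cocycle v lam E x ** matrix_inv (\<Phi> x)
      = ?D + mat2 (Q1 x) (Q x) (Q3 x) (Q4 x)" for x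
  proof -
    have ee: "exp (2 * of_real pi * \<i> * of_real \<theta>) = ep \<theta>" "exp (- (2 * of_real pi * \<i> * of_real \<theta>)) = ep (- \<theta>)"
      by (simp_all add: ep_def)
    have "\<Phi> (x + \<alpha>) ** schroedinger_cocycle v lam E x = (?D + mat2 (Q1 x) (Q x) (Q3 x) (Q4 x)) ** \<Phi> x"
      using conj[of x] unfolding ee
      by (simp add: vec_eq_iff forall_2 matrix_matrix_mult_def sum_2 \<Phi>_def schroedinger_cocycle_def)
    moreover have "\<Phi> x ** matrix_inv (\<Phi> x) = mat 1"
      using invertible_det_nz[of "\<Phi> x"] d[of x] unfolding invertible_def matrix_inv_def
      by (metis (mono_tags, lifting) someI_ex zero_neq_one)
    ultimately show ?thesis by (simp add: matrix_mul_assoc[symmetric])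
  qed
  show ?thesis
    unfolding conjugable_def
    by (intro exI[of _ \<Phi>] exI[of _ "\<lambda>x. Q1 (of_real x)"] exI[of _ "\<lambda>x. Q (of_real x)"]
        exI[of _ "\<lambda>x. Q3 (of_real x)"] exI[of _ "\<lambda>x. Q4 (of_real x)"] conjI allI)
       (use an d mn cj strip_norm_le[OF hol(5) bdQ(1) refl \<epsilon>] strip_norm_le[OF hol(7) bdQ(2) refl \<epsilon>]
          strip_norm_le[OF hol(8) bdQ(3) refl \<epsilon>] strip_norm_le[OF hol(6) bdQ(4) refl \<epsilon>] in auto)
qed

subsection \<open>Distance to the integers\<close>

lemma circle_norm_eq: "circle_norm x = \<bar>x - of_int (round x)\<bar>"
proof (rule antisym)
  show "circle_norm x \<le> \<bar>x - of_int (round x)\<bar>"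
    using infdist_le[of "of_int (round x)" \<int> x] by (simp add: circle_norm_def dist_real_def)
  have "\<bar>x - of_int (round x)\<bar> \<le> (INF a\<in>\<int>. dist x a)"
    by (rule cINF_greatest) (auto simp: dist_real_def elim!: Ints_cases intro: round_diff_minimal)
  then show "\<bar>x - of_int (round x)\<bar> \<le> circle_norm x"
    using infdist_notempty[of "\<int>::real set" x] Ints_0 by (metis circle_norm_def empty_iff)
qed

lemma circle_norm_le: "circle_norm x \<le> \<bar>x - of_int m\<bar>"
  unfolding circle_norm_eq by (rule round_diff_minimal)

lemma circle_norm_nonneg [simp]: "circle_norm x \<ge> 0"
  by (simp add: circle_norm_eq)

lemma circle_norm_diff_le: "circle_norm (x - y) \<le> circle_norm x + circle_norm y"
proof -
  have "circle_norm (x - y) \<le> \<bar>(x - y) - of_int (round x - round y)\<bar>" by (rule circle_norm_le)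
  also have "\<dots> = \<bar>(x - of_int (round x)) - (y - of_int (round y))\<bar>" by simp
  also have "\<dots> \<le> \<bar>x - of_int (round x)\<bar> + \<bar>y - of_int (round y)\<bar>" by (rule abs_triangle_ineq4)
  finally show ?thesis by (simp add: circle_norm_eq)
qed

text \<open>The left side is a chord of the unit circle of length 2 |sin (pi d)| with |d| the
  distance to the nearest integer. The cubic Taylor bound gives sin y >= y/3 on [0, 2]; the optimal
  constant would be 4 instead of 2.\<close>

lemma norm_ep_minus_1_ge: "norm (ep (of_real x) - 1) \<ge> 2 * circle_norm x"
proof -
  define d where "d = x - of_int (round x)"
  have d: "\<bar>d\<bar> \<le> 1 / 2" using of_int_round_abs_le[of x] by (simp add: d_def abs_minus_commute)
  define y where "y = \<bar>pi * d\<bar>"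
  have y: "0 \<le> y" "y \<le> 2" using d pi_less_4 mult_mono[of pi 4 "\<bar>d\<bar>" "1/2"] by (auto simp: y_def abs_mult)
  have "ep (of_real x) = ep (of_real d) * ep (of_int (round x))"
    unfolding ep_add[symmetric] by (simp add: d_def)
  then have "ep (of_real x) - 1 = exp (\<i> * of_real (2 * pi * d)) - 1" by (simp only: ep_of_int) (simp add: ep_def mult_ac)
  then have "norm (ep (of_real x) - 1) = 2 * \<bar>sin (pi * d)\<bar>"
    using dist_exp_i_1[of "2 * pi * d"] by simp
  moreover have "\<bar>sin (pi * d)\<bar> \<ge> y / 3"
  proof -
    have "\<bar>sin y - (\<Sum>m<3. sin_coeff m * y ^ m)\<bar> \<le> inverse (fact 3) * \<bar>y\<bar> ^ 3"
      by (rule Maclaurin_sin_bound)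
    then have "\<bar>sin y - y\<bar> \<le> y ^ 3 / 6"
      using y by (simp add: numeral_3_eq_3 sin_coeff_def fact_numeral lessThan_Suc)
    moreover have "y ^ 3 \<le> 4 * y"
      using mult_mono[of y 2 y 2] y by (simp add: power3_eq_cube mult_right_mono)
    ultimately have "sin y \<ge> y / 3" by linarith
    moreover have "\<bar>sin (pi * d)\<bar> \<ge> sin y" by (cases "d \<ge> 0") (auto simp: y_def abs_mult)
    ultimately show ?thesis by linarith
  qed
  moreover have "y / 3 \<ge> \<bar>d\<bar>" using pi_gt3 mult_right_mono[of 3 pi "\<bar>d\<bar>"] by (simp add: y_def abs_mult)
  moreover have "circle_norm x = \<bar>d\<bar>" by (simp add: circle_norm_eq d_def)
  ultimately show ?thesis by linarith
qed

text \<open>Multiplication of the Diophantine condition by |m| gains one power of |m|. It is given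
  away, as is the rounding of the exponent up to an integer.\<close>

lemma DC_lower_bound:
  assumes "\<alpha> \<in> DC"
  obtains \<kappa> t where "\<kappa> > 0" "\<And>m::int. m \<noteq> 0 \<Longrightarrow> \<kappa> / \<bar>real_of_int m\<bar> ^ t \<le> circle_norm (of_int m * \<alpha>)"
proof -
  from assms obtain \<kappa> \<tau> where \<kappa>: "\<kappa> > 0" "\<tau> > 0" "\<alpha> \<in> DC_param \<kappa> \<tau>" by (auto simp: DC_def)
  define t where "t = nat \<lceil>\<tau>\<rceil>"
  have t: "real t \<ge> \<tau>" unfolding t_def by linarith
  have "\<kappa> / \<bar>real_of_int m\<bar> ^ t \<le> circle_norm (of_int m * \<alpha>)" if m: "m \<noteq> 0" for m
  proof -
    define p where "p = round (of_int m * \<alpha>)"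
    define q where "q = \<bar>real_of_int m\<bar>"
    have q: "q \<ge> 1" using m by (auto simp: q_def)
    have "\<kappa> * q powr (- \<tau>) \<le> \<bar>\<alpha> - of_int p / of_int m\<bar>"
      using \<kappa>(3) m by (auto simp: DC_param_def q_def)
    then have "\<kappa> * q powr (- \<tau>) * q \<le> \<bar>\<alpha> - of_int p / of_int m\<bar> * q"
      using q by (intro mult_right_mono) auto
    also have "\<dots> = \<bar>of_int m * \<alpha> - of_int p\<bar>"
      using m by (simp add: q_def abs_mult[symmetric] field_simps)
    also have "\<dots> = circle_norm (of_int m * \<alpha>)" by (simp add: circle_norm_eq p_def)
    finally have "\<kappa> * q powr (- \<tau>) * q \<le> circle_norm (of_int m * \<alpha>)" .
    moreover have "\<kappa> / q ^ t \<le> \<kappa> * q powr (- \<tau>) * q"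
    proof -
      have "\<kappa> / q ^ t = \<kappa> * q powr (- real t)"
        using q by (simp add: powr_minus powr_realpow divide_inverse)
      also have "\<dots> \<le> \<kappa> * q powr (- \<tau>)"
        using q t \<kappa> by (intro mult_left_mono powr_mono) auto
      also have "\<dots> \<le> \<kappa> * q powr (- \<tau>) * q"
        using q \<kappa> mult_left_mono[of 1 q "\<kappa> * q powr (- \<tau>)"] by simp
      finally show ?thesis .
    qed
    ultimately show ?thesis by (simp add: q_def)
  qed
  then show ?thesis using that \<kappa> by blast
qed

subsection \<open>Orbits of nearly triangular systems\<close>

text \<open>Multiplication of a column vector by the matrix with rows (a, -1), (1, 0). Orbits of
  vectors replace products of matrices throughout.\<close>

definition schr_step :: "complex \<Rightarrow> complex \<times> complex \<Rightarrow> complex \<times> complex" where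
  "schr_step a w = (a * fst w - snd w, fst w)"

primrec orb :: "(nat \<Rightarrow> complex) \<Rightarrow> complex \<times> complex \<Rightarrow> nat \<Rightarrow> complex \<times> complex" where
  "orb a w 0 = w"
| "orb a w (Suc k) = schr_step (a k) (orb a w k)"

definition nm :: "complex \<times> complex \<Rightarrow> real" where
  "nm w = norm (fst w) + norm (snd w)"

lemma nm_nonneg [simp]: "nm w \<ge> 0"
  by (simp add: nm_def)

lemma nm_triangle: "nm (w + w') \<le> nm w + nm w'"
  unfolding nm_def using norm_triangle_ineq[of "fst w" "fst w'"] norm_triangle_ineq[of "snd w" "snd w'"] by simp

lemma orb_diff: "orb a (w - w') k = orb a w k - orb a w' k"
proof (induction k)
  case (Suc k)
  show ?case unfolding orb.simps Suc.IH by (simp add: schr_step_def algebra_simps)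
qed simp

lemma orb_Suc_shift: "orb a w (Suc k) = orb (\<lambda>i. a (Suc i)) (schr_step (a 0) w) k"
  by (induction k) auto

lemma nm_orb_crude:
  assumes "\<And>i. i < k \<Longrightarrow> norm (a i) + 1 \<le> \<Lambda>" "\<Lambda> \<ge> 1"
  shows "nm (orb a w k) \<le> \<Lambda> ^ k * nm w"
  using assms(1)
proof (induction k)
  case (Suc k)
  have "nm (orb a w (Suc k)) \<le> (norm (a k) + 1) * nm (orb a w k)"
  proof -
    let ?p = "fst (orb a w k)" and ?q = "snd (orb a w k)"
    have "norm (a k * ?p - ?q) \<le> norm (a k) * norm ?p + norm ?q"
      by (metis norm_mult norm_triangle_ineq4)
    moreover have "0 \<le> norm (a k) * norm ?q" by simp
    ultimately show ?thesis
      unfolding nm_def orb.simps schr_step_def fst_conv snd_conv ring_distribs mult_1 by linarith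
  qed
  also have "\<dots> \<le> \<Lambda> * (\<Lambda> ^ k * nm w)"
    using Suc assms(2) by (intro mult_mono) auto
  finally show ?case by (simp add: mult_ac)
qed simp

text \<open>Duhamel's principle: y k is compared with the exact orbits that start from y i at the
  intermediate times i. Replacing one starting time by the next changes the endpoint by the error of
  one step, transported by the exact system, hence by at most M \<gamma>.\<close>

lemma nm_perturbed_orbit:
  assumes step: "\<And>i. i < k \<Longrightarrow> nm (y (Suc i) - schr_step (a i) (y i)) \<le> \<gamma>"
    and bd: "\<And>i l w. i + l \<le> k \<Longrightarrow> nm (orb (\<lambda>j. a (i + j)) w l) \<le> M * nm w" and M: "M \<ge> 0"
  shows "nm (y k) \<le> M * (nm (y 0) + real k * \<gamma>)"
proof -
  have "nm (y k) \<le> nm (orb (\<lambda>j. a (i + j)) (y i) l) + real l * (M * \<gamma>)" if "i + l = k" for i l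
    using that
  proof (induction l arbitrary: i)
    case (Suc l)
    define w where "w = schr_step (a i) (y i)"
    have IH: "nm (y k) \<le> nm (orb (\<lambda>j. a (Suc i + j)) (y (Suc i)) l) + real l * (M * \<gamma>)"
      by (rule Suc.IH) (use Suc.prems in simp)
    have "nm (orb (\<lambda>j. a (Suc i + j)) (y (Suc i) - w) l) \<le> M * nm (y (Suc i) - w)"
      by (rule bd) (use Suc.prems in simp)
    also have "\<dots> \<le> M * \<gamma>" unfolding w_def by (intro mult_left_mono step) (use Suc.prems M in auto)
    finally have 1: "nm (orb (\<lambda>j. a (Suc i + j)) (y (Suc i) - w) l) \<le> M * \<gamma>" .
    have "orb (\<lambda>j. a (Suc i + j)) (y (Suc i)) l
        = orb (\<lambda>j. a (Suc i + j)) (y (Suc i) - w) l + orb (\<lambda>j. a (i + j)) (y i) (Suc l)"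
      unfolding orb_diff orb_Suc_shift w_def by simp
    then have "nm (orb (\<lambda>j. a (Suc i + j)) (y (Suc i)) l) \<le> M * \<gamma> + nm (orb (\<lambda>j. a (i + j)) (y i) (Suc l))"
      using order_trans[OF nm_triangle add_right_mono[OF 1]] by simp
    with IH show ?case by (simp add: ring_distribs)
  qed simp
  from this[of 0 k] have "nm (y k) \<le> nm (orb a (y 0) k) + real k * (M * \<gamma>)" by simp
  also have "nm (orb a (y 0) k) \<le> M * nm (y 0)" using bd[of 0 k "y 0"] by simp
  finally show ?thesis by (simp add: algebra_simps)
qed

lemma one_plus_power_le_exp:
  fixes x c :: real
  assumes "x \<ge> 0" "real k * x \<le> c"
  shows "(1 + x) ^ k \<le> exp c"
proof -
  have "(1 + x) ^ k \<le> exp x ^ k" using assms by (intro power_mono) auto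
  also have "\<dots> = exp (real k * x)" by (simp add: exp_of_nat_mult)
  also have "\<dots> \<le> exp c" using assms by simp
  finally show ?thesis .
qed

lemma norm_add4_le:
  fixes a b c d :: complex
  shows "norm ((a + b) * c + d * e) \<le> (norm a + norm b) * norm c + norm d * norm e"
  by (intro order_trans[OF norm_triangle_ineq] add_mono) (auto simp: norm_mult intro!: mult_right_mono norm_triangle_ineq)

text \<open>Here s is the coordinate along the approximate eigenvector and t the one along the
  complementary vector; b is the off-diagonal entry, which may be large, and \<beta> bounds the
  errors in the other three.\<close>

locale triangular_orbit =
  fixes e ei :: complex and \<beta>1 b \<beta>3 \<beta>4 s t :: "nat \<Rightarrow> complex" and k :: nat and \<beta> :: real
  assumes e: "norm e = 1" "norm ei = 1" "e * ei = 1"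
    and s: "\<And>i. i < k \<Longrightarrow> s (Suc i) = (e + \<beta>1 i) * s i + b i * t i"
    and t: "\<And>i. i < k \<Longrightarrow> t (Suc i) = (ei + \<beta>4 i) * t i + \<beta>3 i * s i"
    and bd: "\<And>i. i < k \<Longrightarrow> norm (\<beta>1 i) \<le> \<beta>" "\<And>i. i < k \<Longrightarrow> norm (\<beta>3 i) \<le> \<beta>" "\<And>i. i < k \<Longrightarrow> norm (\<beta>4 i) \<le> \<beta>"
begin

lemma norm_s_Suc:
  assumes i: "i < k"
  shows "norm (s (Suc i)) \<le> (1 + \<beta>) * norm (s i) + norm (b i) * norm (t i)"
proof -
  have "norm (s (Suc i)) \<le> (norm e + norm (\<beta>1 i)) * norm (s i) + norm (b i) * norm (t i)"
    unfolding s[OF i] by (rule norm_add4_le)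
  also have "\<dots> \<le> (1 + \<beta>) * norm (s i) + norm (b i) * norm (t i)"
    by (intro add_mono mult_right_mono bd i) (auto simp: e)
  finally show ?thesis .
qed

lemma norm_t_Suc:
  assumes i: "i < k"
  shows "norm (t (Suc i)) \<le> (1 + \<beta>) * norm (t i) + \<beta> * norm (s i)"
proof -
  have "norm (t (Suc i)) \<le> (norm ei + norm (\<beta>4 i)) * norm (t i) + norm (\<beta>3 i) * norm (s i)"
    unfolding t[OF i] by (rule norm_add4_le)
  also have "\<dots> \<le> (1 + \<beta>) * norm (t i) + \<beta> * norm (s i)"
    by (intro add_mono mult_right_mono bd i) (auto simp: e)
  finally show ?thesis .
qed

lemma near_diagonal_growth:
  assumes "\<And>i. i < k \<Longrightarrow> norm (b i) \<le> \<beta>" "\<beta> \<ge> 0" "real k * (2 * \<beta>) \<le> c"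
  shows "norm (s k) + norm (t k) \<le> exp c * (norm (s 0) + norm (t 0))"
proof -
  have "norm (s j) + norm (t j) \<le> (1 + 2 * \<beta>) ^ j * (norm (s 0) + norm (t 0))" if "j \<le> k" for j
    using that
  proof (induction j)
    case (Suc j)
    then have j: "j < k" by simp
    have "norm (b j) * norm (t j) \<le> \<beta> * norm (t j)"
      by (rule mult_right_mono[OF assms(1)[OF j]]) simp
    then have "norm (s (Suc j)) + norm (t (Suc j)) \<le> (1 + 2 * \<beta>) * (norm (s j) + norm (t j))"
      using norm_s_Suc[OF j] norm_t_Suc[OF j] unfolding ring_distribs mult_2 by linarith
    also have "\<dots> \<le> (1 + 2 * \<beta>) * ((1 + 2 * \<beta>) ^ j * (norm (s 0) + norm (t 0)))"
      using Suc assms(2) by (intro mult_left_mono) auto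
    finally show ?case by (simp only: power_Suc mult.assoc)
  qed simp
  also have "(1 + 2 * \<beta>) ^ k * (norm (s 0) + norm (t 0)) \<le> exp c * (norm (s 0) + norm (t 0))"
    by (intro mult_right_mono one_plus_power_le_exp) (use assms in auto)
  finally show ?thesis by simp
qed

text \<open>The norm |s| / (B K) + |t| makes the off-diagonal entry contribute only 1 / K.\<close>

lemma triangular_growth:
  assumes b: "\<And>i. i < k \<Longrightarrow> norm (b i) \<le> B" and B: "B \<ge> 1" and K: "K \<ge> 1" "real k \<le> K"
    and \<beta>: "\<beta> \<ge> 0" "\<beta> * (B * K\<^sup>2) \<le> 1"
  shows "norm (s k) + norm (t k) \<le> exp 3 * (B * K) * (norm (s 0) + norm (t 0))"
proof -
  define W where "W j = norm (s j) / (B * K) + norm (t j)" for j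
  have BK: "B * K \<ge> 1" using B K by (metis mult_mono mult_1 zero_le_one order_trans)
  have \<beta>K: "\<beta> * (B * K) \<le> 1 / K" using \<beta> K by (simp add: field_simps power2_eq_square)
  have "\<beta> \<le> \<beta> * (B * K)" using BK \<beta> by (metis mult_left_mono mult_1_right)
  with \<beta>K have \<beta>1: "\<beta> \<le> 1 / K" by linarith
  have "W j \<le> (1 + 3 / K) ^ j * W 0" if "j \<le> k" for j
    using that
  proof (induction j)
    case (Suc j)
    then have j: "j < k" by simp
    define x where "x = norm (s j) / (B * K)"
    define y where "y = norm (t j)"
    define r where "r = 1 / K"
    have xy: "x \<ge> 0" "y \<ge> 0" using BK by (auto simp: x_def y_def)
    have sj: "norm (s j) = B * K * x" using B K by (simp add: x_def)
    have "norm (b j) * y \<le> B * y" by (rule mult_right_mono[OF b[OF j] xy(2)])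
    then have "norm (s (Suc j)) \<le> (1 + \<beta>) * (B * K * x) + B * y"
      using norm_s_Suc[OF j] unfolding y_def sj by linarith
    also have "\<dots> = (B * K) * ((1 + \<beta>) * x + y * r)" using B K by (simp add: r_def field_simps)
    finally have 1: "norm (s (Suc j)) / (B * K) \<le> (1 + \<beta>) * x + y * r"
      using BK by (simp add: pos_divide_le_eq mult.commute)
    have 2: "norm (t (Suc j)) \<le> (1 + \<beta>) * y + \<beta> * (B * K) * x"
      using norm_t_Suc[OF j] unfolding y_def sj by (simp only: mult.assoc)
    have 3: "\<beta> * (B * K) * x \<le> r * x" unfolding r_def by (rule mult_right_mono[OF \<beta>K xy(1)])
    have 4: "\<beta> * x \<le> r * x" "\<beta> * y \<le> r * y"
      unfolding r_def by (rule mult_right_mono[OF \<beta>1 xy(1)], rule mult_right_mono[OF \<beta>1 xy(2)])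
    have "r * y = y * r" by simp
    moreover have "r * x \<ge> 0" "r * y \<ge> 0" using K xy by (auto simp: r_def)
    ultimately have "W (Suc j) \<le> (1 + 3 * r) * (x + y)"
      using 1 2 3 4 unfolding W_def ring_distribs mult_1 by linarith
    then have "W (Suc j) \<le> (1 + 3 / K) * W j" by (simp add: W_def x_def y_def r_def)
    also have "\<dots> \<le> (1 + 3 / K) * ((1 + 3 / K) ^ j * W 0)"
      using Suc K by (intro mult_left_mono) auto
    finally show ?case by (simp only: power_Suc mult.assoc)
  qed simp
  then have "W k \<le> (1 + 3 / K) ^ k * W 0" by simp
  also have "\<dots> \<le> exp 3 * W 0"
    by (intro mult_right_mono one_plus_power_le_exp) (use K BK in \<open>auto simp: W_def field_simps\<close>)
  also have "\<dots> \<le> exp 3 * (norm (s 0) + norm (t 0))"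
  proof -
    have "norm (s 0) / (B * K) \<le> norm (s 0) / 1" by (rule divide_left_mono) (use BK in auto)
    then show ?thesis by (simp add: W_def)
  qed
  finally have "B * K * W k \<le> B * K * (exp 3 * (norm (s 0) + norm (t 0)))"
    using BK by (intro mult_left_mono) auto
  moreover have "norm (s k) + norm (t k) \<le> B * K * W k"
    using BK B K mult_right_mono[OF BK, of "norm (t k)"] by (simp add: W_def ring_distribs)
  ultimately show ?thesis by (simp add: mult_ac)
qed

text \<open>Started at (0, 1), the exactly triangular system has t j = ei^j and ei^j * s j = ei
  times the Birkhoff sum of b with weights ei^(2 l). A bound Q for one orbit is therefore a bound
  for these sums, up to errors of order \<beta>.\<close>

lemma birkhoff_sum_le:
  assumes b: "\<And>i. i < k \<Longrightarrow> norm (b i) \<le> B" and B: "B \<ge> 0" and \<beta>: "\<beta> \<ge> 0"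
    and Q: "\<And>i. i \<le> k \<Longrightarrow> norm (s i) + norm (t i) \<le> Q" and init: "s 0 = 0" "t 0 = 1"
  shows "norm (\<Sum>l<k. ei ^ (2 * l) * b l) \<le> Q + real k * (\<beta> * Q * (1 + B * real k))"
proof -
  have Q0: "Q \<ge> 0" using order_trans[OF _ Q[of 0]] by simp
  have ei_pow: "norm (ei ^ j) = 1" for j by (simp add: norm_power e)
  have terr: "norm (t j - ei ^ j) \<le> real j * (\<beta> * Q)" if "j \<le> k" for j
    using that
  proof (induction j)
    case (Suc j)
    then have j: "j < k" by simp
    have "t (Suc j) - ei ^ Suc j = ei * (t j - ei ^ j) + (\<beta>4 j * t j + \<beta>3 j * s j)"
      by (simp add: t[OF j] algebra_simps)
    also have "norm \<dots> \<le> norm (t j - ei ^ j) + (\<beta> * norm (t j) + \<beta> * norm (s j))"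
      by (intro order_trans[OF norm_triangle_ineq] add_mono) (auto simp: norm_mult e intro!: mult_right_mono bd j)
    also have "\<dots> \<le> real j * (\<beta> * Q) + \<beta> * Q"
      using Suc mult_left_mono[OF Q[of j] \<beta>] by (simp add: ring_distribs)
    finally show ?case by (simp add: algebra_simps)
  qed (simp add: init)
  define \<sigma> where "\<sigma> j = (\<Sum>l<j. ei ^ (2 * l) * b l)" for j
  \<comment> \<open>The rotation of s is undone by the factor ei^j, so that only the forcing by b t
    and the error of the diagonal entry accumulate.\<close>
  have serr: "norm (ei ^ j * s j - ei * \<sigma> j) \<le> real j * (\<beta> * Q * (1 + B * real k))" if "j \<le> k" for j
    using that
  proof (induction j)
    case (Suc j)
    then have j: "j < k" by simp
    have ee: "ei ^ Suc j * e = ei ^ j" using e(3) by (simp add: mult_ac)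
    have "ei ^ Suc j * s (Suc j) - ei * \<sigma> (Suc j)
        = (ei ^ Suc j * e * s j - ei * \<sigma> j) + ei ^ Suc j * (\<beta>1 j * s j + b j * (t j - ei ^ j))"
      by (simp add: s[OF j] \<sigma>_def algebra_simps power_add[symmetric] mult_2_right)
    also have "norm \<dots> \<le> norm (ei ^ j * s j - ei * \<sigma> j) + (\<beta> * norm (s j) + B * norm (t j - ei ^ j))"
      unfolding ee
      by (rule order_trans[OF norm_triangle_ineq], rule add_left_mono)
         (use ei_pow[of "Suc j"] in \<open>auto simp: norm_mult intro!: order_trans[OF norm_triangle_ineq] add_mono mult_right_mono bd b j\<close>)
    also have "\<dots> \<le> real j * (\<beta> * Q * (1 + B * real k)) + (\<beta> * Q + B * (real k * (\<beta> * Q)))"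
    proof (intro add_mono)
      show "\<beta> * norm (s j) \<le> \<beta> * Q"
        by (rule mult_left_mono[OF _ \<beta>]) (use Q[of j] j norm_ge_zero[of "t j"] in linarith)
      have "norm (t j - ei ^ j) \<le> real k * (\<beta> * Q)"
        by (rule order_trans[OF terr]) (use j \<beta> Q0 in \<open>auto intro!: mult_right_mono\<close>)
      then show "B * norm (t j - ei ^ j) \<le> B * (real k * (\<beta> * Q))" by (rule mult_left_mono[OF _ B])
    qed (use Suc in simp)
    finally show ?case by (simp add: algebra_simps)
  qed (simp add: init \<sigma>_def)
  have "norm (\<sigma> k) = norm (ei * \<sigma> k)" by (simp add: norm_mult e)
  also have "\<dots> \<le> norm (ei ^ k * s k) + norm (ei ^ k * s k - ei * \<sigma> k)"
    using norm_triangle_sub[of "ei * \<sigma> k" "ei ^ k * s k"] by (simp add: norm_minus_commute)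
  also have "norm (ei ^ k * s k) \<le> Q"
  proof -
    have "norm (ei ^ k * s k) = norm (s k)" by (simp add: norm_mult ei_pow)
    then show ?thesis using Q[of k] norm_ge_zero[of "t k"] by linarith
  qed
  also note serr[of k]
  finally show ?thesis by (simp add: \<sigma>_def)
qed

end

section \<open>Series, geometric sums and the algebra of the frame\<close>

lemma has_sum_finite_sum:
  fixes f :: "'a \<Rightarrow> 'b \<Rightarrow> 'c::topological_comm_monoid_add"
  assumes "finite A" "\<And>a. a \<in> A \<Longrightarrow> (f a has_sum s a) B"
  shows "((\<lambda>x. \<Sum>a\<in>A. f a x) has_sum (\<Sum>a\<in>A. s a)) B"
  using assms by (induction A rule: finite_induct) (auto intro!: has_sum_add)

text \<open>Fubini for the absolutely summable double family x l * y m along the lines l + m = k.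
  The convolution enters through its \<open>has_sum\<close>, the form in which the dual equation
  supplies it.\<close>

lemma has_sum_convolution:
  fixes x y :: "int \<Rightarrow> complex"
  assumes x: "(\<lambda>k. norm (x k)) summable_on UNIV" and y: "(\<lambda>k. norm (y k)) summable_on UNIV"
    and X: "(x has_sum X) UNIV" and Y: "(y has_sum Y) UNIV"
    and c: "\<And>k. ((\<lambda>l. x l * y (k - l)) has_sum c k) UNIV"
  shows "(c has_sum (X * Y)) UNIV"
proof -
  have sm: "(\<lambda>(l, m). x l * y m) summable_on UNIV \<times> UNIV"
  proof (rule abs_summable_summable, unfold Infinite_Sum.abs_summable_on_Sigma_iff, intro conjI ballI)
    show "(\<lambda>m. norm (case (l, m) of (l, m) \<Rightarrow> x l * y m)) summable_on UNIV" for l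
      by (simp add: norm_mult summable_on_cmult_right y)
    show "(\<lambda>l. norm (\<Sum>\<^sub>\<infinity>m. norm (case (l, m) of (l, m) \<Rightarrow> x l * y m))) summable_on UNIV"
      by (simp add: norm_mult infsum_cmult_right' summable_on_cmult_left x abs_mult)
  qed
  have "((\<lambda>(l, m). x l * y m) has_sum (X * Y)) (UNIV \<times> UNIV)"
    by (rule has_sum_SigmaI[OF _ _ sm, where g = "\<lambda>l. x l * Y"])
       (auto intro!: has_sum_cmult_right has_sum_cmult_left X Y)
  moreover have "bij_betw (\<lambda>(k, l). (l, k - l)) (UNIV \<times> UNIV) (UNIV \<times> (UNIV :: int set))"
    by (rule bij_betwI[of _ _ _ "\<lambda>(l, m). (l + m, l)"]) auto
  ultimately have "((\<lambda>kl. (case (case kl of (k, l) \<Rightarrow> (l, k - l)) of (l, m) \<Rightarrow> x l * y m)) has_sum (X * Y)) (UNIV \<times> UNIV)"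
    by (subst has_sum_reindex_bij_betw)
  then show ?thesis
    by (rule has_sum_SigmaD) (use c in simp)
qed

lemma power_le_fact_mult_exp:
  fixes x r :: real
  assumes "x \<ge> 0" "r > 0"
  shows "x ^ n \<le> fact n * (1 / r) ^ n * exp (r * x)"
proof -
  have "(r * x) ^ n / fact n \<le> exp (r * x)"
  proof -
    have "(\<Sum>k\<in>{n}. (r * x) ^ k /\<^sub>R fact k) \<le> (\<Sum>k. (r * x) ^ k /\<^sub>R fact k)"
      by (rule sum_le_suminf[OF summable_exp_generic]) (use assms in auto)
    then show ?thesis by (simp add: exp_def divide_inverse mult.commute)
  qed
  then show ?thesis using assms by (simp add: field_simps power_mult_distrib)
qed

lemma norm_sum_ep_le:
  assumes m: "circle_norm x > 0"
  shows "norm (\<Sum>k<K. ep (of_real (real k * x))) \<le> 1 / circle_norm x"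
proof -
  let ?w = "ep (of_real x)"
  have pw: "ep (of_real (real k * x)) = ?w ^ k" for k
    by (induction k) (auto simp: ring_distribs ep_add)
  have d: "norm (?w - 1) \<ge> 2 * circle_norm x" by (rule norm_ep_minus_1_ge)
  then have ne: "?w \<noteq> 1" using m by auto
  have "norm (\<Sum>k<K. ?w ^ k) = norm (?w ^ K - 1) / norm (?w - 1)"
    by (simp add: geometric_sum[OF ne] norm_divide)
  also have "\<dots> \<le> 2 / (2 * circle_norm x)"
    using norm_triangle_ineq4[of "?w ^ K" 1] d m by (intro frac_le) (auto simp: norm_power)
  finally show ?thesis unfolding pw using m by simp
qed

text \<open>In the notation U = (e u, um), V = (V1, V2) one has det (U, V) = 1, and s = det (Z, V),
  t = det (U, Z) are the coordinates of Z. The suffixes m and p stand for the shifts by -\<alpha>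
  and +\<alpha>. The hypothesis \<open>eq\<close> says that the step maps U to e times the shifted U
  plus (\<gamma>, 0), so every entry except the off-diagonal one differs from its ideal value by a
  multiple of \<gamma>.\<close>

lemma frame_step:
  fixes A D Dp e ei \<gamma> u um up us usm ups Z1 Z2 :: complex
  defines "V1 \<equiv> - (usm / D)" and "V2 \<equiv> ei * us / D"
  defines "s \<equiv> (ei * us * Z1 + usm * Z2) / D" and "t \<equiv> e * u * Z2 - um * Z1"
    and "s' \<equiv> (ei * ups * (A * Z1 - Z2) + us * Z1) / Dp" and "t' \<equiv> e * up * Z1 - u * (A * Z1 - Z2)"
  assumes e: "e * ei = 1" and D: "D = u * us + um * usm" "D \<noteq> 0" and Dp: "Dp = up * ups + u * us" "Dp \<noteq> 0"
    and eq: "A * e * u - um = e * e * up + \<gamma>"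
  shows "Z1 = s * (e * u) + t * V1" "Z2 = s * um + t * V2"
    and "s' = (e + ei * \<gamma> * ups / Dp) * s + ((ei * ups * (A * V1 - V2) + us * V1) / Dp) * t"
    and "t' = (ei + ei * \<gamma> * usm / D) * t + (- \<gamma> * u) * s"
proof -
  have "s * (e * u) + t * V1 = ((e * ei) * u * us * Z1 + um * usm * Z1) / D"
    unfolding s_def t_def V1_def V2_def using D(2) by (simp add: field_simps)
  also have "\<dots> = (D * Z1) / D" unfolding e D(1) by (simp add: algebra_simps)
  finally show Z1: "Z1 = s * (e * u) + t * V1" using D(2) by simp
  have "s * um + t * V2 = (um * usm * Z2 + (e * ei) * u * us * Z2) / D"
    unfolding s_def t_def V1_def V2_def using D(2) by (simp add: field_simps)
  also have "\<dots> = (D * Z2) / D" unfolding e D(1) by (simp add: algebra_simps)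
  finally show Z2: "Z2 = s * um + t * V2" using D(2) by simp
  have "ei * (e * e * up) = ei * (A * e * u - um - \<gamma>)" using eq by simp
  moreover have "ei * (e * e * up) = (e * ei) * e * up" by simp
  moreover have "ei * (A * e * u - um - \<gamma>) = (e * ei) * A * u - ei * um - ei * \<gamma>" by (simp add: algebra_simps)
  ultimately have eup: "e * up = A * u - ei * um - ei * \<gamma>" unfolding e by simp
  have "t' = u * Z2 - ei * um * Z1 - ei * \<gamma> * Z1"
    unfolding t'_def eup by (simp add: algebra_simps)
  also have "u * Z2 = ei * (e * u * Z2)" using e by (simp add: mult.assoc[symmetric] mult.commute[of ei])
  also have "ei * (e * u * Z2) - ei * um * Z1 - ei * \<gamma> * Z1 = ei * t - ei * \<gamma> * Z1"
    by (simp add: t_def algebra_simps)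
  also have "ei * \<gamma> * Z1 = (e * ei) * \<gamma> * u * s + ei * \<gamma> * V1 * t"
    by (subst Z1) (simp add: algebra_simps)
  finally show "t' = (ei + ei * \<gamma> * usm / D) * t + (- \<gamma> * u) * s"
    unfolding e by (simp add: V1_def algebra_simps)
  define W where "W = ei * ups * (A * V1 - V2) + us * V1"
  have "ei * ups * (A * Z1 - Z2) + us * Z1 = s * (ei * ups * (A * e * u - um) + us * (e * u)) + t * W"
    unfolding W_def by (subst (1 2) Z1, subst Z2) (simp add: algebra_simps)
  also have "ei * ups * (A * e * u - um) + us * (e * u) = (e * ei) * e * up * ups + e * u * us + ei * \<gamma> * ups"
    unfolding eq by (simp add: algebra_simps)
  also have "\<dots> = e * Dp + ei * \<gamma> * ups" unfolding e Dp(1) by (simp add: algebra_simps)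
  finally have "s' = (s * (e * Dp + ei * \<gamma> * ups) + t * W) / Dp" unfolding s'_def by (rule arg_cong)
  also have "\<dots> = (e + ei * \<gamma> * ups / Dp) * s + (W / Dp) * t"
    using Dp(2) by (simp add: add_divide_distrib distrib_left distrib_right mult_ac)
  finally show "s' = (e + ei * \<gamma> * ups / Dp) * s + ((ei * ups * (A * V1 - V2) + us * V1) / Dp) * t"
    unfolding W_def .
qed


lemma norm_exp_minus_1_le:
  fixes w :: real
  shows "\<bar>exp w - 1\<bar> \<le> \<bar>w\<bar> * exp \<bar>w\<bar>"
proof (cases "w \<ge> 0")
  case True
  have "exp w * (1 - w) \<le> exp w * exp (- w)"
    using exp_ge_add_one_self[of "- w"] by (intro mult_left_mono) auto
  with True show ?thesis by (simp add: exp_minus algebra_simps)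
next
  case False
  then have "1 - exp w \<le> - w" using exp_ge_add_one_self[of w] by linarith
  moreover have "- w \<le> - w * exp (- w)" using False mult_left_mono[of 1 "exp (- w)" "- w"] by simp
  ultimately have "1 - exp w \<le> - w * exp (- w)" by linarith
  moreover have "\<bar>exp w - 1\<bar> = 1 - exp w" "\<bar>w\<bar> = - w" using False by auto
  ultimately show ?thesis by simp
qed

text \<open>Termwise estimate. A quarter of the rate absorbs the factor |k| from differentiating the
  exponential, a half absorbs its growth in the strip, and the last quarter is summed.\<close>

lemma fs_lipschitz_Im:
  assumes a: "exp_decay C \<rho> a" and \<rho>: "\<rho> > 0" and z: "z \<in> strip (\<rho> / (4 * pi))"
  shows "norm (fs a z - fs a (of_real (Re z))) \<le> C * (8 * pi / \<rho>) * (2 + 8 / \<rho>) * \<bar>Im z\<bar>"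
proof -
  define d where "d k = a k * ep (of_int k * z) - a k * ep (of_int k * of_real (Re z))" for k
  have C: "C \<ge> 0" by (rule exp_decay_nonneg[OF a])
  have Rez: "of_real (Re z) \<in> strip (\<rho> / (4 * pi))" using \<rho> by simp
  have "exp_decay (C * (8 * pi / \<rho>) * \<bar>Im z\<bar>) (\<rho> / 4) d"
    unfolding exp_decay_def
  proof
    fix k
    define w where "w = - (2 * pi * of_int k * Im z)"
    define m where "m = \<bar>real_of_int k\<bar>"
    have m: "m \<ge> 0" by (simp add: m_def)
    have "of_int k * z = of_int k * of_real (Re z) + of_int k * (\<i> * of_real (Im z))"
      by (metis complex_eq distrib_left)
    then have "ep (of_int k * z) = ep (of_int k * of_real (Re z)) * ep (of_int k * (\<i> * of_real (Im z)))"
      by (simp only: ep_add)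
    moreover have "ep (of_int k * (\<i> * of_real (Im z))) = of_real (exp w)"
      unfolding ep_def exp_of_real[symmetric] w_def by (rule arg_cong[of _ _ exp]) (simp add: algebra_simps)
    ultimately have "d k = a k * ep (of_int k * of_real (Re z)) * of_real (exp w - 1)"
      by (simp add: d_def algebra_simps)
    moreover have "norm (ep (of_int k * of_real (Re z))) = 1" using norm_ep_real[of "of_int k * Re z"] by simp
    ultimately have "norm (d k) = norm (a k) * \<bar>exp w - 1\<bar>" by (simp only: norm_mult norm_of_real)
    also have "\<dots> \<le> (C * exp (- \<rho> * m)) * (\<bar>w\<bar> * exp \<bar>w\<bar>)"
      unfolding m_def by (intro mult_mono exp_decayD[OF a] norm_exp_minus_1_le) (use C in auto)
    also have "\<dots> \<le> (C * exp (- \<rho> * m)) * ((2 * pi * \<bar>Im z\<bar> * (4 / \<rho> * exp (\<rho> / 4 * m))) * exp (\<rho> / 2 * m))"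
    proof (intro mult_left_mono mult_mono)
      have w: "\<bar>w\<bar> = 2 * pi * \<bar>Im z\<bar> * m" by (simp add: w_def m_def abs_mult)
      have "\<rho> / 4 * m \<le> exp (\<rho> / 4 * m)" using exp_ge_add_one_self[of "\<rho> / 4 * m"] by linarith
      then have "m \<le> 4 / \<rho> * exp (\<rho> / 4 * m)" using \<rho> by (simp add: field_simps)
      then show "\<bar>w\<bar> \<le> 2 * pi * \<bar>Im z\<bar> * (4 / \<rho> * exp (\<rho> / 4 * m))"
        unfolding w by (intro mult_left_mono) auto
      have "2 * pi * \<bar>Im z\<bar> \<le> \<rho> / 2" using z by (simp add: strip_def field_simps)
      then show "exp \<bar>w\<bar> \<le> exp (\<rho> / 2 * m)" unfolding w exp_le_cancel_iff using m by (rule mult_right_mono)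
    qed (use C \<rho> in auto)
    also have "\<dots> = C * (8 * pi / \<rho>) * \<bar>Im z\<bar> * (exp (- \<rho> * m) * exp (\<rho> / 4 * m) * exp (\<rho> / 2 * m))"
      using \<rho> by (simp add: field_simps)
    also have "exp (- \<rho> * m) * exp (\<rho> / 4 * m) * exp (\<rho> / 2 * m) = exp (- (\<rho> / 4) * m)"
      by (simp add: exp_add[symmetric])
    finally show "norm (d k) \<le> C * (8 * pi / \<rho>) * \<bar>Im z\<bar> * exp (- (\<rho> / 4) * \<bar>real_of_int k\<bar>)"
      by (simp add: m_def)
  qed
  from exp_decay_infsum(3)[OF this] \<rho>
  have "norm (infsum d UNIV) \<le> C * (8 * pi / \<rho>) * (2 + 8 / \<rho>) * \<bar>Im z\<bar>" by (simp add: mult_ac)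
  moreover have "(d has_sum (fs a z - fs a (of_real (Re z)))) UNIV"
    unfolding d_def by (intro has_sum_diff fs_has_sum[OF a \<rho>] z Rez)
  ultimately show ?thesis by (simp add: infsumI)
qed

lemma cnj_ep_real: "cnj (ep (of_real x)) = ep (- of_real x)"
  by (simp add: ep_def exp_cnj)

lemma fs_reflect_real: "fs (\<lambda>k. cnj (a (- k))) (of_real x) = cnj (fs a (of_real x))"
proof -
  have "fs (\<lambda>k. cnj (a (- k))) (of_real x) = (\<Sum>\<^sub>\<infinity>k. cnj (a k * ep (of_int k * of_real x)))"
    unfolding fs_def
  proof (rule infsum_reindex_bij_witness[of _ uminus uminus])
    fix k :: int
    show "cnj (a (- k) * ep (of_int (- k) * of_real x)) = cnj (a (- k)) * ep (of_int k * of_real x)"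
      using cnj_ep_real[of "of_int (- k) * x"] by simp
  qed auto
  then show ?thesis unfolding fs_def infsum_cnj .
qed

subsection \<open>Frames from dual solutions\<close>

text \<open>The data that stay fixed while energy, phase and resonance vary. All constants defined
  here are thus uniform in E, \<theta> and j.\<close>

locale bloch_setting =
  fixes \<alpha> \<kappa> lam \<epsilon> Cv Cb \<Lambda> :: real and \<tau> :: nat and vc :: "int \<Rightarrow> complex"
  assumes \<kappa>: "\<kappa> > 0" and dio: "\<And>m::int. m \<noteq> 0 \<Longrightarrow> \<kappa> / \<bar>real_of_int m\<bar> ^ \<tau> \<le> circle_norm (of_int m * \<alpha>)"
    and \<epsilon>: "0 < \<epsilon>" "\<epsilon> \<le> 1" and vc: "exp_decay Cv \<epsilon> vc" and Cb: "Cb \<ge> 1" and \<Lambda>: "\<Lambda> \<ge> 1"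
begin

definition pot :: "real \<Rightarrow> complex \<Rightarrow> complex" where
  "pot E z = of_real E - of_real lam * fs vc z"

definition pot_seq :: "real \<Rightarrow> complex \<Rightarrow> nat \<Rightarrow> complex" where
  "pot_seq E z i = pot E (z + of_real (real i * \<alpha>))"

text \<open>The sets S in use are the real line and strips. Both are invariant under real
  translations, so the bound also covers orbit segments that start at a later time.\<close>

definition growth :: "real \<Rightarrow> complex set \<Rightarrow> nat \<Rightarrow> real \<Rightarrow> bool" where
  "growth E S K M \<longleftrightarrow> (\<forall>z\<in>S. \<forall>k\<le>K. \<forall>w. nm (orb (pot_seq E z) w k) \<le> M * nm w)"

text \<open>For coefficients of rate \<epsilon>/n, the sup norm of u is at most Cu n, its Lipschitz
  constant in the imaginary direction at most CL n^2, and the nonzero modes of an orbit sum of u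
  contribute at most CS n^(\<tau>+1), whatever the length of the orbit.\<close>

definition "Cu = Cb * (2 + 4 / \<epsilon>)"
definition "CL = Cb * (8 * pi / \<epsilon>) * (2 + 8 / \<epsilon>)"
definition "CS = Cb * (fact \<tau> * (2 / \<epsilon>) ^ \<tau>) * (2 + 4 / \<epsilon>) / \<kappa>"
definition "CK = 2 * CS + 2"
definition "CH = 256 * CL * Cu"

text \<open>Orbit length at which the nonzero modes, bounded by CS n^(\<tau>+1), amount to at most
  half of the contribution of the mean.\<close>

definition Kn :: "real \<Rightarrow> nat" where
  "Kn n = nat \<lceil>2 * CS * n ^ (\<tau> + 1)\<rceil> + 1"

text \<open>Chosen so that 4 CL Cu n^3 * width = 1/(64 M^2): the denominator \<open>D\<close> then
  loses at most half of its lower bound 1/(32 M^2) on the real line.\<close>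

definition width :: "real \<Rightarrow> real \<Rightarrow> real" where
  "width n M = 1 / (CH * n ^ 3 * M\<^sup>2)"

text \<open>The bound Cu n for u, divided by the lower bound 1/(64 M^2) for
  \<open>D\<close>.\<close>

definition frame :: "real \<Rightarrow> real \<Rightarrow> real" where
  "frame n M = 64 * M\<^sup>2 * Cu * n"

lemma Cu_ge: "Cu \<ge> 6"
proof -
  have "6 \<le> 2 + 4 / \<epsilon>" using \<epsilon> by (simp add: field_simps)
  also have "\<dots> \<le> Cb * (2 + 4 / \<epsilon>)" using Cb \<epsilon> mult_right_mono[of 1 Cb "2 + 4 / \<epsilon>"] by simp
  finally show ?thesis by (simp add: Cu_def)
qed

lemma CL_ge: "CL \<ge> 4 * pi / \<epsilon>"
proof -
  have "4 * pi / \<epsilon> * 1 \<le> (8 * pi / \<epsilon>) * (2 + 8 / \<epsilon>)" using \<epsilon> by (intro mult_mono) (auto simp: field_simps)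
  also have "\<dots> \<le> Cb * ((8 * pi / \<epsilon>) * (2 + 8 / \<epsilon>))"
    using Cb \<epsilon> mult_right_mono[of 1 Cb "(8 * pi / \<epsilon>) * (2 + 8 / \<epsilon>)"] by simp
  finally show ?thesis by (simp add: CL_def mult_ac)
qed

lemma CL_pos: "CL > 0"
  using CL_ge \<epsilon> by (metis divide_pos_pos less_le_trans mult_pos_pos pi_gt_zero zero_less_numeral)

lemma CS_pos: "CS > 0"
  unfolding CS_def using \<kappa> \<epsilon> Cb by (intro divide_pos_pos mult_pos_pos) (auto intro: add_pos_pos)

lemma CH_ge: "CH \<ge> 4 * pi / \<epsilon>" "CH > 0" "CH \<ge> 1"
proof -
  have "CL \<le> CH"
    using Cu_ge CL_pos mult_left_mono[of 1 "256 * Cu" CL] by (simp add: CH_def mult_ac)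
  then show 1: "CH \<ge> 4 * pi / \<epsilon>" using CL_ge by linarith
  have "4 * pi / \<epsilon> \<ge> 1" using \<epsilon> pi_gt3 by (simp add: field_simps)
  with 1 show "CH \<ge> 1" by linarith
  then show "CH > 0" by linarith
qed

lemma Kn_bounds:
  assumes "n \<ge> 1"
  shows "2 * CS * n ^ (\<tau> + 1) \<le> real (Kn n)" "real (Kn n) \<le> CK * n ^ (\<tau> + 1)" "Kn n > 0"
proof -
  have p: "n ^ (\<tau> + 1) \<ge> 1" using assms by (rule one_le_power)
  have nn: "2 * CS * n ^ (\<tau> + 1) \<ge> 0" using CS_pos assms by simp
  then have *: "real (nat \<lceil>2 * CS * n ^ (\<tau> + 1)\<rceil>) = of_int \<lceil>2 * CS * n ^ (\<tau> + 1)\<rceil>" by (simp add: zero_le_ceiling)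
  show "2 * CS * n ^ (\<tau> + 1) \<le> real (Kn n)" unfolding Kn_def of_nat_add * by linarith
  have "real (Kn n) \<le> 2 * CS * n ^ (\<tau> + 1) + 2" unfolding Kn_def of_nat_add * by linarith
  also have "\<dots> \<le> CK * n ^ (\<tau> + 1)" unfolding CK_def ring_distribs using p by linarith
  finally show "real (Kn n) \<le> CK * n ^ (\<tau> + 1)" .
  show "Kn n > 0" by (simp add: Kn_def)
qed

lemma width_bounds:
  assumes "n \<ge> 1" "M \<ge> 1"
  shows "width n M > 0" "width n M \<le> \<epsilon> / n / (4 * pi)" "width n M \<le> \<epsilon> / (4 * pi)"
proof -
  show "width n M > 0" unfolding width_def using assms CH_ge by simp
  have "n * 1 \<le> n ^ 3 * M\<^sup>2"
    using assms by (intro mult_mono one_le_power self_le_power) auto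
  then have "(4 * pi / \<epsilon>) * n \<le> CH * (n ^ 3 * M\<^sup>2)" using CH_ge assms by (intro mult_mono) auto
  then have "1 / (CH * (n ^ 3 * M\<^sup>2)) \<le> 1 / ((4 * pi / \<epsilon>) * n)"
    using assms \<epsilon> by (intro divide_left_mono) (auto intro!: mult_pos_pos simp: CH_ge)
  then show 1: "width n M \<le> \<epsilon> / n / (4 * pi)" by (simp add: width_def field_simps)
  have "\<epsilon> / n \<le> \<epsilon> / 1" using assms \<epsilon> by (intro divide_left_mono) auto
  then have "\<epsilon> / n / (4 * pi) \<le> \<epsilon> / 1 / (4 * pi)" by (intro divide_right_mono) auto
  with 1 show "width n M \<le> \<epsilon> / (4 * pi)" by simp
qed

end

text \<open>The sequence a is a truncated dual solution and g its defect in the dual equation. The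
  decay of a starts only beyond distance of order n, whence the slow rate \<epsilon>/n with a
  constant independent of n; the defect has the full rate \<epsilon> and a small size
  \<delta>.\<close>

locale bloch_wave = bloch_setting +
  fixes E \<theta> n \<delta> :: real and a g :: "int \<Rightarrow> complex"
  assumes n: "n \<ge> 1" and a0: "a 0 = 1" and a: "exp_decay Cb (\<epsilon> / n) a" and g: "exp_decay \<delta> \<epsilon> g"
    and dual: "\<And>k. ((\<lambda>l. of_real lam * vc l * a (k - l)) has_sum
        (of_real E * a k - of_real (2 * cos (2 * pi * (\<theta> + of_int k * \<alpha>))) * a k - g k)) UNIV"
    and E\<Lambda>: "\<bar>E\<bar> + \<bar>lam\<bar> * (Cv * (2 + 4 / \<epsilon>)) + 1 \<le> \<Lambda>"
begin

text \<open>On the real line us is the conjugate of u; unlike the conjugate it is holomorphic in strips.\<close>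

abbreviation "u \<equiv> fs a"
abbreviation "us \<equiv> fs (\<lambda>k. cnj (a (- k)))"
abbreviation "W \<equiv> strip (\<epsilon> / n / (4 * pi))"
abbreviation "e \<equiv> ep (of_real \<theta>)"
abbreviation "ei \<equiv> ep (- of_real \<theta>)"

lemma \<epsilon>n: "\<epsilon> / n > 0" "\<epsilon> / n \<le> \<epsilon>"
  using \<epsilon> n by (auto simp: field_simps)

lemma as: "exp_decay Cb (\<epsilon> / n) (\<lambda>k. cnj (a (- k)))"
  using a by (auto simp: exp_decay_def) (metis abs_minus_cancel of_int_minus)

lemma W_subset: "z \<in> W \<Longrightarrow> z \<in> strip (\<epsilon> / (4 * pi))"
  by (rule subsetD[OF strip_mono[OF divide_right_mono[OF \<epsilon>n(2)]]]) auto

lemma of_real_in_W: "of_real x \<in> W"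
  using \<epsilon> n by simp

lemma e_ei: "e * ei = 1" "norm e = 1" "norm ei = 1"
  using norm_ep_real[of "- \<theta>"] by (auto simp: ep_add[symmetric])

lemma Cu_n: "Cb * (2 + 4 / (\<epsilon> / n)) \<le> Cu * n"
proof -
  have "2 + 4 / (\<epsilon> / n) \<le> (2 + 4 / \<epsilon>) * n" using n \<epsilon> by (simp add: field_simps)
  then show ?thesis using mult_left_mono[of "2 + 4 / (\<epsilon> / n)" "(2 + 4 / \<epsilon>) * n" Cb] Cb by (simp add: Cu_def mult_ac)
qed

lemma u_le: "z \<in> W \<Longrightarrow> norm (u z) \<le> Cu * n" and us_le: "z \<in> W \<Longrightarrow> norm (us z) \<le> Cu * n"
  using norm_fs_le[OF a \<epsilon>n(1)] norm_fs_le[OF as \<epsilon>n(1)] Cu_n by (meson order_trans)+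

lemma pot_le: "z \<in> strip (\<epsilon> / (4 * pi)) \<Longrightarrow> norm (pot E z) + 1 \<le> \<Lambda>"
proof -
  assume z: "z \<in> strip (\<epsilon> / (4 * pi))"
  have "norm (pot E z) \<le> norm (of_real E :: complex) + norm (of_real lam * fs vc z)"
    unfolding pot_def by (rule norm_triangle_ineq4)
  also have "\<dots> \<le> \<bar>E\<bar> + \<bar>lam\<bar> * (Cv * (2 + 4 / \<epsilon>))"
    using norm_fs_le[OF vc \<epsilon>(1) z] by (auto simp: norm_mult intro: mult_left_mono)
  finally show ?thesis using E\<Lambda> by linarith
qed

lemma fs_g_le: "z \<in> strip (\<epsilon> / (4 * pi)) \<Longrightarrow> norm (fs g z) \<le> \<delta> * (2 + 4 / \<epsilon>)"
  by (rule norm_fs_le[OF g \<epsilon>(1)])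

text \<open>Fourier duality: the convolution with the coefficients of v turns into multiplication by
  v, and the cosine into the two translations by \<alpha>, with phases e and ei.\<close>

lemma schroedinger_eq:
  assumes z: "z \<in> W"
  shows "pot E z * u z - ei * u (z - of_real \<alpha>) - e * u (z + of_real \<alpha>) = fs g z"
proof -
  let ?z = "\<lambda>k. ep (of_int k * z)"
  note z' = W_subset[OF z]
  have V: "((\<lambda>l. vc l * ?z l) has_sum fs vc z) UNIV" by (rule fs_has_sum[OF vc \<epsilon>(1) z'])
  have U: "((\<lambda>k. a k * ?z k) has_sum u z) UNIV" by (rule fs_has_sum[OF a \<epsilon>n(1) z])
  define c where "c k = (of_real E * a k - of_real (2 * cos (2 * pi * (\<theta> + of_int k * \<alpha>))) * a k - g k) * ?z k" for k
  have "(c has_sum (of_real lam * fs vc z * u z)) UNIV"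
  proof (rule has_sum_convolution)
    show "(\<lambda>k. norm (of_real lam * (vc k * ?z k))) summable_on UNIV"
      using exp_decay_infsum(1)[OF exp_decay_ep[OF vc z']] \<epsilon> by (simp add: norm_mult summable_on_cmult_right)
    show "(\<lambda>k. norm (a k * ?z k)) summable_on UNIV"
      using exp_decay_infsum(1)[OF exp_decay_ep[OF a z]] \<epsilon>n by simp
    show "((\<lambda>k. of_real lam * (vc k * ?z k)) has_sum (of_real lam * fs vc z)) UNIV"
      by (rule has_sum_cmult_right[OF V])
    show "((\<lambda>l. of_real lam * (vc l * ?z l) * (a (k - l) * ?z (k - l))) has_sum c k) UNIV" for k
    proof -
      have eq: "of_real lam * (vc l * ?z l) * (a (k - l) * ?z (k - l)) = of_real lam * vc l * a (k - l) * ?z k" for l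
      proof -
        have "?z l * ?z (k - l) = ?z k" by (simp add: ep_add[symmetric] algebra_simps)
        moreover have "of_real lam * (vc l * ?z l) * (a (k - l) * ?z (k - l)) = of_real lam * vc l * a (k - l) * (?z l * ?z (k - l))"
          by (simp only: mult_ac)
        ultimately show ?thesis by simp
      qed
      show ?thesis unfolding eq c_def by (rule has_sum_cmult_left[OF dual])
    qed
  qed (rule U)
  moreover have "(c has_sum (of_real E * u z - (e * u (z + of_real \<alpha>) + ei * u (z - of_real \<alpha>)) - fs g z)) UNIV"
  proof -
    have 1: "((\<lambda>k. of_real E * (a k * ?z k)) has_sum (of_real E * u z)) UNIV" by (rule has_sum_cmult_right[OF U])
    have 2: "((\<lambda>k. e * (a k * ep (of_int k * (z + of_real \<alpha>)))) has_sum (e * u (z + of_real \<alpha>))) UNIV"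
      by (rule has_sum_cmult_right[OF fs_has_sum[OF a \<epsilon>n(1)]]) (use z in simp)
    have 3: "((\<lambda>k. ei * (a k * ep (of_int k * (z - of_real \<alpha>)))) has_sum (ei * u (z - of_real \<alpha>))) UNIV"
      by (rule has_sum_cmult_right[OF fs_has_sum[OF a \<epsilon>n(1)]]) (use z in simp)
    have 4: "((\<lambda>k. g k * ?z k) has_sum fs g z) UNIV" by (rule fs_has_sum[OF g \<epsilon>(1) z'])
    have "c k = of_real E * (a k * ?z k) - (e * (a k * ep (of_int k * (z + of_real \<alpha>)))
        + ei * (a k * ep (of_int k * (z - of_real \<alpha>)))) - g k * ?z k" for k
    proof -
      define x where "x = \<theta> + of_int k * \<alpha>"
      have "of_real (2 * cos (2 * pi * x)) = ep (of_real x) + ep (- of_real x)"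
      proof -
        define y where "y = 2 * pi * x"
        have 1: "ep (of_real x) = exp (\<i> * of_real y)" "ep (- of_real x) = exp (- (\<i> * of_real y))"
          by (simp_all add: ep_def y_def mult_ac)
        have 2: "of_real (2 * cos y) = 2 * cos (of_real y :: complex)" by (simp add: cos_of_real)
        show ?thesis unfolding y_def[symmetric] 1 2 cos_exp_eq by simp
      qed
      also have "ep (of_real x) = e * ep (of_int k * of_real \<alpha>)" by (simp add: x_def ep_add)
      also have "ep (- of_real x) = ei * ep (- (of_int k * of_real \<alpha>))" unfolding ep_add[symmetric] by (simp add: x_def)
      finally have cos: "of_real (2 * cos (2 * pi * x)) = e * ep (of_int k * of_real \<alpha>) + ei * ep (- (of_int k * of_real \<alpha>))" .
      have s: "ep (of_int k * (z + of_real \<alpha>)) = ?z k * ep (of_int k * of_real \<alpha>)"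
        "ep (of_int k * (z - of_real \<alpha>)) = ?z k * ep (- (of_int k * of_real \<alpha>))"
        by (simp_all add: ep_add[symmetric] algebra_simps)
      show ?thesis unfolding c_def x_def[symmetric] cos s by (simp add: algebra_simps)
    qed
    from iffD2[OF has_sum_cong[OF this] has_sum_diff[OF has_sum_diff[OF 1 has_sum_add[OF 2 3]] 4]]
    show ?thesis .
  qed
  ultimately have "of_real lam * fs vc z * u z
      = of_real E * u z - (e * u (z + of_real \<alpha>) + ei * u (z - of_real \<alpha>)) - fs g z"
    by (rule has_sum_unique)
  then show ?thesis by (simp add: pot_def algebra_simps)
qed

lemma orbit_average:
  fixes x :: real
  shows "\<exists>k<Kn n. norm (u (of_real (x + real k * \<alpha>))) \<ge> 1 / 2"
proof -
  let ?K = "Kn n"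
  define G where "G m = (\<Sum>k<?K. ep (of_real (real k * (of_int m * \<alpha>))))" for m :: int
  define r where "r m = (if m = 0 then 0 else a m * ep (of_int m * of_real x) * G m)" for m
  have h: "((\<lambda>m. \<Sum>k<?K. a m * ep (of_int m * of_real (x + real k * \<alpha>))) has_sum (\<Sum>k<?K. u (of_real (x + real k * \<alpha>)))) UNIV"
    by (intro has_sum_finite_sum fs_has_sum[OF a \<epsilon>n(1)] of_real_in_W) auto
  have tm: "(\<Sum>k<?K. a m * ep (of_int m * of_real (x + real k * \<alpha>))) = (if m = 0 then of_nat ?K else 0) + r m" for m
  proof (cases "m = 0")
    case False
    have eq: "a m * ep (of_int m * of_real (x + real k * \<alpha>))
        = a m * ep (of_int m * of_real x) * ep (of_real (real k * (of_int m * \<alpha>)))" for k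
      by (simp add: mult.assoc ep_add[symmetric]) (simp add: algebra_simps)
    show ?thesis unfolding eq using False by (simp add: r_def G_def sum_distrib_left)
  qed (simp add: r_def a0)
  have "((\<lambda>m::int. if m = 0 then of_nat ?K else 0) has_sum (of_nat ?K :: complex)) UNIV"
    by (rule has_sum_finite_neutralI[of "{0}"]) auto
  from has_sum_diff[OF h[unfolded tm] this]
  have r: "(r has_sum ((\<Sum>k<?K. u (of_real (x + real k * \<alpha>))) - of_nat ?K)) UNIV" by simp
  \<comment> \<open>The small divisor costs |m|^\<tau>. Half of the rate \<epsilon>/n turns this
    into a factor of order n^\<tau>, and the sum over the remaining half gives one more n; hence the
    exponent \<tau> + 1 in \<open>Kn\<close>.\<close>
  have "exp_decay (Cb * (fact \<tau> * (2 * n / \<epsilon>) ^ \<tau>) / \<kappa>) (\<epsilon> / n / 2) r"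
    unfolding exp_decay_def
  proof
    fix m
    define y where "y = \<bar>real_of_int m\<bar>"
    show "norm (r m) \<le> Cb * (fact \<tau> * (2 * n / \<epsilon>) ^ \<tau>) / \<kappa> * exp (- (\<epsilon> / n / 2) * \<bar>real_of_int m\<bar>)"
    proof (cases "m = 0")
      case True
      then show ?thesis using Cb \<kappa> n \<epsilon> by (simp add: r_def)
    next
      case False
      then have y: "y \<ge> 1" by (auto simp: y_def)
      have cn: "\<kappa> / y ^ \<tau> \<le> circle_norm (of_int m * \<alpha>)" using dio[OF False] by (simp add: y_def)
      have pos: "\<kappa> / y ^ \<tau> > 0" using \<kappa> y by simp
      have "norm (G m) \<le> 1 / circle_norm (of_int m * \<alpha>)"
        unfolding G_def by (rule norm_sum_ep_le) (use cn pos in linarith)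
      also have "\<dots> \<le> 1 / (\<kappa> / y ^ \<tau>)"
        by (rule divide_left_mono[OF cn zero_le_one mult_pos_pos[OF less_le_trans[OF pos cn] pos]])
      finally have Gm: "norm (G m) \<le> y ^ \<tau> / \<kappa>" by simp
      have "y ^ \<tau> \<le> fact \<tau> * (1 / (\<epsilon> / n / 2)) ^ \<tau> * exp (\<epsilon> / n / 2 * y)"
        by (rule power_le_fact_mult_exp) (use y \<epsilon>n in auto)
      also have "1 / (\<epsilon> / n / 2) = 2 * n / \<epsilon>" using n \<epsilon> by (simp add: field_simps)
      finally have ytau: "y ^ \<tau> \<le> fact \<tau> * (2 * n / \<epsilon>) ^ \<tau> * exp (\<epsilon> / n / 2 * y)" .
      have "norm (r m) = norm (a m) * norm (G m)"
        using False norm_ep_real[of "of_int m * x"] by (simp add: r_def norm_mult)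
      also have "\<dots> \<le> (Cb * exp (- (\<epsilon> / n) * y)) * (fact \<tau> * (2 * n / \<epsilon>) ^ \<tau> * exp (\<epsilon> / n / 2 * y) / \<kappa>)"
        using exp_decayD[OF a, of m] order_trans[OF Gm divide_right_mono[OF ytau]] \<kappa> Cb
        by (intro mult_mono) (auto simp: y_def)
      also have "\<dots> = Cb * (fact \<tau> * (2 * n / \<epsilon>) ^ \<tau>) / \<kappa> * (exp (- (\<epsilon> / n) * y) * exp (\<epsilon> / n / 2 * y))"
        by simp
      also have "exp (- (\<epsilon> / n) * y) * exp (\<epsilon> / n / 2 * y) = exp (- (\<epsilon> / n / 2) * y)"
        by (simp add: exp_add[symmetric])
      finally show ?thesis by (simp add: y_def)
    qed
  qed
  from exp_decay_infsum(3)[OF this] \<epsilon>n have "norm (infsum r UNIV)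
      \<le> Cb * (fact \<tau> * (2 * n / \<epsilon>) ^ \<tau>) / \<kappa> * (2 + 2 / (\<epsilon> / n / 2))" by simp
  also have "\<dots> \<le> Cb * (fact \<tau> * (2 * n / \<epsilon>) ^ \<tau>) / \<kappa> * ((2 + 4 / \<epsilon>) * n)"
    using Cb \<kappa> n \<epsilon> by (intro mult_left_mono) (auto simp: field_simps)
  also have "\<dots> = CS * n ^ (\<tau> + 1)"
    by (simp add: CS_def power_mult_distrib power_divide)
  also have "\<dots> \<le> real ?K / 2" using Kn_bounds(1)[OF n] by simp
  finally have "norm ((\<Sum>k<?K. u (of_real (x + real k * \<alpha>))) - of_nat ?K) \<le> real ?K / 2"
    using infsumI[OF r] by simp
  moreover have "norm (of_nat ?K :: complex) \<le> norm (\<Sum>k<?K. u (of_real (x + real k * \<alpha>)))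
      + norm ((\<Sum>k<?K. u (of_real (x + real k * \<alpha>))) - of_nat ?K)"
    using norm_triangle_sub[of "of_nat ?K :: complex" "\<Sum>k<?K. u (of_real (x + real k * \<alpha>))"] by (simp add: norm_minus_commute)
  ultimately have big: "real ?K / 2 \<le> norm (\<Sum>k<?K. u (of_real (x + real k * \<alpha>)))" by simp
  show ?thesis
  proof (rule ccontr)
    assume "\<not> (\<exists>k<Kn n. norm (u (of_real (x + real k * \<alpha>))) \<ge> 1 / 2)"
    then have small: "norm (u (of_real (x + real k * \<alpha>))) < 1 / 2" if "k < ?K" for k
      using that by (meson not_le)
    have "norm (\<Sum>k<?K. u (of_real (x + real k * \<alpha>))) \<le> (\<Sum>k<?K. norm (u (of_real (x + real k * \<alpha>))))"
      by (rule norm_sum)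
    also have "\<dots> < (\<Sum>k<?K. 1 / 2)"
      by (rule sum_strict_mono) (use small Kn_bounds(3)[OF n] in auto)
    finally show False using big by simp
  qed
qed

end

context bloch_setting
begin

lemma pot_seq_shift: "pot_seq E z (i + j) = pot_seq E (z + of_real (real i * \<alpha>)) j"
  by (simp add: pot_seq_def algebra_simps)

lemma growth_mono: "growth E S K M \<Longrightarrow> S' \<subseteq> S \<Longrightarrow> K' \<le> K \<Longrightarrow> M \<le> M' \<Longrightarrow> growth E S' K' M'"
  unfolding growth_def by (meson mult_right_mono nm_nonneg order_trans subsetD)

lemma pot_holomorphic: "pot E holomorphic_on strip (\<epsilon> / (4 * pi))"
  unfolding pot_def by (intro holomorphic_intros fs_holomorphic[OF vc \<epsilon>(1)])

lemma pot_periodic: "pot E (z + 1) = pot E z"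
  by (simp add: pot_def fs_periodic)

end

context bloch_wave
begin

definition "\<Gamma> = \<delta> * (2 + 4 / \<epsilon>)"

lemma \<Gamma>_nonneg: "\<Gamma> \<ge> 0"
  using exp_decay_nonneg[OF g] \<epsilon> by (simp add: \<Gamma>_def)

lemma crude_growth: "growth E (strip (\<epsilon> / (4 * pi))) K (\<Lambda> ^ K)"
  unfolding growth_def
proof (intro ballI allI impI)
  fix z k w assume z: "z \<in> strip (\<epsilon> / (4 * pi))" and k: "k \<le> K"
  have "nm (orb (pot_seq E z) w k) \<le> \<Lambda> ^ k * nm w"
    by (rule nm_orb_crude) (use z \<Lambda> pot_le in \<open>auto simp: pot_seq_def simp del: of_real_mult of_real_of_nat_eq\<close>)
  also have "\<dots> \<le> \<Lambda> ^ K * nm w" by (intro mult_right_mono power_increasing k \<Lambda>) simp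
  finally show "nm (orb (pot_seq E z) w k) \<le> \<Lambda> ^ K * nm w" .
qed

text \<open>Bilinear rather than Hermitian: it is the holomorphic continuation of |u(x)|^2 + |u(x -
  \<alpha>)|^2 from the real line.\<close>

definition "D z = u z * us z + u (z - of_real \<alpha>) * us (z - of_real \<alpha>)"

lemma D_of_real: "D (of_real x) = of_real ((norm (u (of_real x)))\<^sup>2 + (norm (u (of_real (x - \<alpha>))))\<^sup>2)"
  unfolding D_def of_real_add complex_norm_square
  using fs_reflect_real[of a x] fs_reflect_real[of a "x - \<alpha>"] by simp

lemma D_lipschitz:
  assumes z: "z \<in> W"
  shows "norm (D z - D (of_real (Re z))) \<le> 4 * CL * Cu * n ^ 3 * \<bar>Im z\<bar>"
proof -
  have L: "C = Cb \<Longrightarrow> C * (8 * pi / (\<epsilon> / n)) * (2 + 8 / (\<epsilon> / n)) * \<bar>y\<bar> \<le> CL * n\<^sup>2 * \<bar>y\<bar>" for y C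
  proof -
    assume C: "C = Cb"
    have "(8 * pi / (\<epsilon> / n)) * (2 + 8 / (\<epsilon> / n)) \<le> (8 * pi / \<epsilon> * n) * ((2 + 8 / \<epsilon>) * n)"
      using n \<epsilon> by (intro mult_mono) (auto simp: field_simps)
    then have "Cb * ((8 * pi / (\<epsilon> / n)) * (2 + 8 / (\<epsilon> / n))) \<le> Cb * ((8 * pi / \<epsilon> * n) * ((2 + 8 / \<epsilon>) * n))"
      using Cb by (intro mult_left_mono) auto
    also have "\<dots> = CL * n\<^sup>2" by (simp add: CL_def power2_eq_square)
    finally have "C * (8 * pi / (\<epsilon> / n)) * (2 + 8 / (\<epsilon> / n)) \<le> CL * n\<^sup>2" using C by (simp add: mult.assoc)
    then show ?thesis by (rule mult_right_mono) simp
  qed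
  have pr: "norm (u w * us w - u (of_real (Re w)) * us (of_real (Re w))) \<le> 2 * (CL * n\<^sup>2 * \<bar>Im w\<bar>) * (Cu * n)"
    if w: "w \<in> W" for w
  proof -
    let ?x = "of_real (Re w) :: complex"
    have 1: "norm (u w - u ?x) \<le> CL * n\<^sup>2 * \<bar>Im w\<bar>"
      using fs_lipschitz_Im[OF a \<epsilon>n(1) w] L[OF refl] by (rule order_trans)
    have 2: "norm (us w - us ?x) \<le> CL * n\<^sup>2 * \<bar>Im w\<bar>"
      using fs_lipschitz_Im[OF as \<epsilon>n(1) w] L[OF refl] by (rule order_trans)
    have "u w * us w - u ?x * us ?x = (u w - u ?x) * us w + u ?x * (us w - us ?x)" by (simp add: algebra_simps)
    also have "norm \<dots> \<le> norm (u w - u ?x) * norm (us w) + norm (u ?x) * norm (us w - us ?x)"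
      by (metis norm_mult norm_triangle_ineq)
    also have "\<dots> \<le> (CL * n\<^sup>2 * \<bar>Im w\<bar>) * (Cu * n) + (Cu * n) * (CL * n\<^sup>2 * \<bar>Im w\<bar>)"
      using CL_pos Cu_ge n by (intro add_mono mult_mono 1 2 u_le us_le w of_real_in_W) auto
    also have "\<dots> = 2 * (CL * n\<^sup>2 * \<bar>Im w\<bar>) * (Cu * n)" by simp
    finally show ?thesis .
  qed
  let ?x = "of_real (Re z) :: complex"
  have "norm (D z - D ?x) \<le> norm (u z * us z - u ?x * us ?x)
      + norm (u (z - of_real \<alpha>) * us (z - of_real \<alpha>) - u (?x - of_real \<alpha>) * us (?x - of_real \<alpha>))"
    unfolding D_def add_diff_add by (rule norm_triangle_ineq)
  also have "\<dots> \<le> 2 * (CL * n\<^sup>2 * \<bar>Im z\<bar>) * (Cu * n) + 2 * (CL * n\<^sup>2 * \<bar>Im z\<bar>) * (Cu * n)"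
    using pr[OF z] pr[of "z - of_real \<alpha>"] z by (intro add_mono) (auto simp del: of_real_diff simp: of_real_diff[symmetric])
  also have "\<dots> = 4 * CL * Cu * n ^ 3 * \<bar>Im z\<bar>" by (simp add: power2_eq_square power3_eq_cube)
  finally show ?thesis .
qed

end

text \<open>The last hypothesis keeps the accumulated defect over \<open>Kn n\<close> steps below
  1/4, half of the lower bound 1/2 from \<open>orbit_average\<close>. It couples growth and defect:
  a worse growth bound demands a later next resonance.\<close>

locale bloch_frame = bloch_wave +
  fixes M :: real
  assumes M: "M \<ge> 1" and gr: "growth E \<real> (Kn n) M" and small: "M * real (Kn n) * \<Gamma> \<le> 1 / 4"
begin

lemma wave_lower_bound: "norm (u (of_real x)) + norm (u (of_real (x - \<alpha>))) \<ge> 1 / (4 * M)"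
proof -
  obtain k where k: "k < Kn n" "norm (u (of_real (x + real k * \<alpha>))) \<ge> 1 / 2"
    using orbit_average by blast
  define z where "z i = (of_real x + of_real (real i * \<alpha>) :: complex)" for i
  \<comment> \<open>The vector U at the i-th point of the orbit, with the phase e^i restored. In
    this normalization it is an orbit of the transfer matrices up to an error \<Gamma> in each step,
    so a small value at x would stay small up to the time k where |u| >= 1/2.\<close>
  define y where "y i = (ep (of_real (real i * \<theta>)) * e * u (z i), ep (of_real (real i * \<theta>)) * u (z i - of_real \<alpha>))" for i
  have zW: "z i \<in> W" for i using of_real_in_W[of "x + real i * \<alpha>"] by (simp add: z_def)
  have z_Suc: "z (Suc i) = z i + of_real \<alpha>" for i by (simp add: z_def algebra_simps)
  have st: "nm (y (Suc i) - schr_step (pot_seq E (of_real x) i) (y i)) \<le> \<Gamma>" for i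
  proof -
    have es: "ep (of_real (real (Suc i) * \<theta>)) = ep (of_real (real i * \<theta>)) * e"
      by (simp add: ep_add[symmetric] algebra_simps)
    have "e * (pot E (z i) * u (z i)) = e * (fs g (z i) + ei * u (z i - of_real \<alpha>) + e * u (z i + of_real \<alpha>))"
      using schroedinger_eq[OF zW[of i]] by (simp add: algebra_simps)
    also have "\<dots> = e * fs g (z i) + (e * ei) * u (z i - of_real \<alpha>) + e * (e * u (z i + of_real \<alpha>))"
      by (simp add: algebra_simps)
    finally have eq: "e * (pot E (z i) * u (z i)) = e * fs g (z i) + u (z i - of_real \<alpha>) + e * (e * u (z i + of_real \<alpha>))"
      unfolding e_ei(1) by simp
    have "pot_seq E (of_real x) i * (ep (of_real (real i * \<theta>)) * e * u (z i))
        = ep (of_real (real i * \<theta>)) * (e * (pot E (z i) * u (z i)))"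
      by (simp add: pot_seq_def z_def)
    then have "y (Suc i) - schr_step (pot_seq E (of_real x) i) (y i) = (- (ep (of_real (real i * \<theta>)) * (e * fs g (z i))), 0)"
      unfolding y_def schr_step_def es z_Suc eq by (simp add: algebra_simps)
    then have "nm (y (Suc i) - schr_step (pot_seq E (of_real x) i) (y i)) = norm (fs g (z i))"
      using norm_ep_real[of "real i * \<theta>"] e_ei by (simp add: nm_def norm_mult)
    also have "\<dots> \<le> \<Gamma>" unfolding \<Gamma>_def by (rule fs_g_le[OF W_subset[OF zW]])
    finally show ?thesis .
  qed
  have "nm (y k) \<le> M * (nm (y 0) + real k * \<Gamma>)"
  proof (rule nm_perturbed_orbit[where a = "pot_seq E (of_real x)" and \<gamma> = \<Gamma>])
    fix i l w assume "i + l \<le> k"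
    then have l: "l \<le> Kn n" using k by simp
    have ps: "(\<lambda>j. pot_seq E (of_real x) (i + j)) = pot_seq E (of_real (x + real i * \<alpha>))"
      by (auto simp: pot_seq_shift)
    show "nm (orb (\<lambda>j. pot_seq E (of_real x) (i + j)) w l) \<le> M * nm w"
      unfolding ps using gr l unfolding growth_def by (metis Reals_of_real)
  qed (use M st in auto)
  moreover have "norm (u (z k)) \<le> nm (y k)"
    using norm_ep_real[of "real k * \<theta>"] e_ei by (simp add: nm_def y_def norm_mult)
  moreover have "norm (u (z k)) \<ge> 1 / 2" using k by (simp add: z_def)
  moreover have "M * (real k * \<Gamma>) \<le> M * (real (Kn n) * \<Gamma>)"
    using k M \<Gamma>_nonneg by (intro mult_left_mono mult_right_mono) auto
  ultimately have "1 / 4 \<le> M * nm (y 0)" using small by (simp add: distrib_left mult.assoc)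
  then have "1 / (4 * M) \<le> nm (y 0)" using M by (simp add: field_simps)
  also have "nm (y 0) = norm (u (of_real x)) + norm (u (of_real (x - \<alpha>)))"
    using e_ei by (simp add: nm_def y_def z_def norm_mult)
  finally show ?thesis .
qed

definition "H = width n M"
definition "P = frame n M"

lemma H: "H > 0" "H \<le> \<epsilon> / n / (4 * pi)" "H \<le> \<epsilon> / (4 * pi)"
  unfolding H_def by (rule width_bounds[OF n M])+

lemma in_W: "z \<in> strip H \<Longrightarrow> z \<in> W"
  using strip_mono[OF H(2)] by blast

text \<open>On the real line \<open>D\<close> is a sum of squares, at least half the square of the
  sum 1/(4 M). The width \<open>H\<close> is chosen so that moving off the line costs at most half
  of this.\<close>

lemma D_lower:
  assumes z: "z \<in> strip H"
  shows "norm (D z) \<ge> 1 / (64 * M\<^sup>2)"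
proof -
  let ?x = "Re z"
  define p where "p = norm (u (of_real ?x))"
  define q where "q = norm (u (of_real (?x - \<alpha>)))"
  have "1 / (4 * M) \<le> p + q" using wave_lower_bound[of ?x] by (simp add: p_def q_def)
  then have "(1 / (4 * M))\<^sup>2 \<le> (p + q)\<^sup>2" using M by (intro power_mono) auto
  also have "\<dots> \<le> 2 * (p\<^sup>2 + q\<^sup>2)" using zero_le_power2[of "p - q"] by (simp add: power2_eq_square algebra_simps)
  finally have "1 / (32 * M\<^sup>2) \<le> p\<^sup>2 + q\<^sup>2" by (simp add: power_divide power_mult_distrib)
  moreover have "norm (D (of_real ?x)) = p\<^sup>2 + q\<^sup>2" 
    unfolding D_of_real norm_of_real by (simp add: p_def q_def)
  moreover have "norm (D z - D (of_real ?x)) \<le> 1 / (64 * M\<^sup>2)"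
  proof -
    have "norm (D z - D (of_real ?x)) \<le> 4 * CL * Cu * n ^ 3 * \<bar>Im z\<bar>" by (rule D_lipschitz[OF in_W[OF z]])
    also have "\<dots> \<le> 4 * CL * Cu * n ^ 3 * width n M"
      using z CL_pos Cu_ge n by (intro mult_left_mono) (auto simp: strip_def H_def)
    also have "\<dots> = 1 / (64 * M\<^sup>2)"
      using CL_pos Cu_ge n M by (simp add: width_def CH_def field_simps)
    finally show ?thesis .
  qed
  moreover have "norm (D (of_real ?x)) \<le> norm (D z) + norm (D z - D (of_real ?x))"
    using norm_triangle_sub[of "D (of_real ?x)" "D z"] by (simp add: norm_minus_commute)
  moreover have "1 / (32 * M\<^sup>2) = 1 / (64 * M\<^sup>2) + 1 / (64 * M\<^sup>2)" by simp
  ultimately show ?thesis by linarith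
qed

lemma D_nonzero: "z \<in> strip H \<Longrightarrow> D z \<noteq> 0"
  using D_lower[of z] M by (auto simp: field_simps)

lemma P_ge: "P \<ge> 1" "Cu * n \<le> P"
proof -
  have "1 \<le> 64 * M\<^sup>2" using one_le_power[OF M, of 2] by linarith
  then show 1: "Cu * n \<le> P" using Cu_ge n mult_right_mono[of 1 "64 * M\<^sup>2" "Cu * n"] by (simp add: P_def frame_def mult_ac)
  have "1 * 1 \<le> Cu * n" using Cu_ge n by (intro mult_mono) auto
  with 1 show "P \<ge> 1" by simp
qed

lemma div_D_le:
  assumes z: "z \<in> strip H" and w: "norm w \<le> c * (Cu * n)" and c: "c \<ge> 0"
  shows "norm (w / D z) \<le> c * P"
proof -
  have "norm w / norm (D z) \<le> (c * (Cu * n)) / (1 / (64 * M\<^sup>2))"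
    using w D_lower[OF z] M c Cu_ge n by (intro frac_le) auto
  then show ?thesis by (simp add: norm_divide P_def frame_def mult_ac)
qed

text \<open>The frame consists of U = (e u, u(. - \<alpha>)) and V = (V1, V2). The coordinates
  \<open>sc\<close> and \<open>tc\<close> of Z are the determinants det (Z, V) and det (U, Z). The
  entries \<open>b1\<close>, \<open>b3\<close>, \<open>b4\<close> carry the defect as a factor,
  whereas \<open>b\<close> does not.\<close>

definition "V1 z = - (us (z - of_real \<alpha>) / D z)"
definition "V2 z = ei * us z / D z"
definition "b1 z = ei * (e * fs g z) * us (z + of_real \<alpha>) / D (z + of_real \<alpha>)"
definition "b3 z = - (e * fs g z) * u z"
definition "b4 z = ei * (e * fs g z) * us (z - of_real \<alpha>) / D z"
definition "b z = (ei * us (z + of_real \<alpha>) * (pot E z * V1 z - V2 z) + us z * V1 z) / D (z + of_real \<alpha>)"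
definition "sc z Z = (ei * us z * fst Z + us (z - of_real \<alpha>) * snd Z) / D z"
definition "tc z Z = e * u z * snd Z - u (z - of_real \<alpha>) * fst Z"

lemma frame_identities:
  assumes z: "z \<in> strip H"
  shows "fst Z = sc z Z * (e * u z) + tc z Z * V1 z" "snd Z = sc z Z * u (z - of_real \<alpha>) + tc z Z * V2 z"
    and "sc (z + of_real \<alpha>) (schr_step (pot E z) Z) = (e + b1 z) * sc z Z + b z * tc z Z"
    and "tc (z + of_real \<alpha>) (schr_step (pot E z) Z) = (ei + b4 z) * tc z Z + b3 z * sc z Z"
proof -
  have za: "z + of_real \<alpha> \<in> strip H" using z by simp
  have "e * (pot E z * u z) = e * (fs g z + ei * u (z - of_real \<alpha>) + e * u (z + of_real \<alpha>))"
    using schroedinger_eq[OF in_W[OF z]] by (simp add: algebra_simps)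
  also have "\<dots> = e * fs g z + (e * ei) * u (z - of_real \<alpha>) + e * (e * u (z + of_real \<alpha>))"
    by (simp add: algebra_simps)
  finally have eq: "pot E z * e * u z - u (z - of_real \<alpha>) = e * e * u (z + of_real \<alpha>) + e * fs g z"
    unfolding e_ei(1) by (simp add: algebra_simps)
  note fr = frame_step[OF e_ei(1) D_def[of z] D_nonzero[OF z] _ D_nonzero[OF za] eq,
      where ?Z1.0 = "fst Z" and ?Z2.0 = "snd Z" and ups = "us (z + of_real \<alpha>)"]
  have Dp: "D (z + of_real \<alpha>) = u (z + of_real \<alpha>) * us (z + of_real \<alpha>) + u z * us z"
    by (simp add: D_def)
  show "fst Z = sc z Z * (e * u z) + tc z Z * V1 z" "snd Z = sc z Z * u (z - of_real \<alpha>) + tc z Z * V2 z"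
    using fr(1,2)[OF Dp] by (simp_all only: sc_def tc_def V1_def V2_def)
  show "sc (z + of_real \<alpha>) (schr_step (pot E z) Z) = (e + b1 z) * sc z Z + b z * tc z Z"
    using fr(3)[OF Dp] by (simp only: sc_def tc_def V1_def V2_def b1_def b_def schr_step_def fst_conv snd_conv add_diff_cancel_right')
  show "tc (z + of_real \<alpha>) (schr_step (pot E z) Z) = (ei + b4 z) * tc z Z + b3 z * sc z Z"
    using fr(4)[OF Dp] by (simp only: sc_def tc_def V1_def V2_def b3_def b4_def schr_step_def fst_conv snd_conv add_diff_cancel_right')
qed

lemma frame_bounds:
  assumes z: "z \<in> strip H"
  shows "norm (b1 z) \<le> \<Gamma> * P" "norm (b3 z) \<le> \<Gamma> * P" "norm (b4 z) \<le> \<Gamma> * P" "norm (b z) \<le> 2 * \<Lambda> * P\<^sup>2"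
    and "norm (V1 z) \<le> P" "norm (V2 z) \<le> P" "norm (u z) \<le> P" "norm (u (z - of_real \<alpha>)) \<le> P"
proof -
  have zW: "z \<in> W" "z - of_real \<alpha> \<in> W" "z + of_real \<alpha> \<in> W" using in_W[OF z] by auto
  have za: "z + of_real \<alpha> \<in> strip H" using z by simp
  have g: "norm (fs g z) \<le> \<Gamma>" unfolding \<Gamma>_def by (rule fs_g_le[OF W_subset[OF zW(1)]])
  show "norm (u z) \<le> P" "norm (u (z - of_real \<alpha>)) \<le> P"
    using u_le[OF zW(1)] u_le[OF zW(2)] P_ge by linarith+
  show V1: "norm (V1 z) \<le> P" unfolding V1_def norm_minus_cancel
    using div_D_le[OF z, of "us (z - of_real \<alpha>)" 1] us_le[OF zW(2)] by simp
  show V2: "norm (V2 z) \<le> P" unfolding V2_def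
    using div_D_le[OF z, of "ei * us z" 1] us_le[OF zW(1)] e_ei by (simp add: norm_mult)
  have gu: "norm (ei * (e * fs g z) * us w) \<le> \<Gamma> * (Cu * n)" if "w \<in> W" for w
    using e_ei g us_le[OF that] \<Gamma>_nonneg by (auto simp: norm_mult intro!: mult_mono)
  show "norm (b1 z) \<le> \<Gamma> * P" unfolding b1_def by (rule div_D_le[OF za gu[OF zW(3)] \<Gamma>_nonneg])
  show "norm (b4 z) \<le> \<Gamma> * P" unfolding b4_def by (rule div_D_le[OF z gu[OF zW(2)] \<Gamma>_nonneg])
  have "norm (b3 z) = norm (fs g z) * norm (u z)" using e_ei by (simp add: b3_def norm_mult)
  also have "\<dots> \<le> \<Gamma> * P" using g u_le[OF zW(1)] P_ge \<Gamma>_nonneg by (intro mult_mono) auto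
  finally show "norm (b3 z) \<le> \<Gamma> * P" .
  have pot: "norm (pot E z) + 1 \<le> \<Lambda>" by (rule pot_le[OF W_subset[OF zW(1)]])
  have "norm (pot E z * V1 z - V2 z) \<le> norm (pot E z) * norm (V1 z) + norm (V2 z)"
    by (metis norm_mult norm_triangle_ineq4)
  also have "\<dots> \<le> norm (pot E z) * P + P" by (intro add_mono mult_left_mono V1 V2) simp
  also have "\<dots> \<le> \<Lambda> * P" using mult_right_mono[OF pot, of P] P_ge by (simp add: algebra_simps)
  finally have X: "norm (pot E z * V1 z - V2 z) \<le> \<Lambda> * P" .
  have "norm (ei * us (z + of_real \<alpha>) * (pot E z * V1 z - V2 z) + us z * V1 z)
      \<le> norm (us (z + of_real \<alpha>)) * norm (pot E z * V1 z - V2 z) + norm (us z) * norm (V1 z)"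
    by (rule order_trans[OF norm_triangle_ineq]) (simp add: norm_mult e_ei)
  also have "\<dots> \<le> (Cu * n) * (\<Lambda> * P) + (Cu * n) * P"
    using Cu_ge n by (intro add_mono mult_mono us_le zW X V1) auto
  also have "\<dots> \<le> (Cu * n) * (\<Lambda> * P) + (Cu * n) * (\<Lambda> * P)"
    using Cu_ge n P_ge \<Lambda> by (intro add_left_mono mult_left_mono) auto
  finally have "norm (ei * us (z + of_real \<alpha>) * (pot E z * V1 z - V2 z) + us z * V1 z) \<le> (2 * \<Lambda> * P) * (Cu * n)"
    by (simp add: mult_ac)
  from div_D_le[OF za this] show "norm (b z) \<le> 2 * \<Lambda> * P\<^sup>2"
    unfolding b_def using \<Lambda> P_ge by (simp add: power2_eq_square mult_ac)
qed

lemma coord_bounds: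
  assumes z: "z \<in> strip H"
  shows "norm (sc z Z) + norm (tc z Z) \<le> 2 * P * nm Z" "nm Z \<le> 2 * P * (norm (sc z Z) + norm (tc z Z))"
proof -
  note fb = frame_bounds[OF z]
  have "sc z Z = V2 z * fst Z + - V1 z * snd Z" by (simp add: sc_def V1_def V2_def add_divide_distrib)
  then have "norm (sc z Z) \<le> norm (V2 z) * norm (fst Z) + norm (V1 z) * norm (snd Z)"
    by (metis norm_minus_cancel norm_mult norm_triangle_ineq)
  also have "\<dots> \<le> P * norm (fst Z) + P * norm (snd Z)" by (intro add_mono mult_right_mono fb) auto
  finally have 1: "norm (sc z Z) \<le> P * nm Z" by (simp add: nm_def algebra_simps)
  have "norm (tc z Z) \<le> norm (u z) * norm (snd Z) + norm (u (z - of_real \<alpha>)) * norm (fst Z)"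
    unfolding tc_def by (rule order_trans[OF norm_triangle_ineq4]) (simp add: norm_mult e_ei)
  also have "\<dots> \<le> P * norm (snd Z) + P * norm (fst Z)" by (intro add_mono mult_right_mono fb) auto
  finally have 2: "norm (tc z Z) \<le> P * nm Z" by (simp add: nm_def algebra_simps)
  from 1 2 show "norm (sc z Z) + norm (tc z Z) \<le> 2 * P * nm Z" by simp
  have "norm (fst Z) \<le> norm (sc z Z) * norm (u z) + norm (tc z Z) * norm (V1 z)"
    by (subst frame_identities(1)[OF z], rule order_trans[OF norm_triangle_ineq]) (simp add: norm_mult e_ei)
  also have "\<dots> \<le> norm (sc z Z) * P + norm (tc z Z) * P" by (intro add_mono mult_left_mono fb) auto
  finally have 3: "norm (fst Z) \<le> norm (sc z Z) * P + norm (tc z Z) * P" .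
  have "norm (snd Z) \<le> norm (sc z Z) * norm (u (z - of_real \<alpha>)) + norm (tc z Z) * norm (V2 z)"
    by (subst frame_identities(2)[OF z], rule order_trans[OF norm_triangle_ineq]) (simp add: norm_mult e_ei)
  also have "\<dots> \<le> norm (sc z Z) * P + norm (tc z Z) * P" by (intro add_mono mult_left_mono fb) auto
  finally have "norm (snd Z) \<le> norm (sc z Z) * P + norm (tc z Z) * P" .
  with 3 show "nm Z \<le> 2 * P * (norm (sc z Z) + norm (tc z Z))" by (simp add: nm_def algebra_simps)
qed

lemma orbit_in_frame:
  assumes z: "z \<in> strip H"
  defines "zz i \<equiv> z + of_real (real i * \<alpha>)"
  shows "triangular_orbit e ei (\<lambda>i. b1 (zz i)) (\<lambda>i. b (zz i)) (\<lambda>i. b3 (zz i)) (\<lambda>i. b4 (zz i))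
    (\<lambda>i. sc (zz i) (orb (pot_seq E z) w i)) (\<lambda>i. tc (zz i) (orb (pot_seq E z) w i)) k (\<Gamma> * P)"
proof
  have zz: "zz i \<in> strip H" for i using z by (simp add: zz_def del: of_real_mult)
  have zz_Suc: "zz (Suc i) = zz i + of_real \<alpha>" for i by (simp add: zz_def algebra_simps)
  have ps: "pot_seq E z i = pot E (zz i)" for i by (simp add: pot_seq_def zz_def)
  show "norm e = 1" "norm ei = 1" "e * ei = 1" by (rule e_ei)+
  show "sc (zz (Suc i)) (orb (pot_seq E z) w (Suc i))
      = (e + b1 (zz i)) * sc (zz i) (orb (pot_seq E z) w i) + b (zz i) * tc (zz i) (orb (pot_seq E z) w i)" for i
    unfolding zz_Suc orb.simps ps by (rule frame_identities(3)[OF zz])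
  show "tc (zz (Suc i)) (orb (pot_seq E z) w (Suc i))
      = (ei + b4 (zz i)) * tc (zz i) (orb (pot_seq E z) w i) + b3 (zz i) * sc (zz i) (orb (pot_seq E z) w i)" for i
    unfolding zz_Suc orb.simps ps by (rule frame_identities(4)[OF zz])
  show "norm (b1 (zz i)) \<le> \<Gamma> * P" "norm (b3 (zz i)) \<le> \<Gamma> * P" "norm (b4 (zz i)) \<le> \<Gamma> * P" for i
    by (rule frame_bounds[OF zz])+
qed

text \<open>The bound is linear in K and the strip does not depend on K: up to the time at which the
  defect becomes visible the triangular form forbids exponential growth. Applied with K the orbit
  length at the next resonance, this is the step of the bootstrap.\<close>

lemma frame_growth:
  assumes K: "K \<ge> 1" and small': "\<Gamma> * P * (2 * \<Lambda> * P\<^sup>2 * (real K)\<^sup>2) \<le> 1"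
  shows "growth E (strip H) K (8 * exp 3 * \<Lambda> * P ^ 4 * real K)"
  unfolding growth_def
proof (intro ballI allI impI)
  fix z k w assume z: "z \<in> strip H" and k: "k \<le> K"
  define zz where "zz i = z + of_real (real i * \<alpha>)" for i
  have zz: "zz i \<in> strip H" for i using z by (simp add: zz_def del: of_real_mult)
  interpret triangular_orbit e ei "\<lambda>i. b1 (zz i)" "\<lambda>i. b (zz i)" "\<lambda>i. b3 (zz i)" "\<lambda>i. b4 (zz i)"
    "\<lambda>i. sc (zz i) (orb (pot_seq E z) w i)" "\<lambda>i. tc (zz i) (orb (pot_seq E z) w i)" k "\<Gamma> * P"
    unfolding zz_def by (rule orbit_in_frame[OF z])
  have B: "2 * \<Lambda> * P\<^sup>2 \<ge> 1" using \<Lambda> P_ge one_le_power[of P 2] mult_mono[of 1 "2 * \<Lambda>" 1 "P\<^sup>2"] by simp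
  have "norm (sc (zz k) (orb (pot_seq E z) w k)) + norm (tc (zz k) (orb (pot_seq E z) w k))
      \<le> exp 3 * (2 * \<Lambda> * P\<^sup>2 * real K) * (norm (sc (zz 0) (orb (pot_seq E z) w 0)) + norm (tc (zz 0) (orb (pot_seq E z) w 0)))"
    by (rule triangular_growth[OF _ B]) (use K k small' \<Gamma>_nonneg P_ge in \<open>auto intro: frame_bounds zz\<close>)
  also have "\<dots> \<le> exp 3 * (2 * \<Lambda> * P\<^sup>2 * real K) * (2 * P * nm w)"
    using coord_bounds(1)[OF zz[of 0], of w] \<Lambda> by (intro mult_left_mono) auto
  finally have st: "norm (sc (zz k) (orb (pot_seq E z) w k)) + norm (tc (zz k) (orb (pot_seq E z) w k))
      \<le> exp 3 * (2 * \<Lambda> * P\<^sup>2 * real K) * (2 * P * nm w)" .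
  have "nm (orb (pot_seq E z) w k) \<le> 2 * P * (exp 3 * (2 * \<Lambda> * P\<^sup>2 * real K) * (2 * P * nm w))"
    by (rule order_trans[OF coord_bounds(2)[OF zz[of k]] mult_left_mono[OF st]]) (use P_ge in auto)
  also have "\<dots> = 8 * exp 3 * \<Lambda> * P ^ 4 * real K * nm w" by (simp add: power2_eq_square power4_eq_xxxx)
  finally show "nm (orb (pot_seq E z) w k) \<le> 8 * exp 3 * \<Lambda> * P ^ 4 * real K * nm w" .
qed

end

lemma holomorphic_on_strip_shift:
  assumes "f holomorphic_on strip h"
  shows "(\<lambda>z. f (z + of_real c)) holomorphic_on strip h" "(\<lambda>z. f (z - of_real c)) holomorphic_on strip h"
proof -
  have "(f \<circ> (\<lambda>z. z + of_real c)) holomorphic_on strip h" for c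
    by (rule holomorphic_on_compose_gen[OF _ assms]) (auto intro!: holomorphic_intros)
  from this[of c] this[of "- c"] show "(\<lambda>z. f (z + of_real c)) holomorphic_on strip h" "(\<lambda>z. f (z - of_real c)) holomorphic_on strip h"
    by (simp_all add: o_def)
qed

text \<open>The identity serves as \<Phi>, and the whole cocycle minus the diagonal matrix goes into
  the error. This suffices where both n and N are bounded, since the required bounds are then at
  least fixed constants.\<close>

lemma (in bloch_wave) conjugation_at_bounded_scale:
  assumes h: "0 < h" "h \<le> \<epsilon> / (4 * pi)" and v: "\<And>x. fs vc (of_real x) = of_real (v x)"
    and B: "4 \<le> B'" "\<Lambda> \<le> \<beta>" "1 \<le> b"
  shows "conjugable v lam \<alpha> E \<theta> h B' \<beta> b"
proof (rule conjugation_from_strip_functions[where ?P11.0 = "\<lambda>_. 1" and ?P12.0 = "\<lambda>_. 0" and ?P21.0 = "\<lambda>_. 0" and ?P22.0 = "\<lambda>_. 1"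
      and ?Q1.0 = "\<lambda>z. pot E z - e" and Q = "\<lambda>_. -1" and ?Q3.0 = "\<lambda>_. 1" and ?Q4.0 = "\<lambda>_. - ei" and B = 1])
  show "(\<lambda>z. pot E z - e) holomorphic_on strip h"
    by (intro holomorphic_intros holomorphic_on_subset[OF pot_holomorphic strip_mono[OF h(2)]])
  show "norm (pot E z - e) \<le> \<beta>" if "z \<in> strip h" for z
    using pot_le[of z] strip_mono[OF h(2)] that norm_triangle_ineq4[of "pot E z" e] e_ei B by fastforce
qed (use B \<Lambda> h e_ei v in \<open>auto simp: pot_def\<close>)

context bloch_frame
begin

lemma u_hol: "u holomorphic_on strip H" "us holomorphic_on strip H"
  by (rule holomorphic_on_subset[OF fs_holomorphic[OF a \<epsilon>n(1)] strip_mono[OF H(2)]])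
     (rule holomorphic_on_subset[OF fs_holomorphic[OF as \<epsilon>n(1)] strip_mono[OF H(2)]])

lemma g_hol: "fs g holomorphic_on strip H"
  by (rule holomorphic_on_subset[OF fs_holomorphic[OF g \<epsilon>(1)] strip_mono[OF H(3)]])

lemma pot_hol: "pot E holomorphic_on strip H"
  by (rule holomorphic_on_subset[OF pot_holomorphic strip_mono[OF H(3)]])

lemma D_hol: "D holomorphic_on strip H"
  unfolding D_def by (intro holomorphic_intros holomorphic_on_strip_shift u_hol)

lemma frame_holomorphic:
  "V1 holomorphic_on strip H" "V2 holomorphic_on strip H" "b1 holomorphic_on strip H" "b3 holomorphic_on strip H"
  "b4 holomorphic_on strip H" "b holomorphic_on strip H"
proof -
  have Dn: "D (z + of_real \<alpha>) \<noteq> 0" if "z \<in> strip H" for z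
    by (rule D_nonzero) (use that in simp)
  show V: "V1 holomorphic_on strip H" "V2 holomorphic_on strip H"
    unfolding V1_def V2_def using D_nonzero
    by (auto intro!: holomorphic_intros holomorphic_on_strip_shift u_hol D_hol)
  show "b1 holomorphic_on strip H" "b3 holomorphic_on strip H" "b4 holomorphic_on strip H"
    unfolding b1_def b3_def b4_def using D_nonzero Dn
    by (auto intro!: holomorphic_intros holomorphic_on_strip_shift u_hol D_hol g_hol)
  show "b holomorphic_on strip H"
    unfolding b_def using Dn
    by (auto intro!: holomorphic_intros holomorphic_on_strip_shift u_hol D_hol pot_hol V)
qed

lemma frame_periodic: "V1 (z + 1) = V1 z" "V2 (z + 1) = V2 z" "b (z + 1) = b z"
proof -
  have s: "z + 1 + c = (z + c) + 1" "z + 1 - c = (z - c) + 1" for z c :: complex by simp_all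
  have D: "D (z + 1) = D z" for z unfolding D_def s fs_periodic ..
  show V: "V1 (z + 1) = V1 z" "V2 (z + 1) = V2 z" for z unfolding V1_def V2_def s fs_periodic D by (rule refl)+
  show "b (z + 1) = b z" unfolding b_def s fs_periodic D V pot_periodic by (rule refl)
qed

section \<open>Shears of the frame\<close>

definition "st \<phi> z Z = sc z Z + \<phi> z * tc z Z"
definition "Q1 \<phi> z = b1 z + \<phi> (z + of_real \<alpha>) * b3 z"
definition "Q4 \<phi> z = b4 z - b3 z * \<phi> z"
text \<open>The off-diagonal entry after the shear s + \<phi> t. The first bracket is the residue of
  the cohomological equation for b; the other terms carry the defect.\<close>

definition "Qq \<phi> z = (b z - e * \<phi> z + ei * \<phi> (z + of_real \<alpha>))
  - b1 z * \<phi> z + \<phi> (z + of_real \<alpha>) * b4 z - \<phi> (z + of_real \<alpha>) * b3 z * \<phi> z"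

lemma modified_frame_step:
  assumes z: "z \<in> strip H"
  shows "st \<phi> (z + of_real \<alpha>) (schr_step (pot E z) Z) = (e + Q1 \<phi> z) * st \<phi> z Z + Qq \<phi> z * tc z Z"
    and "tc (z + of_real \<alpha>) (schr_step (pot E z) Z) = (ei + Q4 \<phi> z) * tc z Z + b3 z * st \<phi> z Z"
  unfolding st_def Q1_def Q4_def Qq_def frame_identities(3,4)[OF z] by (simp_all add: algebra_simps)

lemma modified_frame_bounds:
  assumes z: "z \<in> strip H" and \<phi>: "norm (\<phi> z) \<le> \<Psi>" "norm (\<phi> (z + of_real \<alpha>)) \<le> \<Psi>" and \<Psi>: "\<Psi> \<ge> 1"
    and T: "norm (b z - e * \<phi> z + ei * \<phi> (z + of_real \<alpha>)) \<le> T"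
  shows "norm (Q1 \<phi> z) \<le> 3 * \<Psi>\<^sup>2 * (\<Gamma> * P)" "norm (b3 z) \<le> 3 * \<Psi>\<^sup>2 * (\<Gamma> * P)" "norm (Q4 \<phi> z) \<le> 3 * \<Psi>\<^sup>2 * (\<Gamma> * P)"
    and "norm (Qq \<phi> z) \<le> T + 3 * \<Psi>\<^sup>2 * (\<Gamma> * P)"
proof -
  note fb = frame_bounds[OF z]
  define G where "G = \<Gamma> * P"
  have G: "G \<ge> 0" using \<Gamma>_nonneg P_ge by (simp add: G_def)
  have sq: "\<Psi> \<le> \<Psi>\<^sup>2" "1 \<le> \<Psi>\<^sup>2" using \<Psi> by (auto simp: power2_eq_square mult_left_mono[of 1 \<Psi> \<Psi>, simplified] intro: order_trans)
  have sqG: "G \<le> \<Psi>\<^sup>2 * G" "\<Psi> * G \<le> \<Psi>\<^sup>2 * G" using mult_right_mono[OF sq(2) G] mult_right_mono[OF sq(1) G] by simp_all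
  have 1: "norm (b1 z) \<le> G" "norm (b3 z) \<le> G" "norm (b4 z) \<le> G" using fb by (simp_all add: G_def)
  have m: "norm (x * y) \<le> \<Psi> * G" if "norm x \<le> \<Psi>" "norm y \<le> G" for x y :: complex
    unfolding norm_mult by (rule mult_mono) (use that \<Psi> in auto)
  have p3: "norm (\<phi> (z + of_real \<alpha>) * b3 z) \<le> \<Psi> * G" by (rule m[OF \<phi>(2) 1(2)])
  have p4: "norm (\<phi> z * b3 z) \<le> \<Psi> * G" by (rule m[OF \<phi>(1) 1(2)])
  have p5: "norm (\<phi> z * b1 z) \<le> \<Psi> * G" by (rule m[OF \<phi>(1) 1(1)])
  have p6: "norm (\<phi> (z + of_real \<alpha>) * b4 z) \<le> \<Psi> * G" by (rule m[OF \<phi>(2) 1(3)])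
  have p7: "norm (\<phi> (z + of_real \<alpha>) * b3 z * \<phi> z) \<le> \<Psi>\<^sup>2 * G"
    using mult_mono[OF p3 \<phi>(1)] \<Psi> G by (simp add: norm_mult power2_eq_square mult_ac)
  show "norm (Q1 \<phi> z) \<le> 3 * \<Psi>\<^sup>2 * (\<Gamma> * P)"
    using norm_triangle_ineq[of "b1 z" "\<phi> (z + of_real \<alpha>) * b3 z"] 1 p3 sqG G unfolding Q1_def G_def[symmetric] by linarith
  show "norm (b3 z) \<le> 3 * \<Psi>\<^sup>2 * (\<Gamma> * P)" using 1 sqG G unfolding G_def[symmetric] by linarith
  show "norm (Q4 \<phi> z) \<le> 3 * \<Psi>\<^sup>2 * (\<Gamma> * P)"
    using norm_triangle_ineq4[of "b4 z" "\<phi> z * b3 z"] 1 p4 sqG G unfolding Q4_def G_def[symmetric] by (simp add: mult.commute)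
  let ?A = "b z - e * \<phi> z + ei * \<phi> (z + of_real \<alpha>)"
  have "norm (Qq \<phi> z) \<le> norm ?A + norm (\<phi> z * b1 z) + norm (\<phi> (z + of_real \<alpha>) * b4 z) + norm (\<phi> (z + of_real \<alpha>) * b3 z * \<phi> z)"
    using norm_triangle_ineq4[of "?A - b1 z * \<phi> z + \<phi> (z + of_real \<alpha>) * b4 z" "\<phi> (z + of_real \<alpha>) * b3 z * \<phi> z"]
      norm_triangle_ineq[of "?A - b1 z * \<phi> z" "\<phi> (z + of_real \<alpha>) * b4 z"] norm_triangle_ineq4[of ?A "b1 z * \<phi> z"]
    unfolding Qq_def mult.commute[of "\<phi> z" "b1 z"] by linarith
  then show "norm (Qq \<phi> z) \<le> T + 3 * \<Psi>\<^sup>2 * (\<Gamma> * P)"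
    using T p5 p6 p7 sqG unfolding G_def[symmetric] by linarith
qed

text \<open>Once the residue T and the defect are below about 1/K, the system is close to a diagonal
  one with entries of modulus one, and orbits grow by at most exp 1. The rest of the constant is the
  change of coordinates to and fro: (2 P)^2 for the frame and (2 \<Psi>)^2 for the shear.\<close>

lemma modified_frame_growth:
  assumes h: "h \<le> H" and \<phi>: "\<And>z. z \<in> strip h \<Longrightarrow> norm (\<phi> z) \<le> \<Psi>" and \<Psi>: "\<Psi> \<ge> 1"
    and T: "\<And>z. z \<in> strip h \<Longrightarrow> norm (b z - e * \<phi> z + ei * \<phi> (z + of_real \<alpha>)) \<le> T"
    and K: "real K * (2 * (T + 3 * \<Psi>\<^sup>2 * (\<Gamma> * P))) \<le> 1"
  shows "growth E (strip h) K (16 * exp 1 * P\<^sup>2 * \<Psi>\<^sup>2)"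
  unfolding growth_def
proof (intro ballI allI impI)
  fix z k w assume z: "z \<in> strip h" and k: "k \<le> K"
  define zz where "zz i = z + of_real (real i * \<alpha>)" for i
  have zz: "zz i \<in> strip h" for i using z by (simp add: zz_def del: of_real_mult)
  have zzH: "zz i \<in> strip H" for i using zz strip_mono[OF h] by blast
  have zza: "zz i + of_real \<alpha> \<in> strip h" for i using zz by simp
  have zz_Suc: "zz (Suc i) = zz i + of_real \<alpha>" for i by (simp add: zz_def algebra_simps)
  have ps: "pot_seq E z i = pot E (zz i)" for i by (simp add: pot_seq_def zz_def)
  define S where "S i = st \<phi> (zz i) (orb (pot_seq E z) w i)" for i
  define R where "R i = tc (zz i) (orb (pot_seq E z) w i)" for i
  define \<beta> where "\<beta> = T + 3 * \<Psi>\<^sup>2 * (\<Gamma> * P)"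
  have T0: "T \<ge> 0" using order_trans[OF norm_ge_zero T[OF z]] .
  have G0: "3 * \<Psi>\<^sup>2 * (\<Gamma> * P) \<ge> 0" using \<Gamma>_nonneg P_ge by simp
  have bds: "norm (Q1 \<phi> (zz i)) \<le> \<beta>" "norm (b3 (zz i)) \<le> \<beta>" "norm (Q4 \<phi> (zz i)) \<le> \<beta>" "norm (Qq \<phi> (zz i)) \<le> \<beta>" for i
    using modified_frame_bounds[OF zzH \<phi>[OF zz] \<phi>[OF zza] \<Psi> T[OF zz], of i] T0 unfolding \<beta>_def by linarith+
  interpret triangular_orbit e ei "\<lambda>i. Q1 \<phi> (zz i)" "\<lambda>i. Qq \<phi> (zz i)" "\<lambda>i. b3 (zz i)" "\<lambda>i. Q4 \<phi> (zz i)" S R k \<beta>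
  proof
    show "S (Suc i) = (e + Q1 \<phi> (zz i)) * S i + Qq \<phi> (zz i) * R i" for i
      unfolding S_def R_def zz_Suc orb.simps ps by (rule modified_frame_step(1)[OF zzH])
    show "R (Suc i) = (ei + Q4 \<phi> (zz i)) * R i + b3 (zz i) * S i" for i
      unfolding S_def R_def zz_Suc orb.simps ps by (rule modified_frame_step(2)[OF zzH])
  qed (use e_ei bds in auto)
  have "real k * (2 * \<beta>) \<le> real K * (2 * \<beta>)" using k T0 G0 by (intro mult_right_mono) (auto simp: \<beta>_def)
  then have grw: "norm (S k) + norm (R k) \<le> exp 1 * (norm (S 0) + norm (R 0))"
    by (intro near_diagonal_growth) (use bds K T0 G0 in \<open>auto simp: \<beta>_def\<close>)
  have R_sc: "norm (sc (zz i) Z) + norm (tc (zz i) Z) \<le> 2 * \<Psi> * (norm (st \<phi> (zz i) Z) + norm (tc (zz i) Z))"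
    and sc_R: "norm (st \<phi> (zz i) Z) + norm (tc (zz i) Z) \<le> 2 * \<Psi> * (norm (sc (zz i) Z) + norm (tc (zz i) Z))" for i Z
  proof -
    let ?s = "sc (zz i) Z" and ?t = "tc (zz i) Z" and ?S = "st \<phi> (zz i) Z"
    have m: "norm (\<phi> (zz i) * ?t) \<le> \<Psi> * norm ?t" unfolding norm_mult by (rule mult_right_mono[OF \<phi>[OF zz]]) simp
    have "norm ?S \<le> norm ?s + norm (\<phi> (zz i) * ?t)" unfolding st_def by (rule norm_triangle_ineq)
    moreover have "norm ?s \<le> norm ?S + norm (\<phi> (zz i) * ?t)"
      using norm_triangle_ineq4[of ?S "\<phi> (zz i) * ?t"] by (simp add: st_def)
    moreover have "norm x \<le> \<Psi> * norm x" for x :: complex using \<Psi> mult_right_mono[of 1 \<Psi> "norm x"] by simp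
    moreover have "norm x \<ge> 0" for x :: complex by simp
    ultimately show "norm ?s + norm ?t \<le> 2 * \<Psi> * (norm ?S + norm ?t)" "norm ?S + norm ?t \<le> 2 * \<Psi> * (norm ?s + norm ?t)"
      using m unfolding distrib_left mult.assoc by (smt (verit))+
  qed
  have "nm (orb (pot_seq E z) w k) \<le> 2 * P * (2 * \<Psi> * (norm (S k) + norm (R k)))"
    unfolding S_def R_def using P_ge
    by (intro order_trans[OF coord_bounds(2)[OF zzH[of k]]] mult_left_mono R_sc) auto
  also have "\<dots> \<le> 2 * P * (2 * \<Psi> * (exp 1 * (2 * \<Psi> * (2 * P * nm w))))"
  proof (intro mult_left_mono order_trans[OF grw])
    have "norm (S 0) + norm (R 0) \<le> 2 * \<Psi> * (norm (sc (zz 0) w) + norm (tc (zz 0) w))"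
      unfolding S_def R_def using sc_R[of 0 w] by simp
    also have "\<dots> \<le> 2 * \<Psi> * (2 * P * nm w)"
      using \<Psi> by (intro mult_left_mono coord_bounds(1) zzH) auto
    finally show "norm (S 0) + norm (R 0) \<le> 2 * \<Psi> * (2 * P * nm w)" .
  qed (use P_ge \<Psi> in auto)
  also have "\<dots> = 16 * exp 1 * P\<^sup>2 * \<Psi>\<^sup>2 * nm w" by (simp add: power2_eq_square)
  finally show "nm (orb (pot_seq E z) w k) \<le> 16 * exp 1 * P\<^sup>2 * \<Psi>\<^sup>2 * nm w" .
qed

text \<open>The cohomological equation is solved for the modes |l| < N, whose divisors are at least
  \<eta>. The untouched modes are small because b is analytic in a strip of width H, and their size
  T limits the time K.\<close>

lemma fourier_growth:
  fixes N :: real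
  assumes div: "\<And>l::int. \<bar>real_of_int l\<bar> < N \<Longrightarrow> norm (1 - ep (of_real (of_int l * \<alpha> - 2 * \<theta>))) \<ge> \<eta>" and \<eta>: "\<eta> > 0"
    and \<Psi>: "\<Psi> \<ge> 1" "2 * \<Lambda> * P\<^sup>2 / \<eta> * (2 + 4 / (pi * H)) \<le> \<Psi>"
    and T: "2 * \<Lambda> * P\<^sup>2 * exp (- (pi * H / 2) * N) * (2 + 4 / (pi * H / 2)) \<le> T"
    and K: "real K * (2 * (T + 3 * \<Psi>\<^sup>2 * (\<Gamma> * P))) \<le> 1"
  shows "growth E (strip (H / 8)) K (16 * exp 1 * P\<^sup>2 * \<Psi>\<^sup>2)"
proof -
  define B where "B = 2 * \<Lambda> * P\<^sup>2"
  have B: "B \<ge> 0" using \<Lambda> by (simp add: B_def)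
  have b_le: "norm (b z) \<le> B" if "z \<in> strip H" for z using frame_bounds(4)[OF that] by (simp add: B_def)
  have dec: "exp_decay B (pi * H) (strip_coeff b)"
    by (rule norm_strip_coeff_le[OF frame_holomorphic(6) frame_periodic(3) b_le H(1)])
  \<comment> \<open>With \<phi> = ei * \<psi> the equation e \<phi>(z) - ei \<phi>(z + \<alpha>) =
    b(z) becomes \<psi>(z) - ei^2 \<psi>(z + \<alpha>) = b(z), whose l-th coefficient carries the
    factor 1 - ep (l \<alpha> - 2 \<theta>). This is how the resonances of \<theta> enter.\<close>
  define c where "c l = (if \<bar>real_of_int l\<bar> < N then strip_coeff b l / (1 - ep (of_real (of_int l * \<alpha> - 2 * \<theta>))) else 0)" for l
  define tl where "tl l = (if \<bar>real_of_int l\<bar> < N then 0 else strip_coeff b l)" for l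
  have pH: "pi * H > 0" using H by simp
  have c: "exp_decay (B / \<eta>) (pi * H) c"
    unfolding exp_decay_def
  proof
    fix l
    show "norm (c l) \<le> B / \<eta> * exp (- (pi * H) * \<bar>real_of_int l\<bar>)"
    proof (cases "\<bar>real_of_int l\<bar> < N")
      case True
      then have "norm (c l) = norm (strip_coeff b l) / norm (1 - ep (of_real (of_int l * \<alpha> - 2 * \<theta>)))"
        by (simp add: c_def norm_divide)
      also have "\<dots> \<le> (B * exp (- (pi * H) * \<bar>real_of_int l\<bar>)) / \<eta>"
        by (rule frac_le) (use div[OF True] \<eta> B exp_decayD[OF dec] in auto)
      finally show ?thesis by simp
    qed (use B \<eta> in \<open>simp add: c_def\<close>)
  qed
  have tl: "exp_decay (B * exp (- (pi * H / 2) * N)) (pi * H / 2) tl"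
    unfolding exp_decay_def
  proof
    fix l
    show "norm (tl l) \<le> B * exp (- (pi * H / 2) * N) * exp (- (pi * H / 2) * \<bar>real_of_int l\<bar>)"
    proof (cases "\<bar>real_of_int l\<bar> < N")
      case False
      then have "pi * H / 2 * N \<le> pi * H / 2 * \<bar>real_of_int l\<bar>" using pH by (intro mult_left_mono) auto
      then have "- (pi * H) * \<bar>real_of_int l\<bar> \<le> - (pi * H / 2) * N + - (pi * H / 2) * \<bar>real_of_int l\<bar>"
        by (simp add: algebra_simps)
      then have "exp (- (pi * H) * \<bar>real_of_int l\<bar>) \<le> exp (- (pi * H / 2) * N) * exp (- (pi * H / 2) * \<bar>real_of_int l\<bar>)"
        unfolding exp_add[symmetric] by (simp only: exp_le_cancel_iff)
      then have "B * exp (- (pi * H) * \<bar>real_of_int l\<bar>) \<le> B * (exp (- (pi * H / 2) * N) * exp (- (pi * H / 2) * \<bar>real_of_int l\<bar>))"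
        using B by (rule mult_left_mono)
      then show ?thesis using False exp_decayD[OF dec, of l] unfolding tl_def mult.assoc by simp
    qed (use B in \<open>simp add: tl_def\<close>)
  qed
  define \<psi> where "\<psi> = fs c"
  define \<phi> where "\<phi> z = ei * \<psi> z" for z
  \<comment> \<open>The tail has rate pi H/2 only, half of the rate being used for the factor exp (-
    (pi H/2) N); its series converges on the strip of width H/8, which is the loss of width in the
    conclusion.\<close>
  have s8: "strip (H / 8) \<subseteq> strip (pi * H / (4 * pi))" "strip (H / 8) \<subseteq> strip (pi * H / 2 / (4 * pi))"
    "strip (H / 8) \<subseteq> strip (H / 4)"
    by (rule strip_mono, use H in simp)+
  have \<phi>_le: "norm (\<phi> z) \<le> \<Psi>" if z: "z \<in> strip (H / 8)" for z
  proof -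
    have "norm (\<phi> z) = norm (fs c z)" using e_ei by (simp add: \<phi>_def \<psi>_def norm_mult)
    also have "\<dots> \<le> B / \<eta> * (2 + 4 / (pi * H))" by (rule norm_fs_le[OF c pH]) (use z s8 in blast)
    finally show ?thesis using \<Psi>(2) by (simp add: B_def)
  qed
  have T_le: "norm (b z - e * \<phi> z + ei * \<phi> (z + of_real \<alpha>)) \<le> T" if z: "z \<in> strip (H / 8)" for z
  proof -
    have za: "z + of_real \<alpha> \<in> strip (H / 8)" using z by simp
    have bf: "b z = fs (strip_coeff b) z"
      using fs_strip_coeff[OF frame_holomorphic(6) frame_periodic(3) b_le H(1)] z s8 by auto
    have 1: "((\<lambda>l. strip_coeff b l * ep (of_int l * z)) has_sum b z) UNIV"
      unfolding bf by (rule fs_has_sum[OF dec pH]) (use z s8 in blast)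
    have 2: "((\<lambda>l. c l * ep (of_int l * z)) has_sum \<psi> z) UNIV"
      unfolding \<psi>_def by (rule fs_has_sum[OF c pH]) (use z s8 in blast)
    have 3: "((\<lambda>l. c l * ep (of_int l * (z + of_real \<alpha>))) has_sum \<psi> (z + of_real \<alpha>)) UNIV"
      unfolding \<psi>_def by (rule fs_has_sum[OF c pH]) (use za s8 in blast)
    have 4: "((\<lambda>l. tl l * ep (of_int l * z)) has_sum fs tl z) UNIV"
      by (rule fs_has_sum[OF tl]) (use z s8 pH in auto)
    have ee: "ei * ei = ep (- (2 * of_real \<theta>))" by (simp add: ep_add[symmetric])
    have tmeq: "tl l * ep (of_int l * z) = strip_coeff b l * ep (of_int l * z) - c l * ep (of_int l * z)
        + (ei * ei) * (c l * ep (of_int l * (z + of_real \<alpha>)))" for l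
    proof (cases "\<bar>real_of_int l\<bar> < N")
      case True
      let ?d = "ep (of_real (of_int l * \<alpha> - 2 * \<theta>))"
      have ne: "1 - ?d \<noteq> 0" using div[OF True] \<eta> by auto
      have "(ei * ei) * ep (of_int l * (z + of_real \<alpha>)) = ep (of_int l * z) * ?d"
        unfolding ee ep_add[symmetric] by (simp add: algebra_simps)
      then have "(ei * ei) * (c l * ep (of_int l * (z + of_real \<alpha>))) = c l * (ep (of_int l * z) * ?d)"
        by (metis mult.left_commute)
      then have "strip_coeff b l * ep (of_int l * z) - c l * ep (of_int l * z)
        + (ei * ei) * (c l * ep (of_int l * (z + of_real \<alpha>))) = (strip_coeff b l - c l * (1 - ?d)) * ep (of_int l * z)"
        by (simp add: algebra_simps)
      also have "c l * (1 - ?d) = strip_coeff b l" using True ne by (simp add: c_def)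
      finally show ?thesis using True by (simp add: tl_def)
    qed (simp add: tl_def c_def)
    have "((\<lambda>l. tl l * ep (of_int l * z)) has_sum (b z - \<psi> z + (ei * ei) * \<psi> (z + of_real \<alpha>))) UNIV"
      unfolding tmeq by (rule has_sum_add[OF has_sum_diff[OF 1 2] has_sum_cmult_right[OF 3]])
    with 4 have "fs tl z = b z - \<psi> z + (ei * ei) * \<psi> (z + of_real \<alpha>)" by (rule has_sum_unique)
    moreover have "e * \<phi> z = \<psi> z" using e_ei(1) by (simp add: \<phi>_def mult.assoc[symmetric])
    ultimately have "b z - e * \<phi> z + ei * \<phi> (z + of_real \<alpha>) = fs tl z" by (simp add: \<phi>_def)
    also have "norm (fs tl z) \<le> B * exp (- (pi * H / 2) * N) * (2 + 4 / (pi * H / 2))"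
      by (rule norm_fs_le[OF tl]) (use z s8 pH in auto)
    finally show ?thesis using T by (simp add: B_def)
  qed
  show ?thesis
    by (rule modified_frame_growth[OF _ \<phi>_le \<Psi>(1) T_le K]) (use H in auto)
qed

subsection \<open>Removal of the off-diagonal entry by averaging\<close>

text \<open>The weights ei^(2 l) are the quotients of the two diagonal entries 1/e and e along the
  orbit; with them the sums telescope against the operator of the cohomological equation.\<close>

definition "birkhoff k z = (\<Sum>l<k. ei ^ (2 * l) * b (z + of_real (real l * \<alpha>)))"

text \<open>Growth of transfer matrices is independent of the frame, so the bound \<open>Q0\<close>
  may come from a different resonance. Read in the present frame it bounds an orbit in coordinates,
  hence the Birkhoff sums of the present off-diagonal entry.\<close>

lemma birkhoff_le:
  assumes h: "h \<le> H" and gr': "growth E (strip h) K Q0" and Q0: "Q0 \<ge> 0"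
    and sm: "real K * (\<Gamma> * P * (4 * P\<^sup>2 * Q0) * (1 + 2 * \<Lambda> * P\<^sup>2 * real K)) \<le> 1"
    and z: "z \<in> strip h" and k: "k \<le> K"
  shows "norm (birkhoff k z) \<le> 4 * P\<^sup>2 * Q0 + 1"
proof -
  define zz where "zz i = z + of_real (real i * \<alpha>)" for i
  have zz: "zz i \<in> strip H" for i using z strip_mono[OF h] by (auto simp: zz_def simp del: of_real_mult)
  have z0: "z \<in> strip H" using zz[of 0] by (simp add: zz_def)
  \<comment> \<open>The second vector of the frame, with coordinates (0, 1), as
    \<open>birkhoff_sum_le\<close> demands.\<close>
  let ?w = "(V1 z, V2 z)"
  interpret triangular_orbit e ei "\<lambda>i. b1 (zz i)" "\<lambda>i. b (zz i)" "\<lambda>i. b3 (zz i)" "\<lambda>i. b4 (zz i)"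
    "\<lambda>i. sc (zz i) (orb (pot_seq E z) ?w i)" "\<lambda>i. tc (zz i) (orb (pot_seq E z) ?w i)" k "\<Gamma> * P"
    unfolding zz_def by (rule orbit_in_frame[OF z0])
  define Q where "Q = 4 * P\<^sup>2 * Q0"
  have "nm ?w \<le> 2 * P" using frame_bounds(5,6)[OF z0] by (simp add: nm_def)
  have Q: "norm (sc (zz i) (orb (pot_seq E z) ?w i)) + norm (tc (zz i) (orb (pot_seq E z) ?w i)) \<le> Q" if "i \<le> k" for i
  proof -
    have "nm (orb (pot_seq E z) ?w i) \<le> Q0 * nm ?w"
      using gr' z k that unfolding growth_def by (meson order_trans)
    also have "\<dots> \<le> Q0 * (2 * P)" by (rule mult_left_mono[OF \<open>nm ?w \<le> 2 * P\<close> Q0])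
    finally have "2 * P * nm (orb (pot_seq E z) ?w i) \<le> 2 * P * (Q0 * (2 * P))"
      using P_ge by (intro mult_left_mono) auto
    with coord_bounds(1)[OF zz[of i], of "orb (pot_seq E z) ?w i"] show ?thesis
      by (simp add: Q_def power2_eq_square mult_ac)
  qed
  have D0: "D z \<noteq> 0" by (rule D_nonzero[OF z0])
  have s0: "sc (zz 0) (orb (pot_seq E z) ?w 0) = 0"
    by (simp add: zz_def sc_def V1_def V2_def)
  have "tc z ?w = ((e * ei) * (u z * us z) + u (z - of_real \<alpha>) * us (z - of_real \<alpha>)) / D z"
    using D0 by (simp add: tc_def V1_def V2_def field_simps)
  also have "\<dots> = 1" unfolding e_ei(1) using D0 by (simp add: D_def)
  finally have t0: "tc (zz 0) (orb (pot_seq E z) ?w 0) = 1" by (simp add: zz_def)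
  have B: "2 * \<Lambda> * P\<^sup>2 \<ge> 0" using \<Lambda> by simp
  have GP: "\<Gamma> * P \<ge> 0" using \<Gamma>_nonneg P_ge by simp
  have "norm (birkhoff k z) \<le> Q + real k * (\<Gamma> * P * Q * (1 + 2 * \<Lambda> * P\<^sup>2 * real k))"
    using birkhoff_sum_le[OF _ B GP Q s0 t0] frame_bounds(4)[OF zz] by (simp add: birkhoff_def zz_def)
  also have "real k * (\<Gamma> * P * Q * (1 + 2 * \<Lambda> * P\<^sup>2 * real k)) \<le> real K * (\<Gamma> * P * Q * (1 + 2 * \<Lambda> * P\<^sup>2 * real K))"
    using k B GP Q0 by (intro mult_mono add_left_mono mult_left_mono) (auto simp: Q_def)
  also have "\<dots> \<le> 1" using sm by (simp add: Q_def)
  finally show ?thesis by (simp add: Q_def)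
qed

lemma birkhoff_telescope:
  "birkhoff k z - ei ^ 2 * birkhoff k (z + of_real \<alpha>) = b z - ei ^ (2 * k) * b (z + of_real (real k * \<alpha>))"
proof (induction k)
  case (Suc k)
  have 1: "z + of_real \<alpha> + of_real (real k * \<alpha>) = z + of_real (real (Suc k) * \<alpha>)" by (simp add: algebra_simps)
  have 2: "ei ^ 2 * (ei ^ (2 * k) * x) = ei ^ (2 * Suc k) * x" for x by (simp add: power_add[symmetric] power2_eq_square)
  have "birkhoff (Suc k) z - ei ^ 2 * birkhoff (Suc k) (z + of_real \<alpha>)
      = (birkhoff k z - ei ^ 2 * birkhoff k (z + of_real \<alpha>)) + ei ^ (2 * k) * b (z + of_real (real k * \<alpha>))
        - ei ^ 2 * (ei ^ (2 * k) * b (z + of_real \<alpha> + of_real (real k * \<alpha>)))"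
    by (simp add: birkhoff_def algebra_simps del: of_real_mult)
  also have "\<dots> = b z - ei ^ (2 * Suc k) * b (z + of_real (real (Suc k) * \<alpha>))"
    unfolding Suc.IH 1 2 by simp
  finally show ?case .
qed (simp add: birkhoff_def)

lemma birkhoff_holomorphic: "birkhoff k holomorphic_on strip H"
  unfolding birkhoff_def by (intro holomorphic_intros holomorphic_on_strip_shift frame_holomorphic)

lemma birkhoff_periodic: "birkhoff k (z + 1) = birkhoff k z"
proof -
  have "z + 1 + c = (z + c) + 1" for c :: complex by simp
  then show ?thesis unfolding birkhoff_def by (simp only: frame_periodic)
qed

text \<open>The mean of the Birkhoff sums solves the cohomological equation for b up to an error 1 / K
  times a Birkhoff sum, without any loss of analyticity.\<close>

lemma averaged_conjugation:
  assumes h: "0 < h" "h \<le> H" and gr': "growth E (strip h) K Q0" and Q0: "Q0 \<ge> 0" and K: "K \<ge> 1"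
    and sm: "real K * (\<Gamma> * P * (4 * P\<^sup>2 * Q0) * (1 + 2 * \<Lambda> * P\<^sup>2 * real K)) \<le> 1"
    and v: "\<And>x. fs vc (of_real x) = of_real (v x)"
    and R: "R = 4 * P\<^sup>2 * Q0 + 1"
    and B': "4 * ((R + 1) * P) \<le> B'" and \<beta>: "3 * R\<^sup>2 * (\<Gamma> * P) \<le> \<beta>"
    and bb: "R / real K + 3 * R\<^sup>2 * (\<Gamma> * P) \<le> bb"
  shows "conjugable v lam \<alpha> E \<theta> h B' \<beta> bb"
proof -
  \<comment> \<open>The mean runs over the lengths 1, ..., K. With this choice the end terms of the
    telescoping sums again form a Birkhoff sum, of length K and started at z + \<alpha>; the residue
    is this sum divided by K.\<close>
  define \<phi> where "\<phi> z = ei * ((\<Sum>k<K. birkhoff (Suc k) z) / of_nat K)" for z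
  have Kpos: "real K > 0" "(of_nat K :: complex) \<noteq> 0" using K by auto
  have R1: "R \<ge> 1" using Q0 R by simp
  have bk: "norm (birkhoff k z) \<le> R" if "z \<in> strip h" "k \<le> K" for k z
    using birkhoff_le[OF h(2) gr' Q0 sm that] R by simp
  have \<phi>_le: "norm (\<phi> z) \<le> R" if z: "z \<in> strip h" for z
  proof -
    have "norm (\<Sum>k<K. birkhoff (Suc k) z) \<le> (\<Sum>k<K. R)"
      by (rule order_trans[OF norm_sum sum_mono]) (use bk[OF z] in auto)
    then show ?thesis using Kpos e_ei by (simp add: \<phi>_def norm_mult norm_divide pos_divide_le_eq mult.commute)
  qed
  have T_le: "norm (b z - e * \<phi> z + ei * \<phi> (z + of_real \<alpha>)) \<le> R / real K" if z: "z \<in> strip h" for z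
  proof -
    have za: "z + of_real \<alpha> \<in> strip h" using z by simp
    have last: "(\<Sum>k<K. ei ^ (2 * Suc k) * b (z + of_real (real (Suc k) * \<alpha>))) = ei ^ 2 * birkhoff K (z + of_real \<alpha>)"
      unfolding birkhoff_def sum_distrib_left
      by (rule sum.cong) (simp_all add: algebra_simps power_add[symmetric] power2_eq_square)
    have "(\<Sum>k<K. birkhoff (Suc k) z) - ei ^ 2 * (\<Sum>k<K. birkhoff (Suc k) (z + of_real \<alpha>))
        = (\<Sum>k<K. b z - ei ^ (2 * Suc k) * b (z + of_real (real (Suc k) * \<alpha>)))"
      unfolding sum_distrib_left sum_subtractf[symmetric] birkhoff_telescope ..
    also have "\<dots> = of_nat K * b z - ei ^ 2 * birkhoff K (z + of_real \<alpha>)"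
      unfolding sum_subtractf last by simp
    finally have S: "(\<Sum>k<K. birkhoff (Suc k) z) - ei ^ 2 * (\<Sum>k<K. birkhoff (Suc k) (z + of_real \<alpha>))
        = of_nat K * b z - ei ^ 2 * birkhoff K (z + of_real \<alpha>)" .
    have "e * \<phi> z - ei * \<phi> (z + of_real \<alpha>)
        = ((e * ei) * (\<Sum>k<K. birkhoff (Suc k) z) - ei ^ 2 * (\<Sum>k<K. birkhoff (Suc k) (z + of_real \<alpha>))) / of_nat K"
      by (simp add: \<phi>_def power2_eq_square diff_divide_distrib mult.assoc)
    also have "\<dots> = b z - ei ^ 2 * birkhoff K (z + of_real \<alpha>) / of_nat K"
      unfolding e_ei(1) using S Kpos by (simp add: diff_divide_distrib)
    finally have "b z - e * \<phi> z + ei * \<phi> (z + of_real \<alpha>) = ei ^ 2 * birkhoff K (z + of_real \<alpha>) / of_nat K"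
      by (simp add: algebra_simps)
    also have "norm \<dots> \<le> R / real K"
      using bk[OF za, of K] Kpos e_ei by (auto simp: norm_mult norm_divide norm_power intro: divide_right_mono)
    finally show ?thesis .
  qed
  have sub: "strip h \<subseteq> strip H" by (rule strip_mono[OF h(2)])
  have \<phi>_hol: "\<phi> holomorphic_on strip h"
    unfolding \<phi>_def by (intro holomorphic_intros holomorphic_on_subset[OF birkhoff_holomorphic sub]) (use Kpos in auto)
  have \<phi>_per: "\<phi> (z + 1) = \<phi> z" for z unfolding \<phi>_def birkhoff_periodic ..
  note hol = frame_holomorphic[THEN holomorphic_on_subset, OF sub] u_hol[THEN holomorphic_on_subset, OF sub]
  \<comment> \<open>The first row of \<Phi>, which expresses the sheared coordinate in terms of Z;
    the second row is that of \<open>tc\<close>. Thus \<Phi> is the inverse of the sheared frame,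
    obtained without inverting a matrix.\<close>
  define P11 where "P11 z = V2 z - \<phi> z * u (z - of_real \<alpha>)" for z
  define P12 where "P12 z = - V1 z + \<phi> z * (e * u z)" for z
  have st_eq: "st \<phi> z Z = P11 z * fst Z + P12 z * snd Z" for z Z
    by (simp add: st_def sc_def tc_def P11_def P12_def V1_def V2_def add_divide_distrib algebra_simps)
  have bnd: "norm (Q1 \<phi> z) \<le> \<beta>" "norm (b3 z) \<le> \<beta>" "norm (Q4 \<phi> z) \<le> \<beta>" "norm (Qq \<phi> z) \<le> bb" if z: "z \<in> strip h" for z
  proof -
    have za: "z + of_real \<alpha> \<in> strip h" using z by simp
    note modified_frame_bounds[OF subsetD[OF sub z] \<phi>_le[OF z] \<phi>_le[OF za] R1 T_le[OF z]]
    then show "norm (Q1 \<phi> z) \<le> \<beta>" "norm (b3 z) \<le> \<beta>" "norm (Q4 \<phi> z) \<le> \<beta>" "norm (Qq \<phi> z) \<le> bb"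
      using \<beta> bb by linarith+
  qed
  have prod_le: "norm (\<phi> z * w) \<le> R * P" if "z \<in> strip h" "norm w \<le> P" for z w
    unfolding norm_mult by (rule mult_mono) (use \<phi>_le that R1 in auto)
  have PP: "norm (P11 z) \<le> (R + 1) * P" "norm (P12 z) \<le> (R + 1) * P"
      "norm (- u (z - of_real \<alpha>)) \<le> (R + 1) * P" "norm (e * u z) \<le> (R + 1) * P" if z: "z \<in> strip h" for z
  proof -
    note fb = frame_bounds[OF subsetD[OF sub z]]
    have RP: "R * P \<ge> 0" using R1 P_ge by simp
    have eu: "norm (e * u z) = norm (u z)" using e_ei by (simp add: norm_mult)
    show "norm (P11 z) \<le> (R + 1) * P" unfolding P11_def
      using norm_triangle_ineq4[of "V2 z" "\<phi> z * u (z - of_real \<alpha>)"] fb(6) prod_le[OF z fb(8)] by (simp add: algebra_simps)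
    show "norm (P12 z) \<le> (R + 1) * P" unfolding P12_def
      using norm_triangle_ineq[of "- V1 z" "\<phi> z * (e * u z)"] fb(5) prod_le[OF z, of "e * u z"] fb(7) eu by (simp add: algebra_simps)
    show "norm (- u (z - of_real \<alpha>)) \<le> (R + 1) * P" "norm (e * u z) \<le> (R + 1) * P"
      using fb(7,8) eu RP by (simp_all add: algebra_simps)
  qed
  have per: "z + 1 - of_real \<alpha> = (z - of_real \<alpha>) + 1" for z by simp
  have fsper: "V1 (z + 1) = V1 z" "V2 (z + 1) = V2 z" "u (z + 1) = u z" "u (z + 1 - of_real \<alpha>) = u (z - of_real \<alpha>)" for z
    unfolding per by (rule frame_periodic fs_periodic)+
  have xH: "(of_real x :: complex) \<in> strip H" for x using H by simp
  have s1: "schr_step c (1, 0) = (c, 1)" "schr_step c (0, 1) = (-1, 0)" for c by (simp_all add: schr_step_def)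
  have pv: "pot E (of_real x) = of_real (E - lam * v x)" for x by (simp add: pot_def v)
  \<comment> \<open>The columns of the conjugacy equation are the step identities for the two unit
    vectors Z.\<close>
  have id11: "P11 (of_real x + of_real \<alpha>) * of_real (E - lam * v x) + P12 (of_real x + of_real \<alpha>)
      = (e + Q1 \<phi> (of_real x)) * P11 (of_real x) + Qq \<phi> (of_real x) * - u (of_real x - of_real \<alpha>)"
    and id21: "- u (of_real x) * of_real (E - lam * v x) + e * u (of_real x + of_real \<alpha>)
      = b3 (of_real x) * P11 (of_real x) + (ei + Q4 \<phi> (of_real x)) * - u (of_real x - of_real \<alpha>)" for x
    using modified_frame_step[OF xH[of x], where \<phi> = \<phi> and Z = "(1, 0)"] unfolding s1 st_eq pv by (simp_all add: tc_def algebra_simps)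
  have id12: "- P11 (of_real x + of_real \<alpha>) = (e + Q1 \<phi> (of_real x)) * P12 (of_real x) + Qq \<phi> (of_real x) * (e * u (of_real x))"
    and id22: "u (of_real x) = b3 (of_real x) * P12 (of_real x) + (ei + Q4 \<phi> (of_real x)) * (e * u (of_real x))" for x
    using modified_frame_step[OF xH[of x], where \<phi> = \<phi> and Z = "(0, 1)"] unfolding s1 st_eq by (simp_all add: tc_def algebra_simps)
  have det: "P11 z * (e * u z) - P12 z * - u (z - of_real \<alpha>) = 1" if "z \<in> strip H" for z
  proof -
    have D0: "D z \<noteq> 0" by (rule D_nonzero[OF that])
    have "P11 z * (e * u z) - P12 z * - u (z - of_real \<alpha>)
        = ((e * ei) * (u z * us z) + u (z - of_real \<alpha>) * us (z - of_real \<alpha>)) / D z"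
      by (simp add: P11_def P12_def V1_def V2_def add_divide_distrib algebra_simps)
    also have "\<dots> = 1" unfolding e_ei(1) using D0 by (simp add: D_def)
    finally show ?thesis .
  qed
  show ?thesis
  proof (rule conjugation_from_strip_functions[where ?P11.0 = P11 and ?P12.0 = P12 and ?P21.0 = "\<lambda>z. - u (z - of_real \<alpha>)"
        and ?P22.0 = "\<lambda>z. e * u z" and ?Q1.0 = "Q1 \<phi>" and Q = "Qq \<phi>" and ?Q3.0 = b3 and ?Q4.0 = "Q4 \<phi>" and B = "(R + 1) * P"])
    show "P11 holomorphic_on strip h" "P12 holomorphic_on strip h" "(\<lambda>z. - u (z - of_real \<alpha>)) holomorphic_on strip h"
      "(\<lambda>z. e * u z) holomorphic_on strip h" "Q1 \<phi> holomorphic_on strip h" "Qq \<phi> holomorphic_on strip h"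
      "b3 holomorphic_on strip h" "Q4 \<phi> holomorphic_on strip h"
      unfolding P11_def P12_def Q1_def Qq_def Q4_def
      by (intro holomorphic_intros holomorphic_on_strip_shift hol \<phi>_hol)+
  qed (use h B' bnd PP fsper \<phi>_per det[OF xH] id11 id12 id21 id22 in \<open>auto simp: P11_def P12_def\<close>)
qed

end

lemma circle_norm_minus: "circle_norm (- x) = circle_norm x"
proof -
  have z: "circle_norm 0 = 0" by (simp add: circle_norm_eq)
  have "circle_norm (- y) \<le> circle_norm y" for y using circle_norm_diff_le[of 0 y] z by simp
  from this[of x] this[of "- x"] show ?thesis by simp
qed

subsection \<open>Resonances\<close>

lemma resonance_minimal:
  assumes "k \<in> resonances \<alpha> \<epsilon>0 \<theta>" "\<bar>l\<bar> \<le> \<bar>k\<bar>"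
  shows "circle_norm (2 * \<theta> - of_int k * \<alpha>) \<le> circle_norm (2 * \<theta> - of_int l * \<alpha>)"
proof -
  have "circle_norm (2 * \<theta> - of_int k * \<alpha>) = Min ((\<lambda>j. circle_norm (2 * \<theta> - of_int j * \<alpha>)) ` {- \<bar>k\<bar>..\<bar>k\<bar>})"
    using assms(1) by (simp add: resonances_def)
  also have "\<dots> \<le> circle_norm (2 * \<theta> - of_int l * \<alpha>)"
  proof (intro Min_le imageI)
    show "l \<in> {- \<bar>k\<bar>..\<bar>k\<bar>}" using assms(2) unfolding atLeastAtMost_iff by linarith
  qed simp
  finally show ?thesis .
qed

text \<open>The minimality of a resonance alone makes all smaller frequencies Diophantine relative to the phase.\<close>

lemma small_divisor_bound:
  assumes dio: "\<And>m::int. m \<noteq> 0 \<Longrightarrow> \<kappa> / \<bar>real_of_int m\<bar> ^ \<tau> \<le> circle_norm (of_int m * \<alpha>)" and \<kappa>: "\<kappa> > 0"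
    and k: "k \<in> resonances \<alpha> \<epsilon>0 \<theta>" and l: "\<bar>l\<bar> \<le> \<bar>k\<bar>" "l \<noteq> k"
  shows "\<kappa> / (2 * \<bar>real_of_int k\<bar>) ^ \<tau> \<le> 2 * circle_norm (2 * \<theta> - of_int l * \<alpha>)"
proof -
  have m: "l - k \<noteq> 0" using l by simp
  have "\<bar>real_of_int (l - k)\<bar> \<le> 2 * \<bar>real_of_int k\<bar>" using l by linarith
  moreover have "\<bar>real_of_int (l - k)\<bar> > 0" using m by linarith
  ultimately have "\<kappa> / (2 * \<bar>real_of_int k\<bar>) ^ \<tau> \<le> \<kappa> / \<bar>real_of_int (l - k)\<bar> ^ \<tau>"
    using \<kappa> by (intro divide_left_mono power_mono mult_pos_pos zero_less_power) auto
  also have "\<dots> \<le> circle_norm (of_int (l - k) * \<alpha>)" by (rule dio[OF m])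
  also have "of_int (l - k) * \<alpha> = (2 * \<theta> - of_int k * \<alpha>) - (2 * \<theta> - of_int l * \<alpha>)" by (simp add: algebra_simps)
  also have "circle_norm \<dots> \<le> circle_norm (2 * \<theta> - of_int k * \<alpha>) + circle_norm (2 * \<theta> - of_int l * \<alpha>)"
    by (rule circle_norm_diff_le)
  finally show ?thesis using resonance_minimal[OF k l(1)] by linarith
qed

lemma resonance_enum_Suc:
  assumes r: "resonance_enum \<alpha> \<epsilon>0 \<theta> r" and j: "Suc j \<in> res_index \<alpha> \<epsilon>0 \<theta>"
  shows "j \<in> res_index \<alpha> \<epsilon>0 \<theta>" "r j \<in> resonances \<alpha> \<epsilon>0 \<theta>" "r (Suc j) \<in> resonances \<alpha> \<epsilon>0 \<theta>"
    "\<bar>r j\<bar> \<le> \<bar>r (Suc j)\<bar>" "r j \<noteq> r (Suc j)" "\<bar>r (Suc j)\<bar> \<ge> 1"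
proof -
  show jj: "j \<in> res_index \<alpha> \<epsilon>0 \<theta>" using j by (auto simp: res_index_def)
  have bij: "bij_betw r (res_index \<alpha> \<epsilon>0 \<theta>) (resonances \<alpha> \<epsilon>0 \<theta>)" using r by (simp add: resonance_enum_def)
  then show "r j \<in> resonances \<alpha> \<epsilon>0 \<theta>" "r (Suc j) \<in> resonances \<alpha> \<epsilon>0 \<theta>" using j jj by (auto simp: bij_betw_def)
  show le: "\<bar>r j\<bar> \<le> \<bar>r (Suc j)\<bar>" using r j jj by (simp add: resonance_enum_def)
  show ne: "r j \<noteq> r (Suc j)" using bij j jj by (auto simp: bij_betw_def dest: inj_onD)
  show "\<bar>r (Suc j)\<bar> \<ge> 1" using le ne by auto
qed

text \<open>A resonance n_j has 2 \<theta> - n_j \<alpha> exponentially close to an integer, while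
  the minimality at the next resonance bounds the same distance below by a power of 1/|n_(j+1)|.
  Comparison gives |n_j| = O(ln |n_(j+1)|).\<close>

lemma resonance_separation:
  assumes dio: "\<And>m::int. m \<noteq> 0 \<Longrightarrow> \<kappa> / \<bar>real_of_int m\<bar> ^ \<tau> \<le> circle_norm (of_int m * \<alpha>)" and \<kappa>: "\<kappa> > 0"
    and r: "resonance_enum \<alpha> \<epsilon>0 \<theta> r" and j: "Suc j \<in> res_index \<alpha> \<epsilon>0 \<theta>"
  shows "\<epsilon>0 * \<bar>real_of_int (r j)\<bar> \<le> ln (2 / \<kappa>) + real \<tau> * ln (2 * \<bar>real_of_int (r (Suc j))\<bar>)"
proof -
  note R = resonance_enum_Suc[OF r j]
  define N where "N = \<bar>real_of_int (r (Suc j))\<bar>"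
  have N: "N \<ge> 1" using R(6) by (simp add: N_def)
  have "\<kappa> / (2 * N) ^ \<tau> \<le> 2 * circle_norm (2 * \<theta> - of_int (r j) * \<alpha>)"
    unfolding N_def by (rule small_divisor_bound[OF dio \<kappa> R(3) R(4,5)])
  also have "\<dots> \<le> 2 * exp (- (\<bar>real_of_int (r j)\<bar> * \<epsilon>0))" using R(2) by (simp add: resonances_def)
  finally have "\<kappa> / (2 * N) ^ \<tau> \<le> 2 * exp (- (\<bar>real_of_int (r j)\<bar> * \<epsilon>0))" .
  then have "exp (\<bar>real_of_int (r j)\<bar> * \<epsilon>0) \<le> (2 / \<kappa>) * (2 * N) ^ \<tau>"
    using \<kappa> N by (simp add: exp_minus field_simps)
  then have "\<bar>real_of_int (r j)\<bar> * \<epsilon>0 \<le> ln ((2 / \<kappa>) * (2 * N) ^ \<tau>)"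
    using \<kappa> N by (subst ln_ge_iff) auto
  also have "\<dots> = ln (2 / \<kappa>) + ln ((2 * N) ^ \<tau>)" by (rule ln_mult_pos) (use \<kappa> N in auto)
  also have "ln ((2 * N) ^ \<tau>) = real \<tau> * ln (2 * N)" by (rule ln_realpow)
  finally show ?thesis by (simp add: N_def mult.commute)
qed

lemma exp_neg_enat [simp]: "exp_neg c (enat m) = exp (- c * real m)"
  by (simp add: exp_neg_def)

lemma exp_neg_infinity [simp]: "exp_neg c \<infinity> = 0"
  by (simp add: exp_neg_def)

text \<open>The dual solution is truncated at a fixed fraction of the next resonance.\<close>

lemma approximate_dual_solution:
  fixes v :: "real \<Rightarrow> real" and \<sigma> C0 C1 \<epsilon>1 :: real
  assumes vc: "exp_decay Cv \<sigma> (fourier_coeff v)" and \<sigma>: "\<sigma> > 0"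
    and al: "almost_localized v lam \<alpha> C0 C1 \<epsilon>0 \<epsilon>1"
    and s: "s = min \<sigma> \<epsilon>1 / 2" and C: "C = max C0 1" and D1: "D1 = max C1 (exp (\<epsilon>1 * C))"
    and dp: "dual_phase v lam \<alpha> E \<theta>" and r: "resonance_enum \<alpha> \<epsilon>0 \<theta> r" and j: "j \<in> res_index \<alpha> \<epsilon>0 \<theta>"
    and n: "n = \<bar>real_of_int (r j)\<bar> + 1" and N: "N = res_abs \<alpha> \<epsilon>0 \<theta> r (Suc j)"
  shows "\<exists>a g. a 0 = 1 \<and> exp_decay D1 (\<epsilon>1 / n) a \<and>
    exp_decay (\<bar>lam\<bar> * (Cv * D1 * (2 + 2 / s)) * exp (\<epsilon>1 * C * n) * exp_neg (s / (4 * C)) N) (s / 2) g \<and>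
    (\<forall>k. ((\<lambda>l. of_real lam * fourier_coeff v l * a (k - l)) has_sum
        (of_real E * a k - of_real (2 * cos (2 * pi * (\<theta> + of_int k * \<alpha>))) * a k - g k)) UNIV)"
proof -
  define fv where "fv = fourier_coeff v"
  have pos: "C0 > 0" "C1 > 0" "\<epsilon>1 > 0" using al by (auto simp: almost_localized_def)
  have s0: "s > 0" "2 * s \<le> \<sigma>" "2 * s \<le> \<epsilon>1" using \<sigma> pos by (auto simp: s)
  have C1': "C \<ge> 1" "C \<ge> C0" "C > 0" by (auto simp: C)
  have n1: "n \<ge> 1" by (simp add: n)
  have D1': "D1 \<ge> 1" "D1 \<ge> C1" "D1 \<ge> exp (\<epsilon>1 * C)" "D1 > 0"
  proof -
    have "exp (\<epsilon>1 * C) \<ge> 1" using pos C1' by simp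
    then show "D1 \<ge> 1" "D1 > 0" unfolding D1 by linarith+
  qed (auto simp: D1)
  have Cv: "Cv \<ge> 0" by (rule exp_decay_nonneg[OF vc])
  from dp obtain uh where uh: "dual_solution v lam \<alpha> \<theta> E uh" "uh 0 = 1" "\<And>k. norm (uh k) \<le> 1"
    by (auto simp: dual_phase_def)
  have eq: "((\<lambda>l. of_real lam * fv l * uh (k - l)) has_sum
      (of_real E * uh k - of_real (2 * cos (2 * pi * (\<theta> + of_int k * \<alpha>))) * uh k)) UNIV" for k
    using uh(1) by (simp add: dual_solution_def fv_def)
  have "\<forall>k. norm (uh k) \<le> 1 + \<bar>real_of_int k\<bar>"
  proof
    show "norm (uh k) \<le> 1 + \<bar>real_of_int k\<bar>" for k using uh(3)[of k] by simp
  qed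
  with uh(1,2) r have "dual_solution v lam \<alpha> \<theta> E uh \<and> uh 0 = 1 \<and>
      (\<forall>k. norm (uh k) \<le> 1 + \<bar>real_of_int k\<bar>) \<and> resonance_enum \<alpha> \<epsilon>0 \<theta> r" by blast
  with al have "\<forall>k. \<forall>j\<in>res_index \<alpha> \<epsilon>0 \<theta>.
           C0 * (1 + \<bar>real_of_int (r j)\<bar>) < \<bar>real_of_int k\<bar> \<and>
           (case res_abs \<alpha> \<epsilon>0 \<theta> r (Suc j) of
              enat m \<Rightarrow> \<bar>real_of_int k\<bar> < inverse C0 * real m
            | \<infinity> \<Rightarrow> True) \<longrightarrow>
           norm (uh k) \<le> C1 * exp (- \<epsilon>1 * \<bar>real_of_int k\<bar>)"
    unfolding almost_localized_def by blast
  then have loc: "norm (uh k) \<le> C1 * exp (- \<epsilon>1 * \<bar>real_of_int k\<bar>)"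
    if "C0 * n < \<bar>real_of_int k\<bar>" "case N of enat m \<Rightarrow> \<bar>real_of_int k\<bar> < inverse C0 * real m | \<infinity> \<Rightarrow> True" for k
    using that j unfolding n N add.commute[of _ "1::real"] by blast
  \<comment> \<open>Near the origin, for |k| <= C n, only |u_k| <= 1 is known. This is turned into
    decay in two ways: at the slow rate \<epsilon>1/n with a constant independent of n, for the
    frame, and at the full rate \<epsilon>1 with the constant \<open>X\<close>, for the
    defect.\<close>
  define X where "X = exp (\<epsilon>1 * C * n)"
  have X1: "X \<ge> 1" using pos C1' n1 by (simp add: X_def)
  have decay: "norm (uh k) \<le> D1 * exp (- (\<epsilon>1 / n) * \<bar>real_of_int k\<bar>)" "norm (uh k) \<le> D1 * X * exp (- \<epsilon>1 * \<bar>real_of_int k\<bar>)"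
    if lim: "case N of enat m \<Rightarrow> \<bar>real_of_int k\<bar> < real m / C | \<infinity> \<Rightarrow> True" for k
  proof -
    define y where "y = \<bar>real_of_int k\<bar>"
    have y: "y \<ge> 0" by (simp add: y_def)
    have both: "norm (uh k) \<le> D1 * exp (- (\<epsilon>1 / n) * y) \<and> norm (uh k) \<le> D1 * X * exp (- \<epsilon>1 * y)"
    proof (cases "C * n < y")
      case True
      have "C0 * n \<le> C * n" using C1' n1 by (intro mult_right_mono) auto
      with True have 1: "C0 * n < y" by linarith
      have 2: "case N of enat m \<Rightarrow> \<bar>real_of_int k\<bar> < inverse C0 * real m | \<infinity> \<Rightarrow> True"
      proof (cases N)
        case (enat m)
        have "real m / C \<le> real m / C0" using C1' pos by (intro divide_left_mono) auto
        with lim enat show ?thesis by (simp add: divide_inverse mult.commute)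
      qed simp
      have "norm (uh k) \<le> C1 * exp (- \<epsilon>1 * y)" using loc[OF _ 2] 1 by (simp add: y_def)
      also have "\<dots> \<le> D1 * exp (- \<epsilon>1 * y)" using D1' by (intro mult_right_mono) auto
      finally have b: "norm (uh k) \<le> D1 * exp (- \<epsilon>1 * y)" .
      have "\<epsilon>1 / n * y \<le> \<epsilon>1 * y" using n1 pos y by (intro mult_right_mono) (auto simp: field_simps)
      then have "D1 * exp (- \<epsilon>1 * y) \<le> D1 * exp (- (\<epsilon>1 / n) * y)" using D1' by simp
      moreover have "D1 * exp (- \<epsilon>1 * y) \<le> D1 * X * exp (- \<epsilon>1 * y)" using D1' X1 by simp
      ultimately show ?thesis using b by linarith
    next
      case False
      have "\<epsilon>1 / n * y \<le> \<epsilon>1 / n * (C * n)" using False pos n1 by (intro mult_left_mono) auto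
      also have "\<dots> = \<epsilon>1 * C" using n1 by simp
      finally have "1 \<le> exp (\<epsilon>1 * C) * exp (- (\<epsilon>1 / n) * y)" by (simp add: exp_add[symmetric])
      also have "\<dots> \<le> D1 * exp (- (\<epsilon>1 / n) * y)" using D1' by (intro mult_right_mono) auto
      finally have 1: "1 \<le> D1 * exp (- (\<epsilon>1 / n) * y)" .
      have "\<epsilon>1 * y \<le> \<epsilon>1 * (C * n)" using False pos by (intro mult_left_mono) auto
      then have "1 \<le> X * exp (- \<epsilon>1 * y)" by (simp add: X_def exp_add[symmetric] mult.assoc)
      also have "\<dots> \<le> D1 * (X * exp (- \<epsilon>1 * y))" using D1' X1 by simp
      finally show ?thesis using 1 uh(3)[of k] by (simp add: mult.assoc)
    qed
    then show "norm (uh k) \<le> D1 * exp (- (\<epsilon>1 / n) * \<bar>real_of_int k\<bar>)" "norm (uh k) \<le> D1 * X * exp (- \<epsilon>1 * \<bar>real_of_int k\<bar>)"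
      by (simp_all add: y_def)
  qed
  show ?thesis
  proof (cases N)
    case infinity
    show ?thesis
    proof (rule exI[of _ uh], rule exI[of _ "\<lambda>_. 0"], intro conjI allI)
      show "exp_decay D1 (\<epsilon>1 / n) uh" unfolding exp_decay_def using decay(1) infinity by simp
    qed (use uh eq infinity in \<open>auto simp: exp_decay_def fv_def\<close>)
  next
    case (enat m)
    have "Suc j \<in> res_index \<alpha> \<epsilon>0 \<theta>" using enat N by (auto simp: res_abs_def split: if_splits)
    from resonance_enum_Suc(6)[OF r this] have m1: "m \<ge> 1" using enat N \<open>Suc j \<in> _\<close> by (auto simp: res_abs_def)
    \<comment> \<open>Half of the range m/C in which localization is known. The solution is
      therefore still known to decay between L and 2 L, the first part that the truncation
      removes.\<close>
    define L where "L = real m / (2 * C)"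
    have L: "L > 0" "2 * L = real m / C" using m1 C1' by (auto simp: L_def)
    define a where "a k = (if \<bar>real_of_int k\<bar> \<le> L then uh k else 0)" for k
    define w where "w k = uh k - a k" for k
    have a_dec: "exp_decay D1 (\<epsilon>1 / n) a"
      unfolding exp_decay_def a_def using decay(1) L D1' enat by auto
    have a_dec2: "exp_decay (D1 * X) \<epsilon>1 a"
      unfolding exp_decay_def a_def using decay(2) L D1' X1 enat by auto
    define B where "B = Cv * (D1 * X)"
    have B0: "B \<ge> 0" using Cv D1' X1 by (simp add: B_def)
    have fv_le: "norm (fv l) \<le> Cv * exp (- \<sigma> * \<bar>real_of_int l\<bar>)" for l unfolding fv_def by (rule exp_decayD[OF vc])
    have conv_a: "exp_decay (B * exp (- s * \<bar>real_of_int k\<bar>)) s (\<lambda>l. fv l * a (k - l))" for k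
      unfolding exp_decay_def
    proof
      fix l
      have "norm (fv l * a (k - l)) \<le> (Cv * exp (- \<sigma> * \<bar>real_of_int l\<bar>)) * (D1 * X * exp (- \<epsilon>1 * \<bar>real_of_int (k - l)\<bar>))"
        unfolding norm_mult by (intro mult_mono fv_le exp_decayD[OF a_dec2]) (use Cv in auto)
      also have "\<dots> = B * exp (- \<sigma> * \<bar>real_of_int l\<bar> + - \<epsilon>1 * \<bar>real_of_int (k - l)\<bar>)" unfolding B_def exp_add by (simp only: mult_ac)
      also have "\<dots> \<le> B * exp (- s * \<bar>real_of_int k\<bar> + - s * \<bar>real_of_int l\<bar>)"
      proof (rule mult_left_mono[OF _ B0])
        have "2 * s * \<bar>real_of_int l\<bar> \<le> \<sigma> * \<bar>real_of_int l\<bar>" "2 * s * \<bar>real_of_int (k - l)\<bar> \<le> \<epsilon>1 * \<bar>real_of_int (k - l)\<bar>"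
          by (intro mult_right_mono s0; simp)+
        moreover have "s * \<bar>real_of_int k\<bar> \<le> s * (\<bar>real_of_int l\<bar> + \<bar>real_of_int (k - l)\<bar>)" using s0 by (intro mult_left_mono) linarith+
        moreover have "s * \<bar>real_of_int (k - l)\<bar> \<ge> 0" using s0 by simp
        ultimately have "- \<sigma> * \<bar>real_of_int l\<bar> + - \<epsilon>1 * \<bar>real_of_int (k - l)\<bar> \<le> - s * \<bar>real_of_int k\<bar> + - s * \<bar>real_of_int l\<bar>"
          unfolding distrib_left by linarith
        then show "exp (- \<sigma> * \<bar>real_of_int l\<bar> + - \<epsilon>1 * \<bar>real_of_int (k - l)\<bar>) \<le> exp (- s * \<bar>real_of_int k\<bar> + - s * \<bar>real_of_int l\<bar>)" by simp
      qed
      also have "\<dots> = B * exp (- s * \<bar>real_of_int k\<bar>) * exp (- s * \<bar>real_of_int l\<bar>)" unfolding exp_add by (simp only: mult_ac)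
      finally show "norm (fv l * a (k - l)) \<le> B * exp (- s * \<bar>real_of_int k\<bar>) * exp (- s * \<bar>real_of_int l\<bar>)" .
    qed
    \<comment> \<open>For |k| <= L the removed part w enters only with |k - l| > L. Up to 2 L it
      decays by localization; beyond 2 L it is merely bounded by 1, but then |l| >= L and the
      Fourier coefficient of v decays. Both cases give exp (- s L).\<close>
    have conv_w: "exp_decay (B * exp (- s * L)) s (\<lambda>l. fv l * w (k - l))" if k: "\<bar>real_of_int k\<bar> \<le> L" for k
      unfolding exp_decay_def
    proof
      fix l
      define p where "p = \<bar>real_of_int (k - l)\<bar>"
      define q where "q = \<bar>real_of_int l\<bar>"
      have q0: "q \<ge> 0" by (simp add: q_def)
      have sq: "2 * s * q \<le> \<sigma> * q" by (intro mult_right_mono s0 q0)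
      have sq0: "s * q \<ge> 0" using s0 q0 by simp
      have sL0: "s * L \<ge> 0" using s0 L by simp
      have target: "norm (fv l) * norm (w (k - l)) \<le> B * exp (- s * L + - s * q)"
      proof (cases "p \<le> L")
        case True
        then show ?thesis using B0 by (simp add: w_def a_def p_def)
      next
        case False
        then have wu: "w (k - l) = uh (k - l)" by (simp add: w_def a_def p_def)
        show ?thesis
        proof (cases "p < 2 * L")
          case True
          then have "norm (uh (k - l)) \<le> D1 * X * exp (- \<epsilon>1 * p)"
            using decay(2)[of "k - l"] L enat by (simp add: p_def)
          then have "norm (fv l) * norm (w (k - l)) \<le> (Cv * exp (- \<sigma> * q)) * (D1 * X * exp (- \<epsilon>1 * p))"
            unfolding wu by (intro mult_mono) (use fv_le[of l] Cv in \<open>auto simp: q_def\<close>)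
          also have "\<dots> = B * exp (- \<sigma> * q + - \<epsilon>1 * p)" unfolding B_def exp_add by (simp only: mult_ac)
          also have "\<dots> \<le> B * exp (- s * L + - s * q)"
          proof (rule mult_left_mono[OF _ B0])
            have "2 * s * L \<le> \<epsilon>1 * p" using s0 L False by (intro mult_mono) auto
            then have "- \<sigma> * q + - \<epsilon>1 * p \<le> - s * L + - s * q" using sq sq0 sL0 by linarith
            then show "exp (- \<sigma> * q + - \<epsilon>1 * p) \<le> exp (- s * L + - s * q)" by simp
          qed
          finally show ?thesis .
        next
          case False
          have "q \<ge> p - \<bar>real_of_int k\<bar>" unfolding p_def q_def by linarith
          with False k have qL: "q \<ge> L" by linarith
          have "norm (fv l) * norm (w (k - l)) \<le> (Cv * exp (- \<sigma> * q)) * 1"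
            unfolding wu by (intro mult_mono) (use fv_le[of l] uh(3) Cv in \<open>auto simp: q_def\<close>)
          also have "\<dots> \<le> (Cv * exp (- \<sigma> * q)) * (D1 * X)"
            by (rule mult_left_mono) (use Cv D1' X1 mult_mono[of 1 D1 1 X] in auto)
          also have "\<dots> = B * exp (- \<sigma> * q)" by (simp add: B_def)
          also have "\<dots> \<le> B * exp (- s * L + - s * q)"
          proof (rule mult_left_mono[OF _ B0])
            have "s * L \<le> s * q" using s0 qL by (intro mult_left_mono) auto
            then have "- \<sigma> * q \<le> - s * L + - s * q" using sq by linarith
            then show "exp (- \<sigma> * q) \<le> exp (- s * L + - s * q)" by simp
          qed
          finally show ?thesis .
        qed
      qed
      then show "norm (fv l * w (k - l)) \<le> B * exp (- s * L) * exp (- s * \<bar>real_of_int l\<bar>)"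
        unfolding norm_mult q_def exp_add by (simp only: mult_ac)
    qed
    define g where "g k = of_real E * a k - of_real (2 * cos (2 * pi * (\<theta> + of_int k * \<alpha>))) * a k
        - (\<Sum>\<^sub>\<infinity>l. of_real lam * (fv l * a (k - l)))" for k
    have hs: "((\<lambda>l. of_real lam * (fv l * a (k - l))) has_sum (\<Sum>\<^sub>\<infinity>l. of_real lam * (fv l * a (k - l)))) UNIV" for k
      by (intro has_sum_infsum summable_on_cmult_right exp_decay_infsum(2)[OF conv_a s0(1)])
    \<comment> \<open>Inside the cutoff the exact equation leaves only the convolution with the
      removed part, outside it only the convolution with the retained part. The maximum in the
      exponent is later split evenly: one half of it gives the factor exp (- c N), the other the
      decay in k.\<close>
    have g_le: "norm (g k) \<le> \<bar>lam\<bar> * (B * exp (- s * max L \<bar>real_of_int k\<bar>) * (2 + 2 / s))" for k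
    proof (cases "\<bar>real_of_int k\<bar> \<le> L")
      case True
      have "((\<lambda>l. of_real lam * (fv l * uh (k - l))) has_sum
          (of_real E * uh k - of_real (2 * cos (2 * pi * (\<theta> + of_int k * \<alpha>))) * uh k)) UNIV"
        using eq[of k] by (simp only: mult.assoc)
      from has_sum_diff[OF this hs[of k]]
      have "((\<lambda>l. of_real lam * (fv l * w (k - l))) has_sum g k) UNIV"
        using True by (simp add: g_def a_def w_def algebra_simps)
      then have "g k = (\<Sum>\<^sub>\<infinity>l. of_real lam * (fv l * w (k - l)))" by (simp add: infsumI)
      also have "\<dots> = of_real lam * (\<Sum>\<^sub>\<infinity>l. fv l * w (k - l))" by (rule infsum_cmult_right')
      finally have "norm (g k) = \<bar>lam\<bar> * norm (\<Sum>\<^sub>\<infinity>l. fv l * w (k - l))" by (simp add: norm_mult)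
      also have "\<dots> \<le> \<bar>lam\<bar> * (B * exp (- s * L) * (2 + 2 / s))"
        by (intro mult_left_mono exp_decay_infsum(3)[OF conv_w[OF True] s0(1)]) simp
      finally show ?thesis using True by (simp add: max_def)
    next
      case False
      then have "g k = - (of_real lam * (\<Sum>\<^sub>\<infinity>l. fv l * a (k - l)))"
        by (simp add: g_def a_def infsum_cmult_right')
      then have "norm (g k) = \<bar>lam\<bar> * norm (\<Sum>\<^sub>\<infinity>l. fv l * a (k - l))" by (simp add: norm_mult)
      also have "\<dots> \<le> \<bar>lam\<bar> * (B * exp (- s * \<bar>real_of_int k\<bar>) * (2 + 2 / s))"
        by (intro mult_left_mono exp_decay_infsum(3)[OF conv_a s0(1)]) simp
      finally show ?thesis using False by (simp add: max_def)
    qed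
    show ?thesis
    proof (rule exI[of _ a], rule exI[of _ g], intro conjI allI)
      show "a 0 = 1" using uh L by (simp add: a_def)
      show "exp_decay (\<bar>lam\<bar> * (Cv * D1 * (2 + 2 / s)) * exp (\<epsilon>1 * C * n) * exp_neg (s / (4 * C)) N) (s / 2) g"
        unfolding exp_decay_def
      proof
        fix k
        have "s * max L \<bar>real_of_int k\<bar> \<ge> s * (L / 2 + \<bar>real_of_int k\<bar> / 2)" using s0 by (intro mult_left_mono) auto
        then have "exp (- s * max L \<bar>real_of_int k\<bar>) \<le> exp (- (s / (4 * C)) * real m + - (s / 2) * \<bar>real_of_int k\<bar>)"
          by (simp add: L_def algebra_simps)
        then have "\<bar>lam\<bar> * (B * exp (- s * max L \<bar>real_of_int k\<bar>) * (2 + 2 / s))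
            \<le> \<bar>lam\<bar> * (B * exp (- (s / (4 * C)) * real m + - (s / 2) * \<bar>real_of_int k\<bar>) * (2 + 2 / s))"
          using B0 s0 by (intro mult_left_mono mult_right_mono) auto
        with g_le[of k] show "norm (g k) \<le> \<bar>lam\<bar> * (Cv * D1 * (2 + 2 / s)) * exp (\<epsilon>1 * C * n) * exp_neg (s / (4 * C)) N
            * exp (- (s / 2) * \<bar>real_of_int k\<bar>)"
          unfolding enat exp_neg_enat exp_add B_def X_def by (simp add: mult_ac)
      qed
      show "((\<lambda>l. of_real lam * fourier_coeff v l * a (k - l)) has_sum
        (of_real E * a k - of_real (2 * cos (2 * pi * (\<theta> + of_int k * \<alpha>))) * a k - g k)) UNIV" for k
        using hs[of k] by (simp add: g_def fv_def mult.assoc)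
    qed (rule a_dec)
  qed
qed

subsection \<open>Polynomial growth of transfer matrices\<close>

text \<open>The summand 1 keeps the value at least 1 for x >= 1, so that powers of it are monotone
  in the exponent and dominate constants.\<close>

definition ell :: "real \<Rightarrow> real" where
  "ell x = 1 + ln x"

lemma ell_ge_1: "x \<ge> 1 \<Longrightarrow> ell x \<ge> 1"
  by (simp add: ell_def)

lemma ell_mono: "1 \<le> x \<Longrightarrow> x \<le> y \<Longrightarrow> ell x \<le> ell y"
  by (simp add: ell_def)

lemma ell_power_le_linear:
  fixes c d :: real
  assumes c: "c \<ge> 0" and d: "d > 0"
  obtains D where "D \<ge> 0" "\<And>x. x \<ge> 1 \<Longrightarrow> c * ell x ^ p \<le> D + d * x"
proof -
  define B where "B = c * (fact p * 2 ^ p * exp (1 / 2))"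
  have B: "B \<ge> 0" using c by (simp add: B_def)
  show ?thesis
  proof (rule that[of "B\<^sup>2 / (4 * d)"])
    show "B\<^sup>2 / (4 * d) \<ge> 0" using d by simp
    fix x :: real assume x: "x \<ge> 1"
    \<comment> \<open>The square root of x: a power of the logarithm is O(y), and B y <= B^2/(4 d) +
      d y^2 by completing the square.\<close>
    define y where "y = exp (ln x / 2)"
    have y: "y * y = x" using x by (simp add: y_def exp_add[symmetric])
    have "ell x ^ p \<le> fact p * (1 / (1 / 2)) ^ p * exp (1 / 2 * ell x)"
      by (rule power_le_fact_mult_exp) (use ell_ge_1[OF x] in auto)
    also have "exp (1 / 2 * ell x) = exp (1 / 2) * y"
      by (simp add: ell_def y_def exp_add[symmetric] add_divide_distrib)
    finally have "c * ell x ^ p \<le> c * (fact p * 2 ^ p * (exp (1 / 2) * y))" using c by (intro mult_left_mono) auto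
    also have "\<dots> = B * y" by (simp add: B_def)
    also have "B * y \<le> B\<^sup>2 / (4 * d) + d * x"
    proof -
      have "0 \<le> (B / (2 * d) - y)\<^sup>2 * d" using d by simp
      also have "\<dots> = B\<^sup>2 / (4 * d) - B * y + d * (y * y)"
        using d by (simp add: power2_eq_square field_simps)
      finally show ?thesis using y by simp
    qed
    finally show "c * ell x ^ p \<le> B\<^sup>2 / (4 * d) + d * x" .
  qed
qed

lemma ell_power_le_eventually:
  fixes c d :: real
  assumes c: "c \<ge> 0" and d: "d > 0"
  obtains X where "X \<ge> 1" "\<And>x. x \<ge> X \<Longrightarrow> c * ell x ^ p \<le> d * x"
proof -
  obtain D where D: "D \<ge> 0" "\<And>x. x \<ge> 1 \<Longrightarrow> c * ell x ^ p \<le> D + d / 2 * x"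
    using ell_power_le_linear[OF c, of "d / 2" p] d by auto
  show ?thesis
  proof (rule that[of "max 1 (2 * D / d)"])
    fix x :: real assume x: "max 1 (2 * D / d) \<le> x"
    then have "D \<le> d / 2 * x" using d by (simp add: field_simps)
    then show "c * ell x ^ p \<le> d * x" using D(2)[of x] x by simp
  qed simp
qed

text \<open>Any power of an iterated logarithm is eventually below a logarithm. Hence a crude bound
  taken two resonances back is at most linear in the size of the present one, and two bootstrapping
  steps suffice.\<close>

lemma exp_iterated_ell_le:
  fixes c A :: real
  assumes c: "c \<ge> 0" and A: "A \<ge> 1"
  obtains D where "D \<ge> 1" "\<And>x. x \<ge> 1 \<Longrightarrow> exp (c * (A * ell (A * ell x)) ^ p) \<le> D * x"
proof -
  obtain D where D: "D \<ge> 0" "\<And>x. x \<ge> 1 \<Longrightarrow> (c * A ^ p) * ell x ^ p \<le> D + 1 / A * x"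
    using ell_power_le_linear[of "c * A ^ p" "1 / A" p] c A by auto
  show ?thesis
  proof (rule that[of "exp (D + 1)"])
    fix x :: real assume x: "x \<ge> 1"
    have "1 * 1 \<le> A * ell x" using A ell_ge_1[OF x] by (intro mult_mono) auto
    then have "(c * A ^ p) * ell (A * ell x) ^ p \<le> D + 1 / A * (A * ell x)" by (intro D) simp
    also have "\<dots> = (D + 1) + ln x" using A by (simp add: ell_def)
    finally have "exp (c * (A * ell (A * ell x)) ^ p) \<le> exp ((D + 1) + ln x)"
      by (simp add: power_mult_distrib mult.assoc)
    then show "exp (c * (A * ell (A * ell x)) ^ p) \<le> exp (D + 1) * x" using x by (simp add: exp_add)
  qed (use D in simp)
qed

locale resonance_setting = bloch_setting +
  fixes v :: "real \<Rightarrow> real" and \<epsilon>0 Cg cg Xg :: real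
  assumes v: "\<And>x. fs vc (of_real x) = of_real (v x)"
    and \<epsilon>0: "\<epsilon>0 > 0" and Cg: "Cg \<ge> 1" and cg: "cg > 0" and Xg: "Xg \<ge> 0"
begin

definition "nn r j = \<bar>real_of_int (r j)\<bar> + 1"

text \<open>The size of the defect left by the truncation. The factor exp (Xg n) is the price of the
  full decay rate; since n is of order ln N, it costs only a power of N.\<close>

definition "dl \<theta> r j = Cg * exp (Xg * nn r j) * exp_neg cg (res_abs \<alpha> \<epsilon>0 \<theta> r (Suc j))"

text \<open>Everything that is needed later about the dual solution: an approximate wave at each
  resonance. Growth and conjugacy at one resonance use the waves at preceding ones, so the condition
  is imposed for all j at once.\<close>

definition adm :: "real \<Rightarrow> real \<Rightarrow> (nat \<Rightarrow> int) \<Rightarrow> bool" where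
  "adm E \<theta> r \<longleftrightarrow> resonance_enum \<alpha> \<epsilon>0 \<theta> r \<and>
    (\<forall>j\<in>res_index \<alpha> \<epsilon>0 \<theta>. \<exists>a g. bloch_wave \<alpha> \<kappa> lam \<epsilon> Cv Cb \<Lambda> \<tau> vc E \<theta> (nn r j) (dl \<theta> r j) a g)"

definition "Asep = 1 + (\<bar>ln (2 / \<kappa>)\<bar> + 2 * real \<tau>) / \<epsilon>0"
definition "CB = 8 * exp 3 * \<Lambda> * (64 * Cu) ^ 4 * CK"
definition "\<Gamma>0 = Cg * (2 + 4 / \<epsilon>)"

lemma nn_ge_1: "nn r j \<ge> 1"
  by (simp add: nn_def)

lemma Asep_ge_1: "Asep \<ge> 1"
  using \<epsilon>0 by (simp add: Asep_def)

lemma CK_ge: "CK \<ge> 2"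
  using CS_pos by (simp add: CK_def)

lemma CB_ge_1: "CB \<ge> 1"
proof -
  have "1 \<le> (64 * Cu) ^ 4" using Cu_ge by (intro one_le_power) auto
  moreover have "(1::real) \<le> 8 * exp 3" using one_le_exp_iff[of "3::real"] by linarith
  ultimately have "1 * 1 * 1 * 1 \<le> (8 * exp 3) * \<Lambda> * (64 * Cu) ^ 4 * CK"
    using \<Lambda> CK_ge by (intro mult_mono) auto
  then show ?thesis by (simp add: CB_def)
qed

lemma \<Gamma>0_ge_1: "\<Gamma>0 \<ge> 1"
  using Cg \<epsilon> mult_mono[of 1 Cg 1 "2 + 4 / \<epsilon>"] by (simp add: \<Gamma>0_def)

lemma Kn_mono: "0 \<le> n \<Longrightarrow> n \<le> n' \<Longrightarrow> Kn n \<le> Kn n'"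
  unfolding Kn_def using CS_pos
  by (intro add_right_mono nat_mono ceiling_mono mult_left_mono power_mono) auto

lemma adm_enum: "adm E \<theta> r \<Longrightarrow> resonance_enum \<alpha> \<epsilon>0 \<theta> r"
  by (simp add: adm_def)

lemma adm_wave:
  assumes "adm E \<theta> r" "j \<in> res_index \<alpha> \<epsilon>0 \<theta>"
  obtains a g where "bloch_wave \<alpha> \<kappa> lam \<epsilon> Cv Cb \<Lambda> \<tau> vc E \<theta> (nn r j) (dl \<theta> r j) a g"
  using assms by (auto simp: adm_def)

lemma adm_Suc:
  assumes ad: "adm E \<theta> r" and j: "Suc j \<in> res_index \<alpha> \<epsilon>0 \<theta>"
  shows "j \<in> res_index \<alpha> \<epsilon>0 \<theta>" "nn r (Suc j) = \<bar>real_of_int (r (Suc j))\<bar> + 1" "\<bar>real_of_int (r (Suc j))\<bar> \<ge> 1"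
    "nn r j \<le> nn r (Suc j)" "nn r j \<le> Asep * ell \<bar>real_of_int (r (Suc j))\<bar>"
    "res_abs \<alpha> \<epsilon>0 \<theta> r (Suc j) = enat (nat \<bar>r (Suc j)\<bar>)"
    "dl \<theta> r j = Cg * exp (Xg * nn r j) * exp (- cg * \<bar>real_of_int (r (Suc j))\<bar>)"
proof -
  note R = resonance_enum_Suc[OF adm_enum[OF ad] j]
  define x where "x = \<bar>real_of_int (r (Suc j))\<bar>"
  have x: "x \<ge> 1" using R(6) by (simp add: x_def)
  show "j \<in> res_index \<alpha> \<epsilon>0 \<theta>" "nn r (Suc j) = \<bar>real_of_int (r (Suc j))\<bar> + 1" "\<bar>real_of_int (r (Suc j))\<bar> \<ge> 1"
    using R x by (simp_all add: nn_def x_def)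
  show "nn r j \<le> nn r (Suc j)" using R(4) by (simp add: nn_def)
  have "\<epsilon>0 * \<bar>real_of_int (r j)\<bar> \<le> ln (2 / \<kappa>) + real \<tau> * ln (2 * x)"
    unfolding x_def by (rule resonance_separation[OF dio \<kappa> adm_enum[OF ad] j])
  also have "\<dots> \<le> \<bar>ln (2 / \<kappa>)\<bar> * ell x + real \<tau> * (2 * ell x)"
  proof (intro add_mono mult_left_mono)
    have l: "ell x \<ge> 1" by (rule ell_ge_1[OF x])
    have "\<bar>ln (2 / \<kappa>)\<bar> * 1 \<le> \<bar>ln (2 / \<kappa>)\<bar> * ell x" using l by (intro mult_left_mono) auto
    then show "ln (2 / \<kappa>) \<le> \<bar>ln (2 / \<kappa>)\<bar> * ell x" by linarith
    have "ln (2 * x) = ln 2 + ln x" using x by (subst ln_mult_pos) auto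
    also have "ln 2 \<le> (1::real)" using ln_2_less_1 by simp
    finally show "ln (2 * x) \<le> 2 * ell x" using l by (simp add: ell_def)
  qed simp
  finally have "\<bar>real_of_int (r j)\<bar> \<le> ((\<bar>ln (2 / \<kappa>)\<bar> + 2 * real \<tau>) / \<epsilon>0) * ell x"
    using \<epsilon>0 by (simp add: field_simps)
  then show "nn r j \<le> Asep * ell \<bar>real_of_int (r (Suc j))\<bar>"
    using ell_ge_1[OF x] unfolding nn_def Asep_def x_def[symmetric] distrib_right by linarith
  show N: "res_abs \<alpha> \<epsilon>0 \<theta> r (Suc j) = enat (nat \<bar>r (Suc j)\<bar>)" using j by (simp add: res_abs_def)
  show "dl \<theta> r j = Cg * exp (Xg * nn r j) * exp (- cg * \<bar>real_of_int (r (Suc j))\<bar>)"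
    unfolding dl_def N by simp
qed

lemma crude_bound:
  assumes ad: "adm E \<theta> r" and j: "j \<in> res_index \<alpha> \<epsilon>0 \<theta>"
  shows "growth E \<real> (Kn (nn r j)) (\<Lambda> ^ Kn (nn r j))"
proof -
  obtain a g where "bloch_wave \<alpha> \<kappa> lam \<epsilon> Cv Cb \<Lambda> \<tau> vc E \<theta> (nn r j) (dl \<theta> r j) a g" by (rule adm_wave[OF ad j])
  then interpret bloch_wave \<alpha> \<kappa> lam \<epsilon> Cv Cb \<Lambda> \<tau> vc E \<theta> "nn r j" "dl \<theta> r j" a g .
  show ?thesis by (rule growth_mono[OF crude_growth]) (use \<epsilon> in \<open>auto elim!: Reals_cases\<close>)
qed

text \<open>For n = O(ln x) even the crude growth bound \<Lambda>^(Kn n) is only exp (C (ln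
  x)^(\<tau>+1)), which the defect exp (- cg x) beats. This starts the bootstrap without prior
  knowledge of the growth.\<close>

lemma crude_smallness:
  obtains X where "X \<ge> 1" "\<And>x n M. x \<ge> X \<Longrightarrow> 1 \<le> n \<Longrightarrow> n \<le> Asep * ell x \<Longrightarrow> 1 \<le> M \<Longrightarrow> M \<le> \<Lambda> ^ Kn n \<Longrightarrow>
    M * real (Kn n) * (\<Gamma>0 * exp (Xg * n) * exp (- cg * x)) \<le> 1 / 4 \<and>
    (\<Gamma>0 * exp (Xg * n) * exp (- cg * x)) * frame n M * (2 * \<Lambda> * (frame n M)\<^sup>2 * (real (Kn (x + 1)))\<^sup>2) \<le> 1"
proof -
  define p where "p = \<tau> + 1"
  define k1 where "k1 = CK * Asep ^ p"
  define k2 where "k2 = CK * 2 ^ p + real p"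
  define c4 where "c4 = ln \<Lambda> * k1 + Asep + k1 + k2 + 64 * Cu + \<Gamma>0 + Xg * Asep + 2 * \<Lambda> + 8"
  have pos: "ln \<Lambda> * k1 \<ge> 0" "Asep \<ge> 0" "k1 \<ge> 0" "k2 \<ge> 0" "64 * Cu \<ge> 0" "\<Gamma>0 \<ge> 0" "Xg * Asep \<ge> 0" "2 * \<Lambda> \<ge> 0"
    using \<Lambda> Asep_ge_1 CK_ge Cu_ge \<Gamma>0_ge_1 Xg by (auto simp: k1_def k2_def)
  have c4: "c4 \<ge> 0" using pos unfolding c4_def by linarith
  obtain X where X: "X \<ge> 1" "\<And>x. x \<ge> X \<Longrightarrow> (17 * c4) * ell x ^ p \<le> cg * x"
    using ell_power_le_eventually[of "17 * c4" cg p] c4 cg by auto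
  show ?thesis
  proof (rule that[OF X(1)])
    fix x n M :: real assume x: "x \<ge> X" and n: "1 \<le> n" "n \<le> Asep * ell x" and M: "1 \<le> M" "M \<le> \<Lambda> ^ Kn n"
    have x1: "x \<ge> 1" using x X(1) by simp
    have L1: "ell x \<ge> 1" by (rule ell_ge_1[OF x1])
    define L where "L = ell x ^ p"
    have L: "L \<ge> 1" "ell x \<le> L"
      using one_le_power[OF L1, of p] self_le_power[OF L1, of p] by (auto simp: L_def p_def)
    \<comment> \<open>A common bound for all quantities involved. Its power 17 below counts the
      factors of the second condition: 2 from the defect, 4 from the frame, 1 from 2 \<Lambda>, 8
      from the square of the frame and 2 from the square of the time.\<close>
    define Y where "Y = exp (c4 * L)"
    have Yexp: "exp (t * L) \<le> Y" if "t \<le> c4" for t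
      using that L unfolding Y_def by (simp add: mult_right_mono)
    have Yc: "t \<le> Y" if "t \<le> c4" for t
    proof -
      have "t \<le> exp t" using exp_ge_add_one_self[of t] by linarith
      also have "\<dots> \<le> Y"
      proof (cases "t \<ge> 0")
        case True
        then have "t * 1 \<le> t * L" using L by (intro mult_left_mono) auto
        then have "exp t \<le> exp (t * L)" by simp
        then show ?thesis using Yexp[OF that] by linarith
      next
        case False
        have "exp t \<le> exp 0" using False by simp
        also have "\<dots> \<le> Y" using c4 L by (simp add: Y_def)
        finally show ?thesis .
      qed
      finally show ?thesis .
    qed
    have Y8: "8 \<le> Y" by (rule Yc) (use pos in \<open>simp add: c4_def\<close>)
    have Kn_le: "real (Kn n) \<le> k1 * L"
    proof -
      have "real (Kn n) \<le> CK * n ^ p" unfolding p_def by (rule Kn_bounds(2)[OF n(1)])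
      also have "\<dots> \<le> CK * (Asep * ell x) ^ p" using n CK_ge by (intro mult_left_mono power_mono) auto
      finally show ?thesis by (simp add: k1_def L_def power_mult_distrib mult_ac)
    qed
    have M_le: "M \<le> Y"
    proof -
      have "M \<le> exp (real (Kn n) * ln \<Lambda>)" using M(2) \<Lambda> by (simp add: exp_of_nat_mult)
      also have "\<dots> \<le> exp ((ln \<Lambda> * k1) * L)"
        using mult_right_mono[OF Kn_le, of "ln \<Lambda>"] \<Lambda> by (simp add: mult_ac)
      also have "\<dots> \<le> Y" by (rule Yexp) (use pos in \<open>simp add: c4_def\<close>)
      finally show ?thesis .
    qed
    have lin: "t * L \<le> Y" if "t \<le> c4" for t
      using exp_ge_add_one_self[of "t * L"] Yexp[OF that] by linarith
    have Kn_Y: "real (Kn n) \<le> Y" using Kn_le lin[of k1] pos by (simp add: c4_def)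
    have n_Y: "n \<le> Y"
    proof -
      have "n \<le> Asep * L" using n(2) L(2) Asep_ge_1 mult_left_mono[of "ell x" L Asep] by linarith
      then show ?thesis using lin[of Asep] pos by (simp add: c4_def)
    qed
    have Kx_Y: "real (Kn (x + 1)) \<le> Y"
    proof -
      have "real (Kn (x + 1)) \<le> CK * (x + 1) ^ p" unfolding p_def by (rule Kn_bounds(2)) (use x1 in simp)
      also have "\<dots> \<le> CK * (2 * x) ^ p" using x1 CK_ge by (intro mult_left_mono power_mono) auto
      also have "\<dots> = (CK * 2 ^ p) * exp (real p * ln x)" using x1 by (simp add: power_mult_distrib exp_of_nat_mult)
      also have "\<dots> \<le> exp ((CK * 2 ^ p) * L) * exp (real p * L)"
      proof (intro mult_mono)
        have "CK * 2 ^ p * 1 \<le> CK * 2 ^ p * L" using L CK_ge by (intro mult_left_mono) auto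
        then show "CK * 2 ^ p \<le> exp ((CK * 2 ^ p) * L)" using exp_ge_add_one_self[of "(CK * 2 ^ p) * L"] by linarith
        have "ln x \<le> L" using L(2) by (simp add: ell_def)
        then show "exp (real p * ln x) \<le> exp (real p * L)" by (simp add: mult_left_mono)
      qed auto
      also have "\<dots> = exp (k2 * L)" by (simp add: k2_def exp_add[symmetric] distrib_right)
      also have "\<dots> \<le> Y" by (rule Yexp) (use pos in \<open>simp add: c4_def\<close>)
      finally show ?thesis .
    qed
    define \<Gamma> where "\<Gamma> = \<Gamma>0 * exp (Xg * n) * exp (- cg * x)"
    define E where "E = exp (- cg * x)"
    have E: "E > 0" by (simp add: E_def)
    have G_Y: "\<Gamma> \<le> Y ^ 2 * E"
    proof -
      have "n \<le> Asep * L"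
        by (rule order_trans[OF n(2) mult_left_mono[OF L(2)]]) (use Asep_ge_1 in simp)
      from mult_left_mono[OF this Xg] have "Xg * n \<le> (Xg * Asep) * L" by (simp add: mult.assoc)
      then have "exp (Xg * n) \<le> exp ((Xg * Asep) * L)" by simp
      also have "\<dots> \<le> Y" by (rule Yexp) (use pos in \<open>simp add: c4_def\<close>)
      finally have "\<Gamma>0 * exp (Xg * n) \<le> Y * Y"
        using Yc[of \<Gamma>0] pos Y8 by (intro mult_mono) (auto simp: c4_def)
      from mult_right_mono[OF this, of E] show ?thesis
        unfolding \<Gamma>_def E_def[symmetric] power2_eq_square using E by simp
    qed
    have G0: "\<Gamma> \<ge> 0" using pos by (simp add: \<Gamma>_def)
    have YE: "Y ^ 17 * E \<le> 1"
    proof -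
      have "Y ^ 17 * E = exp (17 * c4 * L - cg * x)"
        by (simp add: Y_def E_def exp_of_nat_mult[symmetric] exp_add[symmetric])
      also have "\<dots> \<le> exp 0" using X(2)[OF x] by (simp add: L_def)
      finally show ?thesis by simp
    qed
    have Y0: "Y \<ge> 0" "Y \<ge> 1" using Y8 by simp_all
    have fr: "frame n M \<le> Y ^ 4"
    proof -
      have "64 * Cu \<le> Y" by (rule Yc) (use pos in \<open>simp add: c4_def\<close>)
      moreover have "frame n M = (64 * Cu) * M ^ 2 * n" by (simp add: frame_def)
      moreover have "(64 * Cu) * M ^ 2 * n \<le> Y * Y ^ 2 * Y"
        using calculation(1) M M_le n n_Y Cu_ge Y0 by (intro mult_mono power_mono) auto
      ultimately show ?thesis by (simp add: power_numeral_reduce mult_ac)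
    qed
    have fr0: "frame n M \<ge> 0" using Cu_ge n by (simp add: frame_def)
    have "M * real (Kn n) * \<Gamma> \<le> Y * Y * (Y ^ 2 * E)"
      using M M_le Kn_Y G_Y G0 Y0 by (intro mult_mono) auto
    also have "\<dots> = Y ^ 4 * E" by (simp add: power_numeral_reduce mult_ac)
    finally have 1: "M * real (Kn n) * \<Gamma> \<le> Y ^ 4 * E" .
    have "4 * Y ^ 4 \<le> Y ^ 5" using Y8 Y0 mult_right_mono[of 4 Y "Y ^ 4"] by (simp add: power_numeral_reduce)
    also have "\<dots> \<le> Y ^ 17" by (rule power_increasing) (use Y0 in auto)
    finally have "4 * (Y ^ 4 * E) \<le> 1" using mult_right_mono[of "4 * Y ^ 4" "Y ^ 17" E] YE E unfolding mult.assoc by linarith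
    with 1 have A: "M * real (Kn n) * \<Gamma> \<le> 1 / 4" by simp
    have "\<Gamma> * frame n M * (2 * \<Lambda> * (frame n M)\<^sup>2 * (real (Kn (x + 1)))\<^sup>2)
        \<le> (Y ^ 2 * E) * Y ^ 4 * (Y * (Y ^ 4)\<^sup>2 * Y\<^sup>2)"
      using G_Y G0 fr fr0 Yc[of "2 * \<Lambda>"] \<Lambda> Kx_Y Y0 E pos by (intro mult_mono power_mono) (auto simp: c4_def)
    also have "\<dots> = Y ^ 17 * E" by (simp add: power_mult[symmetric] power_add[symmetric] power_numeral_reduce mult_ac)
    finally have "\<Gamma> * frame n M * (2 * \<Lambda> * (frame n M)\<^sup>2 * (real (Kn (x + 1)))\<^sup>2) \<le> 1" using YE by linarith
    with A show "M * real (Kn n) * (\<Gamma>0 * exp (Xg * n) * exp (- cg * x)) \<le> 1 / 4 \<and>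
      (\<Gamma>0 * exp (Xg * n) * exp (- cg * x)) * frame n M * (2 * \<Lambda> * (frame n M)\<^sup>2 * (real (Kn (x + 1)))\<^sup>2) \<le> 1"
      by (simp add: \<Gamma>_def)
  qed
qed

text \<open>The frame at resonance j is built with the growth bound M and then gives linear growth
  up to the orbit length needed at resonance j + 1. The power M^8 is P^4 for a frame bound P of
  order M^2.\<close>

lemma bootstrap:
  obtains X where "X \<ge> 1" "\<And>E \<theta> r j M. adm E \<theta> r \<Longrightarrow> Suc j \<in> res_index \<alpha> \<epsilon>0 \<theta> \<Longrightarrow> X \<le> \<bar>real_of_int (r (Suc j))\<bar> \<Longrightarrow>
    1 \<le> M \<Longrightarrow> M \<le> \<Lambda> ^ Kn (nn r j) \<Longrightarrow> growth E \<real> (Kn (nn r j)) M \<Longrightarrow>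
    growth E \<real> (Kn (nn r (Suc j))) (CB * M ^ 8 * nn r (Suc j) ^ (\<tau> + 5))"
proof -
  obtain X where X: "X \<ge> 1" "\<And>x n M. x \<ge> X \<Longrightarrow> 1 \<le> n \<Longrightarrow> n \<le> Asep * ell x \<Longrightarrow> 1 \<le> M \<Longrightarrow> M \<le> \<Lambda> ^ Kn n \<Longrightarrow>
    M * real (Kn n) * (\<Gamma>0 * exp (Xg * n) * exp (- cg * x)) \<le> 1 / 4 \<and>
    (\<Gamma>0 * exp (Xg * n) * exp (- cg * x)) * frame n M * (2 * \<Lambda> * (frame n M)\<^sup>2 * (real (Kn (x + 1)))\<^sup>2) \<le> 1"
    using crude_smallness by blast
  show ?thesis
  proof (rule that[OF X(1)])
    fix E \<theta> r j M
    assume ad: "adm E \<theta> r" and j: "Suc j \<in> res_index \<alpha> \<epsilon>0 \<theta>" and x: "X \<le> \<bar>real_of_int (r (Suc j))\<bar>"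
      and M: "1 \<le> M" "M \<le> \<Lambda> ^ Kn (nn r j)" and gr: "growth E \<real> (Kn (nn r j)) M"
    note S = adm_Suc[OF ad j]
    obtain a g where "bloch_wave \<alpha> \<kappa> lam \<epsilon> Cv Cb \<Lambda> \<tau> vc E \<theta> (nn r j) (dl \<theta> r j) a g" by (rule adm_wave[OF ad S(1)])
    then interpret bloch_wave \<alpha> \<kappa> lam \<epsilon> Cv Cb \<Lambda> \<tau> vc E \<theta> "nn r j" "dl \<theta> r j" a g .
    have G: "\<Gamma> = \<Gamma>0 * exp (Xg * nn r j) * exp (- cg * \<bar>real_of_int (r (Suc j))\<bar>)"
      unfolding \<Gamma>_def by (simp add: S(7) \<Gamma>0_def)
    note sm = X(2)[OF x nn_ge_1 S(5) M, folded G S(2)]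
    interpret bloch_frame \<alpha> \<kappa> lam \<epsilon> Cv Cb \<Lambda> \<tau> vc E \<theta> "nn r j" "dl \<theta> r j" a g M
      by unfold_locales (use M gr sm in auto)
    have K1: "Kn (nn r (Suc j)) \<ge> 1" using Kn_bounds(3)[OF nn_ge_1, of r "Suc j"] by simp
    have "growth E (strip H) (Kn (nn r (Suc j))) (8 * exp 3 * \<Lambda> * P ^ 4 * real (Kn (nn r (Suc j))))"
      by (rule frame_growth[OF K1]) (use sm in \<open>simp add: P_def\<close>)
    then show "growth E \<real> (Kn (nn r (Suc j))) (CB * M ^ 8 * nn r (Suc j) ^ (\<tau> + 5))"
    proof (rule growth_mono)
      show "\<real> \<subseteq> strip H" using H by (auto elim!: Reals_cases)
      have P4: "P ^ 4 = (64 * Cu) ^ 4 * M ^ 8 * nn r j ^ 4"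
        by (simp add: P_def frame_def power_mult_distrib power_mult[symmetric])
      have "8 * exp 3 * \<Lambda> * P ^ 4 * real (Kn (nn r (Suc j)))
          \<le> 8 * exp 3 * \<Lambda> * ((64 * Cu) ^ 4 * M ^ 8 * nn r (Suc j) ^ 4) * (CK * nn r (Suc j) ^ (\<tau> + 1))"
        unfolding P4 using S(4) nn_ge_1[of r j] \<Lambda> M Cu_ge Kn_bounds(2)[OF nn_ge_1, of r "Suc j"]
        by (intro mult_mono mult_left_mono power_mono) auto
      also have "\<dots> = CB * M ^ 8 * nn r (Suc j) ^ (\<tau> + 5)" by (simp add: CB_def power_add power_numeral_reduce mult_ac)
      finally show "8 * exp 3 * \<Lambda> * P ^ 4 * real (Kn (nn r (Suc j))) \<le> CB * M ^ 8 * nn r (Suc j) ^ (\<tau> + 5)" .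
    qed simp
  qed
qed

text \<open>Starting from the crude bound exp (C n^(tau+1)), one bootstrapping step gives a bound
  exp (C (ln n)^(tau+1)) times a power of n, and a second one a power of n: consecutive resonances
  are exponentially separated.\<close>

lemma polynomial_growth:
  obtains CM q where "CM \<ge> 1"
    "\<And>E \<theta> r j. adm E \<theta> r \<Longrightarrow> j \<in> res_index \<alpha> \<epsilon>0 \<theta> \<Longrightarrow> growth E \<real> (Kn (nn r j)) (CM * nn r j ^ q)"
proof -
  obtain X where X: "X \<ge> 1" "\<And>E \<theta> r j M. adm E \<theta> r \<Longrightarrow> Suc j \<in> res_index \<alpha> \<epsilon>0 \<theta> \<Longrightarrow> X \<le> \<bar>real_of_int (r (Suc j))\<bar> \<Longrightarrow>
    1 \<le> M \<Longrightarrow> M \<le> \<Lambda> ^ Kn (nn r j) \<Longrightarrow> growth E \<real> (Kn (nn r j)) M \<Longrightarrow>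
    growth E \<real> (Kn (nn r (Suc j))) (CB * M ^ 8 * nn r (Suc j) ^ (\<tau> + 5))"
    using bootstrap by blast
  define p where "p = \<tau> + 5"
  define Ca where "Ca = \<Lambda> ^ Kn (X + 1)"
  have Ca: "Ca \<ge> 1" using \<Lambda> by (simp add: Ca_def one_le_power)
  obtain D where D: "D \<ge> 1" "\<And>x. x \<ge> 1 \<Longrightarrow> exp ((64 * ln \<Lambda> * CK) * (Asep * ell (Asep * ell x)) ^ (\<tau> + 1)) \<le> D * x"
    using exp_iterated_ell_le[of "64 * ln \<Lambda> * CK" Asep "\<tau> + 1"] \<Lambda> CK_ge Asep_ge_1 by auto
  \<comment> \<open>The three summands serve a resonance of bounded size, one whose predecessor is
    bounded, and one that admits two bootstrapping steps.\<close>
  define CM where "CM = Ca + CB * Ca ^ 8 + CB ^ 9 * D"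
  have CMs: "Ca \<le> CM" "CB * Ca ^ 8 \<le> CM" "CB ^ 9 * D \<le> CM" using Ca CB_ge_1 D by (auto simp: CM_def)
  have poly: "c * y ^ k \<le> CM * y ^ (9 * p + 1)" if "c \<le> CM" "y \<ge> 1" "k \<le> 9 * p + 1" for c y k
    using that CMs Ca by (intro mult_mono power_increasing) auto
  have step: "growth E \<real> (Kn (nn r j)) (CM * nn r j ^ (9 * p + 1))" if ad: "adm E \<theta> r" and j: "j \<in> res_index \<alpha> \<epsilon>0 \<theta>" for E \<theta> r j
  proof -
    have small_M: "\<Lambda> ^ Kn (nn r j) \<le> Ca" if "nn r j \<le> X + 1" for j
      unfolding Ca_def by (intro power_increasing Kn_mono that) (use \<Lambda> nn_ge_1[of r j] in auto)
    have prev: "\<exists>i. j = Suc i \<and> X \<le> \<bar>real_of_int (r j)\<bar>" if "\<not> nn r j \<le> X + 1" for j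
    proof (cases j)
      case 0
      then show ?thesis using that adm_enum[OF ad] X(1) by (simp add: nn_def resonance_enum_def)
    qed (use that in \<open>simp add: nn_def\<close>)
    have L1: "1 \<le> \<Lambda> ^ k" for k using \<Lambda> by (simp add: one_le_power)
    show ?thesis
    proof (cases "nn r j \<le> X + 1")
      case True
      have "\<Lambda> ^ Kn (nn r j) \<le> CM * nn r j ^ (9 * p + 1)"
        using small_M[OF True] poly[of Ca "nn r j" 0] CMs nn_ge_1[of r j] by simp
      then show ?thesis using growth_mono[OF crude_bound[OF ad j]] by auto
    next
      case False
      then obtain i where i: "j = Suc i" "X \<le> \<bar>real_of_int (r j)\<bar>" using prev by blast
      note S = adm_Suc[OF ad j[unfolded i(1)]]
      show ?thesis
      proof (cases "nn r i \<le> X + 1")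
        case True
        have "growth E \<real> (Kn (nn r j)) (CB * (\<Lambda> ^ Kn (nn r i)) ^ 8 * nn r j ^ p)"
          unfolding i(1) p_def by (rule X(2)[OF ad]) (use j i L1 crude_bound[OF ad S(1)] in auto)
        moreover have "CB * (\<Lambda> ^ Kn (nn r i)) ^ 8 \<le> CB * Ca ^ 8"
          using small_M[OF True] CB_ge_1 \<Lambda> by (intro mult_left_mono power_mono) auto
        then have "CB * (\<Lambda> ^ Kn (nn r i)) ^ 8 * nn r j ^ p \<le> CM * nn r j ^ (9 * p + 1)"
          by (intro poly) (use CMs nn_ge_1[of r j] in auto)
        ultimately show ?thesis using growth_mono by auto
      next
        case False
        then obtain k where k: "i = Suc k" "X \<le> \<bar>real_of_int (r i)\<bar>" using prev by blast
        note S' = adm_Suc[OF ad S(1)[unfolded k(1)]]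
        define Mk where "Mk = \<Lambda> ^ Kn (nn r k)"
        define M1 where "M1 = CB * Mk ^ 8 * nn r i ^ p"
        \<comment> \<open>The minimum with the crude bound secures the hypothesis M <= \<Lambda>^(Kn
          n) of the second bootstrapping step.\<close>
        define Mi where "Mi = min M1 (\<Lambda> ^ Kn (nn r i))"
        have Mk: "Mk \<ge> 1" by (simp add: Mk_def L1)
        have g1: "growth E \<real> (Kn (nn r i)) M1"
          unfolding M1_def k(1) p_def Mk_def by (rule X(2)[OF ad]) (use S(1) k L1 crude_bound[OF ad S'(1)] in auto)
        have gi: "growth E \<real> (Kn (nn r i)) Mi"
          unfolding Mi_def min_def using g1 crude_bound[OF ad S(1)] by simp
        have "1 * 1 * 1 \<le> CB * Mk ^ 8 * nn r i ^ p"
          using CB_ge_1 Mk nn_ge_1[of r i] by (intro mult_mono one_le_power) auto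
        then have Mi: "1 \<le> Mi" "Mi \<le> M1" "Mi \<le> \<Lambda> ^ Kn (nn r i)" using L1 by (auto simp: Mi_def M1_def)
        have gj: "growth E \<real> (Kn (nn r j)) (CB * Mi ^ 8 * nn r j ^ p)"
          unfolding i(1) p_def by (rule X(2)[OF ad]) (use j i Mi gi in auto)
        \<comment> \<open>Two applications of \<open>bootstrap\<close> raise the crude bound at the
          resonance k, two places before j, to the power 64 = 8 * 8. Since n_k is an iterated
          logarithm of n_j, the result is still at most linear in n_j.\<close>
        have Mk64: "Mk ^ 64 \<le> D * nn r j"
        proof -
          have ni: "nn r i \<le> Asep * ell (nn r j)"
          proof -
            have "ell \<bar>real_of_int (r j)\<bar> \<le> ell (nn r j)"
              by (rule ell_mono) (use S(3) in \<open>auto simp: i(1) nn_def\<close>)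
            then have "Asep * ell \<bar>real_of_int (r j)\<bar> \<le> Asep * ell (nn r j)"
              using Asep_ge_1 by (intro mult_left_mono) auto
            then show ?thesis using S(5) unfolding i(1) by linarith
          qed
          have "nn r k \<le> Asep * ell (nn r i)"
          proof -
            have "ell \<bar>real_of_int (r i)\<bar> \<le> ell (nn r i)"
              by (rule ell_mono) (use S'(3) in \<open>auto simp: k(1) nn_def\<close>)
            then have "Asep * ell \<bar>real_of_int (r i)\<bar> \<le> Asep * ell (nn r i)"
              using Asep_ge_1 by (intro mult_left_mono) auto
            then show ?thesis using S'(5) unfolding k(1) by linarith
          qed
          also have "\<dots> \<le> Asep * ell (Asep * ell (nn r j))"
            using ni nn_ge_1[of r i] Asep_ge_1 by (intro mult_left_mono ell_mono) auto
          finally have nk: "nn r k \<le> Asep * ell (Asep * ell (nn r j))" .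
          have "Mk ^ 64 = exp (64 * real (Kn (nn r k)) * ln \<Lambda>)"
          proof -
            have pw: "\<Lambda> ^ m = exp (real m * ln \<Lambda>)" for m using \<Lambda> by (simp add: exp_of_nat_mult)
            have "Mk ^ 64 = \<Lambda> ^ (64 * Kn (nn r k))" by (simp add: Mk_def power_mult[symmetric] mult.commute)
            then show ?thesis unfolding pw by simp
          qed
          also have "\<dots> \<le> exp ((64 * ln \<Lambda> * CK) * (Asep * ell (Asep * ell (nn r j))) ^ (\<tau> + 1))"
          proof -
            have "real (Kn (nn r k)) \<le> CK * nn r k ^ (\<tau> + 1)" by (rule Kn_bounds(2)[OF nn_ge_1])
            also have "\<dots> \<le> CK * (Asep * ell (Asep * ell (nn r j))) ^ (\<tau> + 1)"
              using nk nn_ge_1[of r k] CK_ge by (intro mult_left_mono power_mono) auto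
            finally have "64 * ln \<Lambda> * real (Kn (nn r k)) \<le> 64 * ln \<Lambda> * (CK * (Asep * ell (Asep * ell (nn r j))) ^ (\<tau> + 1))"
              using \<Lambda> by (intro mult_left_mono) auto
            then show ?thesis by (simp add: mult_ac)
          qed
          also have "\<dots> \<le> D * nn r j" by (rule D(2)[OF nn_ge_1])
          finally show ?thesis .
        qed
        have "CB * Mi ^ 8 * nn r j ^ p \<le> CB * M1 ^ 8 * nn r j ^ p"
          using Mi CB_ge_1 nn_ge_1[of r j] by (intro mult_right_mono mult_left_mono power_mono) auto
        also have "\<dots> = (CB * CB ^ 8) * (Mk ^ 8) ^ 8 * ((nn r i ^ p) ^ 8 * nn r j ^ p)"
          unfolding M1_def power_mult_distrib by (simp only: mult_ac)
        also have "\<dots> = CB ^ 9 * Mk ^ 64 * (nn r i ^ (8 * p) * nn r j ^ p)"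
        proof -
          have "(Mk ^ 8) ^ 8 = Mk ^ 64" "(nn r i ^ p) ^ 8 = nn r i ^ (8 * p)" "CB * CB ^ 8 = CB ^ 9"
            using power_add[of CB 1 8] by (simp_all add: power_mult[symmetric] mult.commute)
          then show ?thesis by (simp only:)
        qed
        also have "\<dots> \<le> CB ^ 9 * (D * nn r j) * (nn r j ^ (8 * p) * nn r j ^ p)"
          using S(4) nn_ge_1[of r i] nn_ge_1[of r j] CB_ge_1 Mk Mk64 D(1) unfolding i(1)[symmetric]
          by (intro mult_mono mult_left_mono power_mono mult_right_mono) auto
        also have "\<dots> = CB ^ 9 * D * nn r j ^ (9 * p + 1)"
          by (simp add: power_add[symmetric] mult_ac)
        also have "\<dots> \<le> CM * nn r j ^ (9 * p + 1)"
          by (rule poly) (use CMs nn_ge_1[of r j] in auto)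
        finally show ?thesis using growth_mono[OF gj] by auto
      qed
    qed
  qed
  show ?thesis by (rule that[OF _ step]) (use CMs Ca in auto)
qed

end

section \<open>Powers expressed through exponentials of logarithms\<close>

lemma poly_le_exp:
  fixes c m A L :: real
  assumes "c \<ge> 0" "0 \<le> m" "m \<le> A * L" "L \<ge> 1" "A \<ge> 0"
  shows "c * m ^ k \<le> exp ((c * (A ^ k * fact k) + 1) * L)"
proof -
  have "m ^ k \<le> (A * L) ^ k" by (rule power_mono) (use assms in auto)
  also have "\<dots> \<le> A ^ k * (fact k * exp L)"
    unfolding power_mult_distrib using power_le_fact_mult_exp[of L 1 k] assms by (intro mult_left_mono) auto
  finally have "c * m ^ k \<le> c * (A ^ k * (fact k * exp L))" using assms by (intro mult_left_mono)
  also have "\<dots> = (c * (A ^ k * fact k)) * exp L" by simp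
  also have "\<dots> \<le> exp ((c * (A ^ k * fact k)) * L) * exp L"
  proof (rule mult_right_mono)
    have "(c * (A ^ k * fact k)) * 1 \<le> (c * (A ^ k * fact k)) * L" using assms by (intro mult_left_mono) auto
    then show "c * (A ^ k * fact k) \<le> exp ((c * (A ^ k * fact k)) * L)"
      using exp_ge_add_one_self[of "(c * (A ^ k * fact k)) * L"] by linarith
  qed simp
  also have "\<dots> = exp ((c * (A ^ k * fact k) + 1) * L)" unfolding exp_add[symmetric] by (simp add: algebra_simps)
  finally show ?thesis .
qed

lemma poly_le_exp_ell:
  fixes c x :: real
  assumes "c \<ge> 0" "x \<ge> 1"
  shows "c * (x + 1) ^ k \<le> exp ((c * 2 ^ k + real k) * ell x)"
proof -
  have L: "ell x \<ge> 1" by (rule ell_ge_1[OF assms(2)])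
  have "c * (x + 1) ^ k \<le> c * (2 * x) ^ k" using assms by (intro mult_left_mono power_mono) auto
  also have "\<dots> = (c * 2 ^ k) * exp (real k * ln x)" using assms by (simp add: power_mult_distrib exp_of_nat_mult)
  also have "\<dots> \<le> exp ((c * 2 ^ k) * ell x) * exp (real k * ell x)"
  proof (intro mult_mono)
    have "(c * 2 ^ k) * 1 \<le> (c * 2 ^ k) * ell x" using assms L by (intro mult_left_mono) auto
    then show "c * 2 ^ k \<le> exp ((c * 2 ^ k) * ell x)" using exp_ge_add_one_self[of "(c * 2 ^ k) * ell x"] by linarith
    show "exp (real k * ln x) \<le> exp (real k * ell x)" by (simp add: ell_def mult_left_mono)
  qed auto
  also have "\<dots> = exp ((c * 2 ^ k + real k) * ell x)" unfolding exp_add[symmetric] by (simp add: algebra_simps)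
  finally show ?thesis .
qed

subsection \<open>Conjugation at each resonance\<close>

locale resonance_growth = resonance_setting +
  fixes CM :: real and q :: nat
  assumes CM: "CM \<ge> 1"
    and poly: "\<And>E \<theta> r j. adm E \<theta> r \<Longrightarrow> j \<in> res_index \<alpha> \<epsilon>0 \<theta> \<Longrightarrow> growth E \<real> (Kn (nn r j)) (CM * nn r j ^ q)"
begin

text \<open>The exponent of n in 1/width for M = CM n^q. \<open>Hm\<close> is one eighth of that
  width, the part left by the Fourier step \<open>fourier_growth\<close>, so that one strip serves
  for both the preceding and the present frame.\<close>

definition "Qe = 2 * q + 3"
definition "Hm n = 1 / (8 * CH * CM\<^sup>2 * n ^ Qe)"
definition "Pm n = 64 * CM\<^sup>2 * Cu * n ^ (2 * q + 1)"

lemma width_eq: "width n (CM * n ^ q) = 8 * Hm n"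
  by (simp add: width_def Hm_def Qe_def power_mult_distrib power_add power_mult[symmetric] mult_ac)

lemma frame_eq: "frame n (CM * n ^ q) = Pm n"
  by (simp add: frame_def Pm_def power_mult_distrib power_add power_mult[symmetric] mult_ac)

lemma M_ge_1: "CM * nn r j ^ q \<ge> 1"
  using CM nn_ge_1[of r j] mult_mono[of 1 CM 1 "nn r j ^ q"] by (simp add: one_le_power)

lemma Hm_pos: "n \<ge> 1 \<Longrightarrow> Hm n > 0"
  using CH_ge CM by (simp add: Hm_def)

lemma Hm_antimono: "1 \<le> n \<Longrightarrow> n \<le> n' \<Longrightarrow> Hm n' \<le> Hm n"
  unfolding Hm_def using CH_ge CM by (intro divide_left_mono mult_left_mono power_mono) auto

lemma Hm_le:
  assumes "n \<ge> 1"
  shows "Hm n \<le> \<epsilon> / (4 * pi)"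
proof -
  have "1 * 1 \<le> CM * n ^ q" using CM assms by (intro mult_mono one_le_power) auto
  then have "8 * Hm n \<le> \<epsilon> / (4 * pi)" using width_bounds(3)[OF assms, of "CM * n ^ q"] by (simp add: width_eq)
  then show ?thesis using Hm_pos[OF assms] by linarith
qed

lemma Pm_mono: "0 \<le> n \<Longrightarrow> n \<le> n' \<Longrightarrow> Pm n \<le> Pm n'"
  unfolding Pm_def using Cu_ge by (intro mult_left_mono power_mono) auto

definition "Gj \<theta> r j = dl \<theta> r j * (2 + 4 / \<epsilon>)"

lemma Gj_eq: "Gj \<theta> r j = \<Gamma>0 * exp (Xg * nn r j) * exp_neg cg (res_abs \<alpha> \<epsilon>0 \<theta> r (Suc j))"
  by (simp add: Gj_def dl_def \<Gamma>0_def)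

lemma Gj_nonneg: "Gj \<theta> r j \<ge> 0"
  using \<Gamma>0_ge_1 by (auto simp: Gj_eq exp_neg_def split: enat.split)

lemma adm_frame:
  assumes ad: "adm E \<theta> r" and j: "j \<in> res_index \<alpha> \<epsilon>0 \<theta>"
    and small: "CM * nn r j ^ q * real (Kn (nn r j)) * Gj \<theta> r j \<le> 1 / 4"
  obtains a g where "bloch_frame \<alpha> \<kappa> lam \<epsilon> Cv Cb \<Lambda> \<tau> vc E \<theta> (nn r j) (dl \<theta> r j) a g (CM * nn r j ^ q)"
proof -
  obtain a g where "bloch_wave \<alpha> \<kappa> lam \<epsilon> Cv Cb \<Lambda> \<tau> vc E \<theta> (nn r j) (dl \<theta> r j) a g" by (rule adm_wave[OF ad j])
  then interpret bloch_wave \<alpha> \<kappa> lam \<epsilon> Cv Cb \<Lambda> \<tau> vc E \<theta> "nn r j" "dl \<theta> r j" a g .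
  have "\<Gamma> = Gj \<theta> r j" by (simp add: \<Gamma>_def Gj_def)
  then have "bloch_frame \<alpha> \<kappa> lam \<epsilon> Cv Cb \<Lambda> \<tau> vc E \<theta> (nn r j) (dl \<theta> r j) a g (CM * nn r j ^ q)"
    by unfold_locales (use M_ge_1 poly[OF ad j] small in auto)
  then show ?thesis by (rule that)
qed

text \<open>\<open>averaged_conjugation\<close> with all polynomial factors measured in powers of a
  single quantity Y. In this count a Birkhoff sum is at most Y^12, the conjugacy at most Y^14, and
  the off-diagonal entry at most Y^13/K plus the defect.\<close>

lemma scale_conjugation:
  assumes ad: "adm E \<theta> r" and j: "j \<in> res_index \<alpha> \<epsilon>0 \<theta>"
    and small: "CM * nn r j ^ q * real (Kn (nn r j)) * Gj \<theta> r j \<le> 1 / 4"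
    and h: "0 < h" "h \<le> Hm (nn r j)" and gr': "growth E (strip h) K Q0" and Q0: "0 \<le> Q0" "Q0 \<le> Y ^ 9" and K: "K \<ge> 1"
    and Y: "Y \<ge> 44" "Pm (nn r j) \<le> Y" "2 * \<Lambda> * (Pm (nn r j))\<^sup>2 \<le> Y"
    and e0: "Gj \<theta> r j * Y ^ 30 * (real K)\<^sup>2 \<le> e0" "e0 \<le> 1"
    and B': "Y ^ 14 \<le> B'" and \<beta>: "e0 \<le> \<beta>" and bb: "Y ^ 13 / real K + e0 \<le> bb"
  shows "conjugable v lam \<alpha> E \<theta> h B' \<beta> bb"
proof -
  obtain a g where "bloch_frame \<alpha> \<kappa> lam \<epsilon> Cv Cb \<Lambda> \<tau> vc E \<theta> (nn r j) (dl \<theta> r j) a g (CM * nn r j ^ q)"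
    by (rule adm_frame[OF ad j small])
  then interpret bloch_frame \<alpha> \<kappa> lam \<epsilon> Cv Cb \<Lambda> \<tau> vc E \<theta> "nn r j" "dl \<theta> r j" a g "CM * nn r j ^ q" .
  have G: "\<Gamma> = Gj \<theta> r j" by (simp add: \<Gamma>_def Gj_def)
  have P: "P = Pm (nn r j)" by (simp add: P_def frame_eq)
  have H8: "H = 8 * Hm (nn r j)" by (simp add: H_def width_eq)
  have hH: "h \<le> H" using h H8 Hm_pos[OF nn_ge_1, of r j] by linarith
  have P1: "1 \<le> P" "P \<le> Y" "2 * \<Lambda> * P\<^sup>2 \<le> Y" using P_ge Y by (auto simp: P)
  have Y1: "Y \<ge> 1" "Y \<ge> 0" using Y by auto
  define R where "R = 4 * P\<^sup>2 * Q0 + 1"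
  have R12: "R \<le> Y ^ 12"
  proof -
    have "4 * P\<^sup>2 * Q0 \<le> 4 * Y\<^sup>2 * Y ^ 9" using P1 Q0 by (intro mult_mono power_mono) auto
    also have "\<dots> = 4 * Y ^ 11" by (simp add: power_add[symmetric])
    finally have "4 * P\<^sup>2 * Q0 \<le> 4 * Y ^ 11" .
    moreover have "1 \<le> Y ^ 11" using Y1 by (simp add: one_le_power)
    moreover have "5 * Y ^ 11 \<le> Y * Y ^ 11" using Y Y1 by (intro mult_right_mono) auto
    moreover have "Y * Y ^ 11 = Y ^ 12" using power_add[of Y 1 11] by simp
    ultimately show ?thesis unfolding R_def by linarith
  qed
  have R1: "R \<ge> 1" using Q0 by (simp add: R_def)
  have K1: "real K \<ge> 1" "(real K)\<^sup>2 \<ge> 1" using K by (auto simp: one_le_power)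
  define G' where "G' = Gj \<theta> r j"
  have G0: "G' \<ge> 0" using Gj_nonneg by (simp add: G'_def)
  have GK: "G' * Y ^ 30 * (real K)\<^sup>2 \<le> e0" using e0 by (simp add: G'_def)
  have GY: "G' * Y ^ m \<le> e0" if "m \<le> 30" for m
  proof -
    have "G' * Y ^ m * 1 \<le> G' * Y ^ 30 * (real K)\<^sup>2"
      using that Y1 G0 K1 by (intro mult_mono mult_left_mono power_increasing) auto
    with GK show ?thesis by simp
  qed
  show ?thesis
  proof (rule averaged_conjugation[OF h(1) hH gr' Q0(1) K _ v R_def])
    have "real K * (\<Gamma> * P * (4 * P\<^sup>2 * Q0) * (1 + 2 * \<Lambda> * P\<^sup>2 * real K))
        \<le> real K * (G' * Y * Y ^ 12 * (2 * (Y * real K)))"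
    proof (intro mult_left_mono mult_mono)
      show "4 * P\<^sup>2 * Q0 \<le> Y ^ 12" using R12 by (simp add: R_def)
      have "2 * \<Lambda> * P\<^sup>2 * real K \<le> Y * real K" using P1 by (intro mult_right_mono) auto
      moreover have "1 * 1 \<le> Y * real K" using Y1 K1 by (intro mult_mono) auto
      ultimately show "1 + 2 * \<Lambda> * P\<^sup>2 * real K \<le> 2 * (Y * real K)" by linarith
    qed (use G G0 P1 Q0 \<Lambda> Y1 in \<open>auto simp: G'_def\<close>)
    also have "\<dots> = G' * (2 * (Y ^ 14)) * (real K)\<^sup>2" by (simp add: power_numeral_reduce mult_ac)
    also have "\<dots> \<le> G' * Y ^ 30 * (real K)\<^sup>2"
    proof (intro mult_right_mono mult_left_mono)
      have "2 * Y ^ 14 \<le> Y * Y ^ 14" using Y Y1 by (intro mult_right_mono) auto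
      also have "\<dots> = Y ^ 15" using power_add[of Y 1 14] by simp
      also have "\<dots> \<le> Y ^ 30" using Y1 by (intro power_increasing) auto
      finally show "2 * Y ^ 14 \<le> Y ^ 30" .
    qed (use G0 in auto)
    finally show "real K * (\<Gamma> * P * (4 * P\<^sup>2 * Q0) * (1 + 2 * \<Lambda> * P\<^sup>2 * real K)) \<le> 1" using GK e0(2) by linarith
    have "4 * ((R + 1) * P) \<le> 4 * ((2 * Y ^ 12) * Y)"
      using R12 R1 P1 Y1 by (intro mult_left_mono mult_mono) auto
    also have "\<dots> = 8 * Y ^ 13" by (simp add: power_numeral_reduce)
    also have "\<dots> \<le> Y * Y ^ 13" using Y Y1 by (intro mult_right_mono) auto
    also have "\<dots> = Y ^ 14" using power_add[of Y 1 13] by simp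
    finally show "4 * ((R + 1) * P) \<le> B'" using B' by linarith
    have "3 * R\<^sup>2 * (\<Gamma> * P) \<le> 3 * (Y ^ 12)\<^sup>2 * (G' * Y)"
      using R12 R1 P1 G G0 Y1 by (intro mult_mono mult_left_mono power_mono) (auto simp: G'_def)
    also have "\<dots> = G' * (3 * Y ^ 25)" by (simp add: power_mult[symmetric] power_numeral_reduce mult_ac)
    also have "\<dots> \<le> G' * (Y * Y ^ 25)" using Y Y1 G0 by (intro mult_left_mono mult_right_mono) auto
    also have "\<dots> = G' * Y ^ 26" using power_add[of Y 1 25] by simp
    also have "\<dots> \<le> e0" by (rule GY) simp
    finally have be: "3 * R\<^sup>2 * (\<Gamma> * P) \<le> e0" .
    with \<beta> show "3 * R\<^sup>2 * (\<Gamma> * P) \<le> \<beta>" by linarith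
    have "Y ^ 12 \<le> Y ^ 13" using Y1 by (intro power_increasing) auto
    then have "R / real K \<le> Y ^ 13 / real K" using R12 K1 by (intro divide_right_mono) auto
    with be bb show "R / real K + 3 * R\<^sup>2 * (\<Gamma> * P) \<le> bb" by linarith
  qed
qed

text \<open>Here m stands for the size of the resonance before x. Whatever is polynomial in m or in
  x is bounded by exp (c5 ell x), a power of x, whereas the Fourier tail in the strip belonging to m
  is exp (- c6 w) with w = x / ell x ^ Qe. For x >= X the sixtieth power of the former is still
  below exp (c6 w), which leaves room for all later products.\<close>

lemma scale_constants:
  obtains c5 c6 X where "c5 \<ge> 1" "c6 > 0" "c6 \<le> cg / 4" "X \<ge> 1"
    "\<And>x m. x \<ge> X \<Longrightarrow> 1 \<le> m \<Longrightarrow> m \<le> Asep * ell x \<Longrightarrow>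
       CM * m ^ q * real (Kn m) \<le> exp (c5 * ell x) \<and> Pm m \<le> exp (c5 * ell x) \<and> 2 * \<Lambda> * (Pm m)\<^sup>2 \<le> exp (c5 * ell x) \<and>
       2 + 8 / (pi * (8 * Hm m)) \<le> exp (c5 * ell x) \<and> \<Gamma>0 * exp (Xg * m) \<le> exp (c5 * ell x) \<and>
       exp (- (pi * (8 * Hm m) / 2) * x) \<le> exp (- (c6 * (x / ell x ^ Qe)))"
    "\<And>x. x \<ge> X \<Longrightarrow> (2 * x) ^ \<tau> / \<kappa> \<le> exp (c5 * ell x) \<and> Pm (x + 1) \<le> exp (c5 * ell x) \<and>
       2 * \<Lambda> * (Pm (x + 1))\<^sup>2 \<le> exp (c5 * ell x) \<and> 44 \<le> exp (c5 * ell x) \<and>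
       exp (c5 * ell x) ^ 60 \<le> exp (c6 * (x / ell x ^ Qe)) \<and> x / ell x ^ Qe \<le> x"
proof -
  define k0 where "k0 = 64 * CM\<^sup>2 * Cu"
  define f where "f c k = c * (Asep ^ k * fact k) + 1" for c :: real and k :: nat
  define f' where "f' c k = c * 2 ^ k + real k" for c :: real and k :: nat
  define t1 where "t1 = f k0 (2 * q + 1)"
  define t2 where "t2 = f (2 * \<Lambda> * k0\<^sup>2) (4 * q + 2)"
  define t3 where "t3 = f' (2 ^ \<tau> / \<kappa>) \<tau>"
  define t4 where "t4 = f (2 + 8 * CH * CM\<^sup>2) Qe"
  define t5 where "t5 = \<Gamma>0 + Xg * Asep"
  define t6 where "t6 = f' k0 (2 * q + 1)"
  define t7 where "t7 = f' (2 * \<Lambda> * k0\<^sup>2) (4 * q + 2)"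
  define t8 where "t8 = f (CM * CK) (q + \<tau> + 1)"
  define c5 where "c5 = t1 + t2 + t3 + t4 + t5 + t6 + t7 + t8 + 44"
  have k0: "k0 \<ge> 0" using Cu_ge by (simp add: k0_def)
  have tpos: "t1 \<ge> 0" "t2 \<ge> 0" "t3 \<ge> 0" "t4 \<ge> 0" "t5 \<ge> 0" "t6 \<ge> 0" "t7 \<ge> 0" "t8 \<ge> 0"
    using k0 \<Lambda> \<kappa> CH_ge CM CK_ge \<Gamma>0_ge_1 Xg Asep_ge_1
    by (auto simp: t1_def t2_def t3_def t4_def t5_def t6_def t7_def t8_def f_def f'_def)
  have c5: "c5 \<ge> 44" using tpos unfolding c5_def by linarith
  have tle: "t1 \<le> c5" "t2 \<le> c5" "t3 \<le> c5" "t4 \<le> c5" "t5 \<le> c5" "t6 \<le> c5" "t7 \<le> c5" "t8 \<le> c5"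
    using tpos unfolding c5_def by linarith+
  have nonneg: "2 * \<Lambda> * k0\<^sup>2 \<ge> 0" "2 ^ \<tau> / \<kappa> \<ge> 0" "2 + 8 * CH * CM\<^sup>2 \<ge> 0" "CM * CK \<ge> 0"
    using \<Lambda> \<kappa> CH_ge CM CK_ge by auto
  \<comment> \<open>The second entry is the decay rate offered by the preceding strip; the first
    leaves the factor exp (- cg N) of the defect in control of the square of the averaging
    time.\<close>
  define c6 where "c6 = min (cg / 4) (1 / (CH * CM\<^sup>2 * Asep ^ Qe))"
  have c6: "c6 > 0" "c6 \<le> cg / 4" "c6 \<le> 1 / (CH * CM\<^sup>2 * Asep ^ Qe)"
    using cg CH_ge CM Asep_ge_1 by (auto simp: c6_def)
  obtain X where X: "X \<ge> 1" "\<And>x. x \<ge> X \<Longrightarrow> (60 * c5) * ell x ^ (Qe + 1) \<le> c6 * x"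
    using ell_power_le_eventually[of "60 * c5" c6 "Qe + 1"] c5 c6 by auto
  have mono: "exp (t * ell x) \<le> exp (c5 * ell x)" if "t \<le> c5" "x \<ge> 1" for t x
    using that ell_ge_1[of x] by (simp add: mult_right_mono)
  have Pm_eq: "Pm m = k0 * m ^ (2 * q + 1)" for m by (simp add: Pm_def k0_def)
  have Pm2_eq: "2 * \<Lambda> * (Pm m)\<^sup>2 = (2 * \<Lambda> * k0\<^sup>2) * m ^ (4 * q + 2)" for m
  proof -
    have "(m ^ (2 * q + 1))\<^sup>2 = m ^ (4 * q + 2)" unfolding power_mult[symmetric] by (simp add: algebra_simps)
    then show ?thesis unfolding Pm_eq power_mult_distrib by simp
  qed
  show ?thesis
  proof (rule that[of c5 c6 X])
    fix x m assume x: "x \<ge> X" and m: "1 \<le> m" "m \<le> Asep * ell x"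
    have x1: "x \<ge> 1" using x X(1) by simp
    have L: "ell x \<ge> 1" by (rule ell_ge_1[OF x1])
    have pe: "c * m ^ k \<le> exp (f c k * ell x)" if "c \<ge> 0" for c k
      unfolding f_def by (rule poly_le_exp[OF that _ m(2) L]) (use m Asep_ge_1 in auto)
    have 1: "Pm m \<le> exp (c5 * ell x)"
      unfolding Pm_eq by (rule order_trans[OF pe[OF k0, of "2 * q + 1", folded t1_def] mono[OF tle(1) x1]])
    have 2: "2 * \<Lambda> * (Pm m)\<^sup>2 \<le> exp (c5 * ell x)"
      unfolding Pm2_eq by (rule order_trans[OF pe[OF nonneg(1), of "4 * q + 2", folded t2_def] mono[OF tle(2) x1]])
    have 3: "2 + 8 / (pi * (8 * Hm m)) \<le> exp (c5 * ell x)"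
    proof -
      define Z where "Z = 8 * CH * CM\<^sup>2 * m ^ Qe"
      have Z: "Z \<ge> 0" using CH_ge m by (simp add: Z_def)
      have "8 / (pi * (8 * Hm m)) = Z / pi" by (simp add: Hm_def Z_def)
      also have "\<dots> \<le> Z / 1" using Z pi_gt3 by (intro divide_left_mono) auto
      finally have "2 + 8 / (pi * (8 * Hm m)) \<le> 2 * m ^ Qe + Z" using one_le_power[OF m(1), of Qe] by simp
      also have "\<dots> = (2 + 8 * CH * CM\<^sup>2) * m ^ Qe" by (simp add: Z_def algebra_simps)
      also have "\<dots> \<le> exp (c5 * ell x)"
        by (rule order_trans[OF pe[OF nonneg(3), of "Qe", folded t4_def] mono[OF tle(4) x1]])
      finally show ?thesis .
    qed
    have 4: "\<Gamma>0 * exp (Xg * m) \<le> exp (c5 * ell x)"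
    proof -
      have "\<Gamma>0 * 1 \<le> \<Gamma>0 * ell x" using \<Gamma>0_ge_1 L by (intro mult_left_mono) auto
      then have "\<Gamma>0 \<le> exp (\<Gamma>0 * ell x)" using exp_ge_add_one_self[of "\<Gamma>0 * ell x"] by linarith
      moreover have "exp (Xg * m) \<le> exp (Xg * Asep * ell x)"
        using mult_left_mono[OF m(2) Xg] by (simp add: mult.assoc)
      ultimately have "\<Gamma>0 * exp (Xg * m) \<le> exp (\<Gamma>0 * ell x) * exp (Xg * Asep * ell x)" by (intro mult_mono) auto
      also have "\<dots> = exp (t5 * ell x)" by (simp add: t5_def exp_add[symmetric] distrib_right)
      also have "\<dots> \<le> exp (c5 * ell x)" by (rule mono[OF tle(5) x1])
      finally show ?thesis .
    qed
    have 5: "CM * m ^ q * real (Kn m) \<le> exp (c5 * ell x)"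
    proof -
      have "CM * m ^ q * real (Kn m) \<le> CM * m ^ q * (CK * m ^ (\<tau> + 1))"
        using CM m Kn_bounds(2)[OF m(1)] by (intro mult_left_mono) auto
      also have "\<dots> = (CM * CK) * m ^ (q + \<tau> + 1)" by (simp add: power_add)
      also have "\<dots> \<le> exp (c5 * ell x)"
        by (rule order_trans[OF pe[OF nonneg(4), of "q + \<tau> + 1", folded t8_def] mono[OF tle(8) x1]])
      finally show ?thesis .
    qed
    have 6: "exp (- (pi * (8 * Hm m) / 2) * x) \<le> exp (- (c6 * (x / ell x ^ Qe)))"
    proof -
      have "c6 * (x / ell x ^ Qe) \<le> 1 / (CH * CM\<^sup>2 * Asep ^ Qe) * (x / ell x ^ Qe)"
        using c6 x1 L by (intro mult_right_mono) auto
      also have "\<dots> = x / (CH * CM\<^sup>2 * (Asep * ell x) ^ Qe)" by (simp add: power_mult_distrib mult_ac)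
      also have "\<dots> \<le> x / (CH * CM\<^sup>2 * m ^ Qe)"
        using m x1 L Asep_ge_1 CH_ge CM by (intro divide_left_mono mult_left_mono power_mono mult_pos_pos zero_less_power) auto
      also have "\<dots> = (8 * Hm m) * x" by (simp add: Hm_def)
      also have "\<dots> \<le> (pi * (8 * Hm m) / 2) * x"
        using x1 pi_gt3 Hm_pos[OF m(1)] by (intro mult_right_mono) (auto simp: field_simps)
      finally show ?thesis by simp
    qed
    show "CM * m ^ q * real (Kn m) \<le> exp (c5 * ell x) \<and> Pm m \<le> exp (c5 * ell x) \<and> 2 * \<Lambda> * (Pm m)\<^sup>2 \<le> exp (c5 * ell x) \<and>
       2 + 8 / (pi * (8 * Hm m)) \<le> exp (c5 * ell x) \<and> \<Gamma>0 * exp (Xg * m) \<le> exp (c5 * ell x) \<and>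
       exp (- (pi * (8 * Hm m) / 2) * x) \<le> exp (- (c6 * (x / ell x ^ Qe)))"
      using 1 2 3 4 5 6 by blast
  next
    fix x assume x: "x \<ge> X"
    have x1: "x \<ge> 1" using x X(1) by simp
    have L: "ell x \<ge> 1" by (rule ell_ge_1[OF x1])
    have pe: "c * (x + 1) ^ k \<le> exp (f' c k * ell x)" if "c \<ge> 0" for c k
      unfolding f'_def by (rule poly_le_exp_ell[OF that x1])
    have 1: "Pm (x + 1) \<le> exp (c5 * ell x)"
      unfolding Pm_eq by (rule order_trans[OF pe[OF k0, of "2 * q + 1", folded t6_def] mono[OF tle(6) x1]])
    have 2: "2 * \<Lambda> * (Pm (x + 1))\<^sup>2 \<le> exp (c5 * ell x)"
      unfolding Pm2_eq by (rule order_trans[OF pe[OF nonneg(1), of "4 * q + 2", folded t7_def] mono[OF tle(7) x1]])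
    have 3: "(2 * x) ^ \<tau> / \<kappa> \<le> exp (c5 * ell x)"
    proof -
      have "(2 * x) ^ \<tau> / \<kappa> = (2 ^ \<tau> / \<kappa>) * x ^ \<tau>" by (simp add: power_mult_distrib)
      also have "\<dots> \<le> (2 ^ \<tau> / \<kappa>) * (x + 1) ^ \<tau>" using \<kappa> x1 by (intro mult_left_mono power_mono) auto
      also have "\<dots> \<le> exp (c5 * ell x)"
        by (rule order_trans[OF pe[OF nonneg(2), of "\<tau>", folded t3_def] mono[OF tle(3) x1]])
      finally show ?thesis .
    qed
    have 4: "44 \<le> exp (c5 * ell x)"
      using mult_mono[of 44 c5 1 "ell x"] c5 L exp_ge_add_one_self[of "c5 * ell x"] by linarith
    have 5: "exp (c5 * ell x) ^ 60 \<le> exp (c6 * (x / ell x ^ Qe))"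
    proof -
      have "(60 * c5 * ell x) * ell x ^ Qe \<le> c6 * x" using X(2)[OF x] by (simp add: mult_ac)
      then have "60 * c5 * ell x \<le> c6 * x / ell x ^ Qe" using L by (subst pos_le_divide_eq) auto
      moreover have "exp (c5 * ell x) ^ 60 = exp (60 * c5 * ell x)" by (simp add: exp_of_nat_mult[symmetric] mult_ac)
      ultimately show ?thesis by simp
    qed
    have 6: "x / ell x ^ Qe \<le> x"
      using divide_left_mono[of 1 "ell x ^ Qe" x] one_le_power[OF L, of Qe] x1 by simp
    show "(2 * x) ^ \<tau> / \<kappa> \<le> exp (c5 * ell x) \<and> Pm (x + 1) \<le> exp (c5 * ell x) \<and>
       2 * \<Lambda> * (Pm (x + 1))\<^sup>2 \<le> exp (c5 * ell x) \<and> 44 \<le> exp (c5 * ell x) \<and>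
       exp (c5 * ell x) ^ 60 \<le> exp (c6 * (x / ell x ^ Qe)) \<and> x / ell x ^ Qe \<le> x"
      using 1 2 3 4 5 6 by blast
  qed (use c5 c6 X in auto)
qed

text \<open>Within the frame of resonance i the modes below resonance i + 1 have polynomially
  bounded divisors, so the shear has size Y^3. Tail and defect are of order exp (- c6 w) up to
  powers of Y; therefore orbits of length exp (c6 w/2) still grow by a power of Y only.\<close>

lemma previous_scale_growth:
  assumes ad: "adm E \<theta> r" and i: "Suc i \<in> res_index \<alpha> \<epsilon>0 \<theta>"
  defines "x \<equiv> \<bar>real_of_int (r (Suc i))\<bar>"
  assumes Y: "1 \<le> Y" "44 \<le> Y" and c6: "c6 > 0" "c6 \<le> cg / 4"
    and A: "CM * nn r i ^ q * real (Kn (nn r i)) \<le> Y" "Pm (nn r i) \<le> Y" "2 * \<Lambda> * (Pm (nn r i))\<^sup>2 \<le> Y"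
       "2 + 8 / (pi * (8 * Hm (nn r i))) \<le> Y" "\<Gamma>0 * exp (Xg * nn r i) \<le> Y"
       "exp (- (pi * (8 * Hm (nn r i)) / 2) * x) \<le> exp (- (c6 * w))"
    and B: "(2 * x) ^ \<tau> / \<kappa> \<le> Y" "Y ^ 60 \<le> exp (c6 * w)" "w \<le> x" and w: "w \<ge> 0"
    and K: "real K \<le> exp (c6 * w / 2)"
  shows "growth E (strip (Hm (nn r i))) K (Y ^ 9)"
proof -
  note S = adm_Suc[OF ad i, folded x_def]
  define Z where "Z = exp (c6 * w / 2)"
  have Z: "Z > 0" by (simp add: Z_def)
  have Z2: "Z * Z = exp (c6 * w)" unfolding Z_def exp_add[symmetric] by simp
  have Z3: "exp (- (c6 * w)) = 1 / (Z * Z)"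
    unfolding Z2 by (simp add: exp_minus inverse_eq_divide)
  have "(Y ^ 30)\<^sup>2 = Y ^ 60" unfolding power_mult[symmetric] by simp
  also have "\<dots> \<le> Z\<^sup>2" unfolding power2_eq_square Z2 by (rule B(2))
  finally have YZ: "Y ^ 30 \<le> Z" using Z by (intro power2_le_imp_le[of "Y ^ 30" Z]) auto
  have YkZ: "Y ^ k \<le> Z" if "k \<le> 30" for k
    using YZ power_increasing[OF that Y(1)] by linarith
  have cgx: "exp (- cg * x) \<le> 1 / (Z * Z)"
  proof -
    have "c6 * w \<le> cg * x" using c6 B(3) w S(3) by (intro mult_mono) auto
    then show ?thesis unfolding Z3[symmetric] by simp
  qed
  have G_eq: "Gj \<theta> r i = \<Gamma>0 * exp (Xg * nn r i) * exp (- cg * x)" by (simp add: Gj_eq S(6)) (simp add: x_def)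
  have G: "Gj \<theta> r i \<le> Y / (Z * Z)"
    unfolding G_eq using mult_mono[OF A(5) cgx] Y by simp
  have small: "CM * nn r i ^ q * real (Kn (nn r i)) * Gj \<theta> r i \<le> 1 / 4"
  proof -
    have "CM * nn r i ^ q * real (Kn (nn r i)) * Gj \<theta> r i \<le> Y * (Y / (Z * Z))"
      using A(1) G Gj_nonneg Y by (intro mult_mono) auto
    moreover have "4 * (Y * Y) \<le> Z * Z"
    proof -
      have "4 * (Y * Y) \<le> Y * (Y * Y)" using Y by (intro mult_right_mono) auto
      also have "\<dots> = Y ^ 3" by (simp add: power3_eq_cube)
      also have "\<dots> \<le> Z" by (rule YkZ) simp
      also have "\<dots> \<le> Z * Z" using YkZ[of 0] Z mult_right_mono[of 1 Z Z] by simp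
      finally show ?thesis .
    qed
    then have "Y * (Y / (Z * Z)) \<le> 1 / 4" using Z by (simp add: field_simps)
    ultimately show ?thesis by linarith
  qed
  obtain a g where "bloch_frame \<alpha> \<kappa> lam \<epsilon> Cv Cb \<Lambda> \<tau> vc E \<theta> (nn r i) (dl \<theta> r i) a g (CM * nn r i ^ q)"
    by (rule adm_frame[OF ad S(1) small])
  then interpret bloch_frame \<alpha> \<kappa> lam \<epsilon> Cv Cb \<Lambda> \<tau> vc E \<theta> "nn r i" "dl \<theta> r i" a g "CM * nn r i ^ q" .
  have G': "\<Gamma> = Gj \<theta> r i" by (simp add: \<Gamma>_def Gj_def)
  have P: "P = Pm (nn r i)" by (simp add: P_def frame_eq)
  have H8: "H = 8 * Hm (nn r i)" by (simp add: H_def width_eq)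
  have Hpos: "pi * H > 0" using H by simp
  have P1: "1 \<le> P" "P \<le> Y" using P_ge A(2) by (auto simp: P)
  have x1: "x \<ge> 1" by (rule S(3))
  define \<eta> where "\<eta> = \<kappa> / (2 * x) ^ \<tau>"
  have \<eta>: "\<eta> > 0" using \<kappa> x1 by (simp add: \<eta>_def)
  \<comment> \<open>With Z = exp (c6 w/2) both the tail and the defect carry 1/Z^2. One factor Z is
    spent on the time K, the other on the powers of Y.\<close>
  have "growth E (strip (H / 8)) K (16 * exp 1 * P\<^sup>2 * (Y ^ 3)\<^sup>2)"
  proof (rule fourier_growth[where N = x and \<eta> = \<eta> and T = "Y\<^sup>2 * (1 / (Z * Z))"])
    fix l :: int assume l: "\<bar>real_of_int l\<bar> < x"
    then have l': "\<bar>l\<bar> < \<bar>r (Suc i)\<bar>" unfolding x_def by linarith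
    have "\<eta> \<le> 2 * circle_norm (2 * \<theta> - of_int l * \<alpha>)"
      unfolding \<eta>_def x_def
      by (rule small_divisor_bound[OF dio \<kappa> resonance_enum_Suc(3)[OF adm_enum[OF ad] i]]) (use l' in auto)
    also have "circle_norm (2 * \<theta> - of_int l * \<alpha>) = circle_norm (of_int l * \<alpha> - 2 * \<theta>)"
      using circle_norm_minus[of "2 * \<theta> - of_int l * \<alpha>"] by simp
    also have "2 * circle_norm (of_int l * \<alpha> - 2 * \<theta>) \<le> norm (ep (of_real (of_int l * \<alpha> - 2 * \<theta>)) - 1)"
      by (rule norm_ep_minus_1_ge)
    finally show "\<eta> \<le> norm (1 - ep (of_real (of_int l * \<alpha> - 2 * \<theta>)))" by (simp only: norm_minus_commute)
  next
    have X: "2 + 4 / (pi * H) \<le> Y" "2 + 4 / (pi * H / 2) \<le> Y"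
    proof -
      have "4 / (pi * H) \<le> 8 / (pi * H)" using Hpos by (intro divide_right_mono) auto
      with A(4) show "2 + 4 / (pi * H) \<le> Y" "2 + 4 / (pi * H / 2) \<le> Y" by (simp_all add: H8)
    qed
    have "2 * \<Lambda> * P\<^sup>2 / \<eta> = 2 * \<Lambda> * P\<^sup>2 * ((2 * x) ^ \<tau> / \<kappa>)" by (simp add: \<eta>_def)
    also have "\<dots> \<le> Y * Y" using A(3) B(1) Y \<kappa> x1 unfolding P by (intro mult_mono) auto
    finally have "2 * \<Lambda> * P\<^sup>2 / \<eta> * (2 + 4 / (pi * H)) \<le> (Y * Y) * Y"
      using X Y \<eta> \<Lambda> Hpos by (intro mult_mono) auto
    then show "2 * \<Lambda> * P\<^sup>2 / \<eta> * (2 + 4 / (pi * H)) \<le> Y ^ 3" by (simp add: power3_eq_cube)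
    have "2 * \<Lambda> * P\<^sup>2 * exp (- (pi * H / 2) * x) * (2 + 4 / (pi * H / 2)) \<le> Y * (1 / (Z * Z)) * Y"
      using A(3,6) X Y Hpos \<Lambda> Z unfolding P H8 Z3 by (intro mult_mono) auto
    then show "2 * \<Lambda> * P\<^sup>2 * exp (- (pi * H / 2) * x) * (2 + 4 / (pi * H / 2)) \<le> Y\<^sup>2 * (1 / (Z * Z))"
      by (simp add: power2_eq_square)
    have GP: "\<Gamma> * P \<le> Y / (Z * Z) * Y" unfolding G' using G P1 Gj_nonneg Y Z by (intro mult_mono) auto
    have "Y\<^sup>2 * (1 / (Z * Z)) + 3 * (Y ^ 3)\<^sup>2 * (\<Gamma> * P) \<le> Y\<^sup>2 * (1 / (Z * Z)) + 3 * (Y ^ 3)\<^sup>2 * (Y / (Z * Z) * Y)"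
      by (intro add_left_mono mult_left_mono GP) auto
    also have "\<dots> = (Y\<^sup>2 + 3 * Y ^ 8) / (Z * Z)"
      by (simp add: add_divide_distrib power_mult[symmetric] power_numeral_reduce)
    also have "\<dots> \<le> (4 * Y ^ 8) / (Z * Z)"
      using power_increasing[of 2 8 Y] Y Z by (intro divide_right_mono) auto
    finally have "2 * (Y\<^sup>2 * (1 / (Z * Z)) + 3 * (Y ^ 3)\<^sup>2 * (\<Gamma> * P)) \<le> 8 * Y ^ 8 / (Z * Z)" by simp
    moreover have "0 \<le> 2 * (Y\<^sup>2 * (1 / (Z * Z)) + 3 * (Y ^ 3)\<^sup>2 * (\<Gamma> * P))"
      using Y Z \<Gamma>_nonneg P1 by (intro mult_nonneg_nonneg add_nonneg_nonneg) auto
    ultimately have "real K * (2 * (Y\<^sup>2 * (1 / (Z * Z)) + 3 * (Y ^ 3)\<^sup>2 * (\<Gamma> * P))) \<le> Z * (8 * Y ^ 8 / (Z * Z))"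
      using K unfolding Z_def[symmetric] by (intro mult_mono) (use Z in auto)
    also have "\<dots> = 8 * Y ^ 8 / Z" using Z by simp
    also have "\<dots> \<le> 1"
    proof -
      have "8 * Y ^ 8 \<le> Y * Y ^ 8" using Y by (intro mult_right_mono) auto
      also have "\<dots> = Y ^ 9" using power_add[of Y 1 8] by simp
      also have "\<dots> \<le> Z" by (rule YkZ) simp
      finally show ?thesis using Z by simp
    qed
    finally show "real K * (2 * (Y\<^sup>2 * (1 / (Z * Z)) + 3 * (Y ^ 3)\<^sup>2 * (\<Gamma> * P))) \<le> 1" .
    show "1 \<le> Y ^ 3" using Y by (simp add: one_le_power)
  qed (rule \<eta>)
  moreover have "16 * exp 1 * P\<^sup>2 * (Y ^ 3)\<^sup>2 \<le> Y ^ 9"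
  proof -
    have "16 * exp 1 \<le> Y" using e_less_272 Y by linarith
    then have "16 * exp 1 * P\<^sup>2 * (Y ^ 3)\<^sup>2 \<le> Y * Y\<^sup>2 * (Y ^ 3)\<^sup>2"
      using P1 Y by (intro mult_mono power_mono) auto
    also have "\<dots> = Y ^ 9" by (simp add: power_mult[symmetric] power_numeral_reduce)
    finally show ?thesis .
  qed
  ultimately show ?thesis using growth_mono[of E "strip (H / 8)" K _ "strip (Hm (nn r i))" K "Y ^ 9"] by (simp add: H8)
qed

end

lemma exp_neg_mono: "0 \<le> c \<Longrightarrow> c \<le> c' \<Longrightarrow> exp_neg c' N \<le> exp_neg c N"
  by (cases N) (auto simp: mult_right_mono)

lemma exp_neg_le_1: "0 \<le> c \<Longrightarrow> exp_neg c N \<le> 1"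
  by (cases N) auto

lemma exp_neg_nonneg: "0 \<le> exp_neg c N"
  by (cases N) auto

context resonance_growth
begin

lemma conjugable_bounded_scale:
  assumes ad: "adm E \<theta> r" and j: "j \<in> res_index \<alpha> \<epsilon>0 \<theta>" and h: "0 < h" "h \<le> \<epsilon> / (4 * pi)"
  shows "conjugable v lam \<alpha> E \<theta> h 4 \<Lambda> 1"
proof -
  obtain a g where "bloch_wave \<alpha> \<kappa> lam \<epsilon> Cv Cb \<Lambda> \<tau> vc E \<theta> (nn r j) (dl \<theta> r j) a g" by (rule adm_wave[OF ad j])
  then interpret bloch_wave \<alpha> \<kappa> lam \<epsilon> Cv Cb \<Lambda> \<tau> vc E \<theta> "nn r j" "dl \<theta> r j" a g .
  show ?thesis by (rule conjugation_at_bounded_scale[OF h v]) auto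
qed

text \<open>Bounded n and large N: the off-diagonal entry needs only a fixed bound, so the averaging
  time 1 and the one-step growth \<Lambda> are enough, while the other entries inherit the smallness
  of the defect.\<close>

lemma conjugable_first_scale:
  assumes ad: "adm E \<theta> r" and j: "j \<in> res_index \<alpha> \<epsilon>0 \<theta>" and h: "0 < h" "h \<le> Hm (nn r j)"
    and n: "nn r j \<le> n0" and Y: "44 \<le> Y" "Pm n0 \<le> Y" "2 * \<Lambda> * (Pm n0)\<^sup>2 \<le> Y" "\<Lambda> \<le> Y" "CM * n0 ^ q * real (Kn n0) \<le> Y"
    and N: "N = res_abs \<alpha> \<epsilon>0 \<theta> r (Suc j)" "\<And>m. N = enat m \<Longrightarrow> \<Gamma>0 * exp (Xg * n0) * Y ^ 30 \<le> exp (cg / 2 * real m)"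
  shows "conjugable v lam \<alpha> E \<theta> h (Y ^ 14) (exp_neg (cg / 2) N) (Y ^ 13 + exp_neg (cg / 2) N)"
proof -
  note n1 = nn_ge_1[of r j]
  have Y1: "Y \<ge> 1" "Y \<ge> 0" using Y by auto
  have G30: "Gj \<theta> r j * Y ^ 30 \<le> exp_neg (cg / 2) N"
  proof (cases N)
    case (enat m)
    have "exp (Xg * nn r j) \<le> exp (Xg * n0)" using n Xg by (simp add: mult_left_mono)
    then have "\<Gamma>0 * exp (Xg * nn r j) * Y ^ 30 \<le> \<Gamma>0 * exp (Xg * n0) * Y ^ 30"
      using \<Gamma>0_ge_1 Y1 by (intro mult_right_mono mult_left_mono) auto
    also have "\<dots> \<le> exp (cg / 2 * real m)" by (rule N(2)[OF enat])
    finally have "\<Gamma>0 * exp (Xg * nn r j) * Y ^ 30 * exp (- cg * real m) \<le> exp (cg / 2 * real m) * exp (- cg * real m)"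
      by (intro mult_right_mono) auto
    also have "\<dots> = exp (- (cg / 2) * real m)" by (simp add: exp_add[symmetric])
    finally show ?thesis unfolding Gj_eq N(1)[symmetric] enat exp_neg_enat by (simp add: mult_ac)
  qed (simp add: Gj_eq N(1)[symmetric])
  have Pm_le: "Pm (nn r j) \<le> Pm n0" by (rule Pm_mono) (use n n1 in auto)
  have Pm0: "Pm (nn r j) \<ge> 0" using Cu_ge n1 by (simp add: Pm_def)
  have small: "CM * nn r j ^ q * real (Kn (nn r j)) * Gj \<theta> r j \<le> 1 / 4"
  proof -
    have "CM * nn r j ^ q * real (Kn (nn r j)) \<le> CM * n0 ^ q * real (Kn n0)"
      using CM n n1 Kn_mono[of "nn r j" n0] by (intro mult_mono mult_left_mono power_mono) auto
    with Y have "CM * nn r j ^ q * real (Kn (nn r j)) * Gj \<theta> r j \<le> Y * Gj \<theta> r j"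
      using Gj_nonneg by (intro mult_right_mono) auto
    moreover have "4 * Y \<le> Y ^ 30"
    proof -
      have "4 * Y \<le> Y * Y" using Y by (intro mult_right_mono) auto
      also have "\<dots> = Y ^ 2" by (simp add: power2_eq_square)
      also have "\<dots> \<le> Y ^ 30" using Y1 by (intro power_increasing) auto
      finally show ?thesis .
    qed
    then have "(4 * Y) * Gj \<theta> r j \<le> Y ^ 30 * Gj \<theta> r j" using Gj_nonneg by (intro mult_right_mono) auto
    moreover have "exp_neg (cg / 2) N \<le> 1" using cg by (intro exp_neg_le_1) auto
    ultimately show ?thesis using G30 by (simp add: mult.commute)
  qed
  have gr': "growth E (strip h) 1 \<Lambda>"
  proof -
    obtain a g where "bloch_wave \<alpha> \<kappa> lam \<epsilon> Cv Cb \<Lambda> \<tau> vc E \<theta> (nn r j) (dl \<theta> r j) a g" by (rule adm_wave[OF ad j])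
    then interpret bloch_wave \<alpha> \<kappa> lam \<epsilon> Cv Cb \<Lambda> \<tau> vc E \<theta> "nn r j" "dl \<theta> r j" a g .
    show ?thesis using growth_mono[OF crude_growth[of 1] strip_mono, of h 1 \<Lambda>] h Hm_le[OF n1] by simp
  qed
  have L9: "\<Lambda> \<le> Y ^ 9" using Y(4) power_increasing[of 1 9 Y] Y1 by simp
  have P2: "2 * \<Lambda> * (Pm (nn r j))\<^sup>2 \<le> Y"
    by (rule order_trans[OF _ Y(3)]) (use Pm_le Pm0 \<Lambda> in \<open>auto intro!: mult_left_mono power_mono\<close>)
  show ?thesis
    by (rule scale_conjugation[OF ad j small h gr', of Y "exp_neg (cg / 2) N"])
       (use Y Pm_le \<Lambda> G30 L9 P2 cg exp_neg_le_1[of "cg / 2" N] in auto)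
qed

text \<open>The growth comes from resonance i, the frame from resonance i + 1, and the defect from
  resonance i + 2. Accordingly Y is taken at the present resonance x and, when the following one is
  finite, a second quantity Y' at that one.\<close>

lemma conjugable_later_scale:
  assumes ad: "adm E \<theta> r" and j: "Suc i \<in> res_index \<alpha> \<epsilon>0 \<theta>" and h: "0 < h" "h \<le> Hm (nn r (Suc i))"
    and N: "N = res_abs \<alpha> \<epsilon>0 \<theta> r (Suc (Suc i))"
    and c56: "c5 \<ge> 1" "c6 > 0" "c6 \<le> cg / 4" and X: "X \<ge> 1" "X \<le> x"
    and sc1: "\<And>x m. x \<ge> X \<Longrightarrow> 1 \<le> m \<Longrightarrow> m \<le> Asep * ell x \<Longrightarrow>
       CM * m ^ q * real (Kn m) \<le> exp (c5 * ell x) \<and> Pm m \<le> exp (c5 * ell x) \<and> 2 * \<Lambda> * (Pm m)\<^sup>2 \<le> exp (c5 * ell x) \<and>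
       2 + 8 / (pi * (8 * Hm m)) \<le> exp (c5 * ell x) \<and> \<Gamma>0 * exp (Xg * m) \<le> exp (c5 * ell x) \<and>
       exp (- (pi * (8 * Hm m) / 2) * x) \<le> exp (- (c6 * (x / ell x ^ Qe)))"
    and sc2: "\<And>x. x \<ge> X \<Longrightarrow> (2 * x) ^ \<tau> / \<kappa> \<le> exp (c5 * ell x) \<and> Pm (x + 1) \<le> exp (c5 * ell x) \<and>
       2 * \<Lambda> * (Pm (x + 1))\<^sup>2 \<le> exp (c5 * ell x) \<and> 44 \<le> exp (c5 * ell x) \<and>
       exp (c5 * ell x) ^ 60 \<le> exp (c6 * (x / ell x ^ Qe)) \<and> x / ell x ^ Qe \<le> x"
    and x: "x = \<bar>real_of_int (r (Suc i))\<bar>"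
  shows "conjugable v lam \<alpha> E \<theta> h (exp (c5 * ell x) ^ 14) (exp_neg (cg / 2) N) (2 * exp (- (c6 / 4 * (x / ell x ^ Qe))))"
proof -
  note S = adm_Suc[OF ad j, folded x]
  define Y where "Y = exp (c5 * ell x)"
  define w where "w = x / ell x ^ Qe"
  define n where "n = nn r (Suc i)"
  have n: "n = x + 1" using S(2) by (simp add: n_def)
  have x1: "x \<ge> 1" using X by simp
  have L: "ell x \<ge> 1" by (rule ell_ge_1[OF x1])
  have w0: "w \<ge> 0" using x1 L by (simp add: w_def)
  note A = sc1[OF X(2) nn_ge_1 S(5), folded Y_def w_def]
  note B = sc2[OF X(2), folded Y_def w_def]
  have Y: "44 \<le> Y" "1 \<le> Y" "0 \<le> Y" using B by auto
  \<comment> \<open>The exponential of c6 w is divided into four factors V: the averaging time is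
    about V^2, and powers of Y up to 15 cost at most one V, so the off-diagonal entry is of order
    1/V.\<close>
  define V where "V = exp (c6 * w / 4)"
  have V: "V \<ge> 1" using w0 c56 by (simp add: V_def)
  define Z where "Z = exp (c6 * w / 2)"
  have VZ: "V * V = Z" unfolding V_def Z_def exp_add[symmetric] by simp
  have Z1: "Z \<ge> 1" using w0 c56 by (simp add: Z_def)
  define K where "K = nat \<lfloor>Z\<rfloor>"
  have K: "real K \<le> Z" "Z / 2 \<le> real K" "K \<ge> 1"
  proof -
    have "\<lfloor>Z\<rfloor> \<ge> 1" using Z1 by linarith
    then have "real K = of_int \<lfloor>Z\<rfloor>" "K \<ge> 1" unfolding K_def by (simp, linarith)
    then show "real K \<le> Z" "Z / 2 \<le> real K" "K \<ge> 1" using \<open>\<lfloor>Z\<rfloor> \<ge> 1\<close> by linarith+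
  qed
  have "growth E (strip (Hm (nn r i))) K (Y ^ 9)"
    by (rule previous_scale_growth[OF ad j Y(2,1) c56(2,3), of w, folded x]) (use A B w0 K in \<open>auto simp: Z_def\<close>)
  then have gr': "growth E (strip h) K (Y ^ 9)"
    by (rule growth_mono) (use h Hm_antimono[OF nn_ge_1 S(4)] in \<open>auto intro!: strip_mono\<close>)
  \<comment> \<open>With no further resonance the defect vanishes identically; otherwise n is
    logarithmic in the next one.\<close>
  have N_cases: "N = \<infinity> \<or> (\<exists>m. N = enat m \<and> Suc (Suc i) \<in> res_index \<alpha> \<epsilon>0 \<theta> \<and> real m = \<bar>real_of_int (r (Suc (Suc i)))\<bar>
      \<and> x \<le> real m \<and> n \<le> Asep * ell (real m))"
  proof (cases "Suc (Suc i) \<in> res_index \<alpha> \<epsilon>0 \<theta>")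
    case True
    note S' = adm_Suc[OF ad True]
    have "N = enat (nat \<bar>r (Suc (Suc i))\<bar>)" using N S'(6) by simp
    moreover have "real (nat \<bar>r (Suc (Suc i))\<bar>) = \<bar>real_of_int (r (Suc (Suc i)))\<bar>" by simp
    moreover have "x \<le> \<bar>real_of_int (r (Suc (Suc i)))\<bar>" using S'(4) by (simp add: nn_def x)
    ultimately show ?thesis using True S'(5) by (auto simp: n_def)
  next
    case False
    then show ?thesis by (simp add: N res_abs_def)
  qed
  have e0_1: "exp_neg (cg / 2) N \<le> 1" by (rule exp_neg_le_1) (use cg in auto)
  have key: "CM * n ^ q * real (Kn n) * Gj \<theta> r (Suc i) \<le> 1 / 4 \<and> Gj \<theta> r (Suc i) * Y ^ 30 * (real K)\<^sup>2 \<le> exp_neg (cg / 2) N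
      \<and> exp_neg (cg / 2) N \<le> 1 / V"
    using N_cases
  proof
    assume "N = \<infinity>"
    then show ?thesis using V by (simp add: Gj_eq N[symmetric])
  next
    assume "\<exists>m. N = enat m \<and> Suc (Suc i) \<in> res_index \<alpha> \<epsilon>0 \<theta> \<and> real m = \<bar>real_of_int (r (Suc (Suc i)))\<bar>
      \<and> x \<le> real m \<and> n \<le> Asep * ell (real m)"
    then obtain m where m: "N = enat m" "x \<le> real m" "n \<le> Asep * ell (real m)" by blast
    define y where "y = real m"
    have y: "X \<le> y" "x \<le> y" "y \<ge> 1" using X m by (auto simp: y_def)
    define Y' where "Y' = exp (c5 * ell y)"
    have n1: "1 \<le> n" using n x1 by simp
    note A' = sc1[OF y(1) n1 m(3)[folded y_def], folded Y'_def]
    note B' = sc2[OF y(1), folded Y'_def]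
    have YY': "Y \<le> Y'" unfolding Y_def Y'_def using ell_mono[OF x1 y(2)] c56 by (simp add: mult_left_mono)
    have Y'1: "Y' \<ge> 44" "Y' \<ge> 1" "Y' \<ge> 0" using B' by auto
    have Y60: "Y' ^ 60 \<le> exp (cg / 4 * y)"
    proof -
      have "c6 * (y / ell y ^ Qe) \<le> cg / 4 * y" using B' c56 y ell_ge_1[OF y(3)] by (intro mult_mono) auto
      then have "exp (c6 * (y / ell y ^ Qe)) \<le> exp (cg / 4 * y)" by simp
      with B' show ?thesis by linarith
    qed
    have Yk: "Y' ^ k \<le> exp (cg / 4 * y)" if "k \<le> 60" for k
      using power_increasing[OF that Y'1(2)] Y60 by linarith
    have G: "Gj \<theta> r (Suc i) \<le> Y' * exp (- cg * y)"
      unfolding Gj_eq N[symmetric] m(1) exp_neg_enat n_def[symmetric] y_def[symmetric]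
      by (rule mult_right_mono) (use A' in auto)
    have small: "CM * n ^ q * real (Kn n) * Gj \<theta> r (Suc i) \<le> 1 / 4"
    proof -
      have "CM * n ^ q * real (Kn n) * Gj \<theta> r (Suc i) \<le> Y' * (Y' * exp (- cg * y))"
        using A' G Gj_nonneg Y'1 by (intro mult_mono) auto
      moreover have "4 * (Y' * Y') \<le> exp (cg * y)"
      proof -
        have "4 * (Y' * Y') \<le> Y' * (Y' * Y')" using Y'1 by (intro mult_right_mono) auto
        also have "\<dots> = Y' ^ 3" by (simp add: power3_eq_cube)
        also have "\<dots> \<le> exp (cg / 4 * y)" by (rule Yk) simp
        also have "\<dots> \<le> exp (cg * y)" using cg y by simp
        finally show ?thesis .
      qed
      then have "4 * (Y' * Y') * exp (- cg * y) \<le> exp (cg * y) * exp (- cg * y)" by (intro mult_right_mono) auto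
      then have "4 * (Y' * (Y' * exp (- cg * y))) \<le> 1" by (simp add: exp_minus mult_ac)
      ultimately show ?thesis by linarith
    qed
    have "Gj \<theta> r (Suc i) * Y ^ 30 * (real K)\<^sup>2 \<le> (Y' * exp (- cg * y)) * Y' ^ 30 * exp (cg / 4 * y)"
    proof (intro mult_mono)
      have "(real K)\<^sup>2 \<le> Z\<^sup>2" using K by (intro power_mono) auto
      also have "Z\<^sup>2 = exp (c6 * w)" unfolding Z_def power2_eq_square exp_add[symmetric] by simp
      also have "\<dots> \<le> exp (cg / 4 * y)"
      proof -
        have "w \<le> y" using B y by linarith
        then have "c6 * w \<le> cg / 4 * y" using c56 w0 y by (intro mult_mono) auto
        then show ?thesis by simp
      qed
      finally show "(real K)\<^sup>2 \<le> exp (cg / 4 * y)" .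
      show "Y ^ 30 \<le> Y' ^ 30" using YY' Y by (intro power_mono) auto
    qed (use G Gj_nonneg Y Y'1 in auto)
    also have "\<dots> = Y' ^ 31 * (exp (cg / 4 * y) * exp (- cg * y))"
      using power_add[of Y' 1 30] by (simp add: mult_ac)
    also have "\<dots> \<le> exp (cg / 4 * y) * (exp (cg / 4 * y) * exp (- cg * y))"
      by (intro mult_right_mono Yk) auto
    also have "\<dots> = exp (- (cg / 2) * y)" unfolding exp_add[symmetric] by (simp add: field_simps)
    finally have g: "Gj \<theta> r (Suc i) * Y ^ 30 * (real K)\<^sup>2 \<le> exp_neg (cg / 2) N" by (simp add: m(1) y_def)
    have "w \<le> y" using B y by linarith
    then have "c6 * w \<le> cg / 4 * y" using c56 w0 y by (intro mult_mono) auto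
    then have "c6 * w \<le> cg * y / 4" by simp
    moreover have "0 \<le> c6 * w" "0 \<le> cg * y" using c56 w0 cg y by auto
    ultimately have "c6 * w / 4 \<le> cg * y / 2" by linarith
    then have "exp (- (cg / 2) * y) \<le> exp (- (c6 * w / 4))" by simp
    then have "exp_neg (cg / 2) N \<le> 1 / V" by (simp add: m(1) y_def V_def exp_minus inverse_eq_divide)
    with small g show ?thesis by simp
  qed
  \<comment> \<open>The fourth root of the bound Y^60 <= V^4.\<close>
  have YV: "Y ^ 15 \<le> V"
  proof (rule power_le_imp_le_base[of _ 3])
    have "(Y ^ 15) ^ Suc 3 = Y ^ 60" unfolding power_mult[symmetric] by simp
    also have "\<dots> \<le> exp (c6 * w)" using B by blast
    also have "\<dots> = V ^ Suc 3" unfolding V_def exp_of_nat_mult[symmetric] by simp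
    finally show "(Y ^ 15) ^ Suc 3 \<le> V ^ Suc 3" .
  qed (use V in simp)
  have bb: "Y ^ 13 / real K + exp_neg (cg / 2) N \<le> 2 * exp (- (c6 / 4 * w))"
  proof -
    have "Y ^ 13 / real K \<le> Y ^ 13 / (Z / 2)" using K Z1 Y by (intro divide_left_mono) auto
    also have "\<dots> = (2 * Y ^ 13) / (V * V)" by (simp add: VZ)
    also have "\<dots> \<le> V / (V * V)"
    proof (rule divide_right_mono)
      have "2 * Y ^ 13 \<le> Y * Y ^ 13" using Y by (intro mult_right_mono) auto
      also have "\<dots> = Y ^ 14" using power_add[of Y 1 13] by simp
      also have "\<dots> \<le> Y ^ 15" using Y by (intro power_increasing) auto
      finally show "2 * Y ^ 13 \<le> V" using YV by linarith
    qed (use V in auto)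
    also have "\<dots> = 1 / V" using V by simp
    finally have "Y ^ 13 / real K + exp_neg (cg / 2) N \<le> 1 / V + 1 / V" using key by (intro add_mono) auto
    then show ?thesis by (simp add: V_def exp_minus inverse_eq_divide)
  qed
  show ?thesis
    unfolding Y_def[symmetric] w_def[symmetric]
    by (rule scale_conjugation[OF ad j _ h gr', of Y "exp_neg (cg / 2) N"])
       (use key Y B K bb e0_1 in \<open>auto simp: n_def[symmetric] n\<close>)
qed

text \<open>Three ranges: n and N both bounded, where the identity works; n bounded and N large; n
  large, where a preceding resonance exists. A single pair C, c has to serve all of them.\<close>

lemma conjugable_at_every_scale:
  obtains C c where "C > 0" "c > 0"
    "\<And>E \<theta> r j n N. adm E \<theta> r \<Longrightarrow> j \<in> res_index \<alpha> \<epsilon>0 \<theta> \<Longrightarrow> n = nn r j \<Longrightarrow> N = res_abs \<alpha> \<epsilon>0 \<theta> r (Suc j) \<Longrightarrow>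
      conjugable v lam \<alpha> E \<theta> (c * n powr (- C)) (C * n powr C) (C * exp_neg c N) (C * exp (- c * n * (ln (1 + n)) powr (- C)))"
proof (rule scale_constants, goal_cases)
  case (1 c5 c6 X)
  note sc = 1(2-7)
  define n0 where "n0 = X + 1"
  define Y where "Y = 44 + Pm n0 + 2 * \<Lambda> * (Pm n0)\<^sup>2 + \<Lambda> + CM * n0 ^ q * real (Kn n0)"
  have n0: "n0 \<ge> 1" using sc by (simp add: n0_def)
  have Ys: "Pm n0 \<ge> 0" "2 * \<Lambda> * (Pm n0)\<^sup>2 \<ge> 0" "\<Lambda> \<ge> 0" "CM * n0 ^ q * real (Kn n0) \<ge> 0"
    using Cu_ge n0 \<Lambda> CM by (auto simp: Pm_def)
  then have Y: "44 \<le> Y" "Pm n0 \<le> Y" "2 * \<Lambda> * (Pm n0)\<^sup>2 \<le> Y" "\<Lambda> \<le> Y" "CM * n0 ^ q * real (Kn n0) \<le> Y"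
    unfolding Y_def by linarith+
  \<comment> \<open>From this value of N on, exp ((cg/2) N) exceeds the fixed constants of the
    bounded range, by exp y >= y.\<close>
  define N3 where "N3 = X + 2 / cg * (\<Gamma>0 * exp (Xg * n0) * Y ^ 30)"
  define n1 where "n1 = N3 + 1"
  \<comment> \<open>The multiples of 3 compensate the factor exp (-1) >= 1/3 to which the right-hand
    exponentials may fall in the bounded ranges.\<close>
  define C where "C = real Qe + 14 * c5 + exp (14 * c5) + 3 * (Y ^ 14 + 1) + 3 * \<Lambda> + 4"
  \<comment> \<open>In this order: the strip must lie in that of width \<open>Hm\<close>; the defect
    rate is halved; n <= 2 x and ell x <= 2 ln (1 + n) change variables from x to n; the last two
    keep the exponents c N and c n (ln (1 + n))^(-C) below 1 in the bounded ranges.\<close>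
  define c where "c = Min {1 / (8 * CH * CM\<^sup>2), cg / 2, c6 / (8 * 2 ^ Qe), 1 / N3, (ln 2) powr C / n1}"
  have big: "\<Gamma>0 * exp (Xg * n0) * Y ^ 30 \<ge> 0" using \<Gamma>0_ge_1 Y by simp
  have N3: "N3 \<ge> X" "N3 \<ge> 1" "n1 \<ge> n0" "n1 \<ge> 1"
  proof -
    show "N3 \<ge> X" using big cg by (simp add: N3_def)
    then show "N3 \<ge> 1" "n1 \<ge> n0" "n1 \<ge> 1" using sc(4) by (simp_all add: n1_def n0_def)
  qed
  have Y14: "Y ^ 14 \<ge> 0" "Y ^ 13 \<le> Y ^ 14" using Y by (auto intro!: power_increasing)
  have C: "C \<ge> real Qe" "C \<ge> 14 * c5" "C \<ge> exp (14 * c5)" "C \<ge> 3 * (Y ^ 14 + 1)" "C \<ge> 3 * \<Lambda>" "C \<ge> 4" "C > 0"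
  proof -
    have sum_bound: "a \<le> s \<and> b \<le> s \<and> d \<le> s \<and> e \<le> s \<and> f \<le> s \<and> 4 \<le> s \<and> 0 < s"
      if "0 \<le> a" "0 \<le> b" "0 \<le> d" "0 \<le> e" "0 \<le> f" "s = a + b + d + e + f + 4" for a b d e f s :: real
      using that by linarith
    show "C \<ge> real Qe" "C \<ge> 14 * c5" "C \<ge> exp (14 * c5)" "C \<ge> 3 * (Y ^ 14 + 1)" "C \<ge> 3 * \<Lambda>" "C \<ge> 4" "C > 0"
      using sum_bound[OF _ _ _ _ _ C_def] sc(1) \<Lambda> Y14 by auto
  qed
  have CY: "Y ^ 14 \<le> C" "3 * (Y ^ 13 + e) \<le> C" if "e \<le> 1" for e
  proof -
    have "1 * Y ^ 14 \<le> 3 * (Y ^ 14 + 1)" by (intro mult_mono) (use Y14 in auto)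
    from order_trans[OF this C(4)] show "Y ^ 14 \<le> C" by simp
    have "3 * (Y ^ 13 + e) \<le> 3 * (Y ^ 14 + 1)" by (intro mult_left_mono add_mono Y14(2) that) simp
    from order_trans[OF this C(4)] show "3 * (Y ^ 13 + e) \<le> C" .
  qed
  have ln2: "ln 2 > (0::real)" by simp
  have c_pos: "c > 0"
    unfolding c_def using CH_ge CM cg sc(2) N3 ln2 by (subst Min_gr_iff) auto
  have c: "c \<le> 1 / (8 * CH * CM\<^sup>2)" "c \<le> cg / 2" "c \<le> c6 / (8 * 2 ^ Qe)" "c \<le> 1 / N3" "c \<le> (ln 2) powr C / n1"
    unfolding c_def by (intro Min_le; simp)+
  show ?case
  proof (rule 1(1)[OF C(7) c_pos])
    fix E \<theta> r j n N
    assume ad: "adm E \<theta> r" and j: "j \<in> res_index \<alpha> \<epsilon>0 \<theta>" and n: "n = nn r j" and N: "N = res_abs \<alpha> \<epsilon>0 \<theta> r (Suc j)"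
    have n_ge: "n \<ge> 1" using nn_ge_1 n by simp
    define h where "h = c * n powr (- C)"
    have h0: "h > 0" using c_pos n_ge by (simp add: h_def)
    have hHm: "h \<le> Hm n"
    proof -
      have "n powr (- C) \<le> n powr (- real Qe)" using n_ge C by (intro powr_mono) auto
      also have "\<dots> = 1 / n ^ Qe" using n_ge by (simp add: powr_minus powr_realpow divide_inverse)
      finally have "c * n powr (- C) \<le> 1 / (8 * CH * CM\<^sup>2) * (1 / n ^ Qe)"
        using c c_pos n_ge CH_ge by (intro mult_mono) auto
      then show ?thesis by (simp add: h_def Hm_def)
    qed
    have nC: "1 \<le> n powr C" using n_ge C by (simp add: ge_one_powr_ge_zero)
    have eN: "exp_neg (cg / 2) N \<le> C * exp_neg c N"
    proof -
      have "exp_neg (cg / 2) N \<le> exp_neg c N" by (rule exp_neg_mono) (use c c_pos in auto)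
      also have "\<dots> \<le> C * exp_neg c N" using mult_right_mono[of 1 C "exp_neg c N"] C(6) exp_neg_nonneg[of c N] by linarith
      finally show ?thesis .
    qed
    have e3: "1 / 3 \<le> exp (- t)" if "t \<le> 1" for t :: real
    proof -
      have "exp t \<le> exp 1" using that by simp
      then have "exp t \<le> 3" using exp_le by linarith
      then show ?thesis by (simp add: exp_minus field_simps)
    qed
    have small_n: "b \<le> C * exp (- c * n * (ln (1 + n)) powr (- C))" if "n \<le> n1" "3 * b \<le> C" for b
    proof -
      have "ln 2 \<le> ln (1 + n)" using n_ge by simp
      then have "(ln (1 + n)) powr (- C) \<le> (ln 2) powr (- C)" using C ln2 by (intro powr_mono2') auto
      then have "c * n * (ln (1 + n)) powr (- C) \<le> ((ln 2) powr C / n1) * n1 * (ln 2) powr (- C)"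
        using c c_pos that n_ge N3 by (intro mult_mono) auto
      also have "\<dots> = 1" using N3 ln2 by (simp add: powr_minus)
      finally have "1 / 3 \<le> exp (- (c * n * (ln (1 + n)) powr (- C)))" by (rule e3)
      then have "C * (1 / 3) \<le> C * exp (- (c * n * (ln (1 + n)) powr (- C)))" using C by (intro mult_left_mono) auto
      then show ?thesis using that(2) by simp
    qed
    have BB: "B \<le> C * n powr C" if "B \<le> C" for B
    proof -
      have "C * 1 \<le> C * n powr C" by (intro mult_left_mono nC) (use C(7) in linarith)
      then show ?thesis using that by linarith
    qed
    have "conjugable v lam \<alpha> E \<theta> h (C * n powr C) (C * exp_neg c N) (C * exp (- c * n * (ln (1 + n)) powr (- C)))"
    proof (cases "n \<le> n0")
      case n_small: True
      show ?thesis
      proof (cases "\<exists>m. N = enat m \<and> real m < N3")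
        case True
        then obtain m where m: "N = enat m" "real m < N3" by blast
        have "conjugable v lam \<alpha> E \<theta> h 4 \<Lambda> 1"
          by (rule conjugable_bounded_scale[OF ad j h0]) (use hHm Hm_le[OF n_ge] in linarith)
        then show ?thesis
        proof (rule conjugable_mono)
          show "4 \<le> C * n powr C" by (rule BB[OF C(6)])
          have "c * real m \<le> 1 / N3 * N3" using c c_pos m N3 by (intro mult_mono) auto
          then have "1 / 3 \<le> exp (- (c * real m))" using N3 by (intro e3) auto
          then have "C * (1 / 3) \<le> C * exp (- (c * real m))" using C by (intro mult_left_mono) auto
          then show "\<Lambda> \<le> C * exp_neg c N" using C(5) by (simp add: m(1))
          show "1 \<le> C * exp (- c * n * (ln (1 + n)) powr (- C))"
            by (rule small_n) (use n_small N3 C in auto)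
        qed
      next
        case False
        have "conjugable v lam \<alpha> E \<theta> h (Y ^ 14) (exp_neg (cg / 2) N) (Y ^ 13 + exp_neg (cg / 2) N)"
        proof (rule conjugable_first_scale[OF ad j h0 hHm[unfolded n] n_small[unfolded n] Y N])
          fix m assume "N = enat m"
          then have "N3 \<le> real m" using False by force
          then have "2 / cg * (\<Gamma>0 * exp (Xg * n0) * Y ^ 30) \<le> real m" using sc(4) by (simp add: N3_def)
          then have "\<Gamma>0 * exp (Xg * n0) * Y ^ 30 \<le> cg / 2 * real m" using cg by (simp add: field_simps)
          then show "\<Gamma>0 * exp (Xg * n0) * Y ^ 30 \<le> exp (cg / 2 * real m)"
            using exp_ge_add_one_self[of "cg / 2 * real m"] by linarith
        qed
        then show ?thesis
        proof (rule conjugable_mono)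
          show "Y ^ 14 \<le> C * n powr C" by (rule BB[OF CY(1)[OF order_refl]])
          have "exp_neg (cg / 2) N \<le> 1" by (rule exp_neg_le_1) (use cg in auto)
          then show "Y ^ 13 + exp_neg (cg / 2) N \<le> C * exp (- c * n * (ln (1 + n)) powr (- C))"
            using CY(2) n_small N3 by (intro small_n) auto
        qed (rule eN)
      qed
    next
      case False
      have "j \<noteq> 0"
      proof
        assume "j = 0"
        then have "r j = 0" using adm_enum[OF ad] by (simp add: resonance_enum_def)
        then show False using False n n0 by (simp add: nn_def)
      qed
      then obtain i where i: "j = Suc i" using not0_implies_Suc by blast
      define x where "x = \<bar>real_of_int (r (Suc i))\<bar>"
      have nx: "n = x + 1" by (simp add: n nn_def x_def i)
      have xX: "X \<le> x" using False nx by (simp add: n0_def)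
      have x1: "x \<ge> 1" using xX sc(4) by simp
      define w where "w = x / ell x ^ Qe"
      have "conjugable v lam \<alpha> E \<theta> h (exp (c5 * ell x) ^ 14) (exp_neg (cg / 2) N) (2 * exp (- (c6 / 4 * w)))"
        unfolding w_def
        by (rule conjugable_later_scale[OF ad j[unfolded i] h0 hHm[unfolded n i] N[unfolded i] sc(1-4) xX sc(5,6) x_def])
      then show ?thesis
      proof (rule conjugable_mono)
        have "exp (c5 * ell x) ^ 14 = exp (14 * c5) * exp (14 * c5 * ln x)"
          by (simp add: exp_of_nat_mult[symmetric] exp_add[symmetric] ell_def algebra_simps)
        also have "exp (14 * c5 * ln x) = x powr (14 * c5)" using x1 by (simp add: powr_def)
        also have "exp (14 * c5) * x powr (14 * c5) \<le> C * n powr C"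
        proof (intro mult_mono C)
          have "x powr (14 * c5) \<le> n powr (14 * c5)" using nx x1 sc(1) by (intro powr_mono2) auto
          also have "\<dots> \<le> n powr C" using C n_ge by (intro powr_mono) auto
          finally show "x powr (14 * c5) \<le> n powr C" .
        qed (use C in auto)
        finally show "exp (c5 * ell x) ^ 14 \<le> C * n powr C" .
        define L where "L = ln (1 + n)"
        \<comment> \<open>Here n >= 2, so 1 + n exceeds exp 1. This allows the exponent Qe of the
          logarithm to be raised to C and the summand 1 of \<open>ell\<close> to be
          absorbed.\<close>
        have L1: "L \<ge> 1"
        proof -
          have "exp 1 \<le> 1 + n" using exp_le nx x1 by linarith
          then show ?thesis using n_ge by (simp add: L_def ln_ge_iff)
        qed
        have ellL: "ell x \<le> 2 * L"
        proof -
          have "ln x \<le> L" unfolding L_def using nx x1 by simp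
          then show ?thesis using L1 by (simp add: ell_def)
        qed
        have e1: "ell x \<ge> 1" by (rule ell_ge_1[OF x1])
        have "c * n * L powr (- C) \<le> c6 / 4 * w"
        proof -
          have "L powr (- C) \<le> L powr (- real Qe)" using L1 C by (intro powr_mono) auto
          also have "\<dots> = 1 / L ^ Qe" using L1 by (simp add: powr_minus powr_realpow divide_inverse)
          finally have "c * n * L powr (- C) \<le> c6 / (8 * 2 ^ Qe) * (2 * x) * (1 / L ^ Qe)"
            using c c_pos nx x1 sc(2) by (intro mult_mono) auto
          also have "\<dots> = c6 / 4 * (x / (2 * L) ^ Qe)" by (simp add: power_mult_distrib)
          also have "\<dots> \<le> c6 / 4 * w"
            unfolding w_def using ellL e1 L1 x1 sc(2)
            by (intro mult_left_mono divide_left_mono power_mono mult_pos_pos zero_less_power) auto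
          finally show ?thesis .
        qed
        then have "exp (- (c6 / 4 * w)) \<le> exp (- (c * n * L powr (- C)))" by simp
        then have "2 * exp (- (c6 / 4 * w)) \<le> C * exp (- (c * n * L powr (- C)))"
          using C by (intro mult_mono) auto
        then show "2 * exp (- (c6 / 4 * w)) \<le> C * exp (- c * n * (ln (1 + n)) powr (- C))"
          by (simp add: L_def)
      qed (rule eN)
    qed
    then show "conjugable v lam \<alpha> E \<theta> (c * n powr (- C)) (C * n powr C) (C * exp_neg c N) (C * exp (- c * n * (ln (1 + n)) powr (- C)))"
      by (simp only: h_def)
  qed
qed

end

text \<open>The dual equation at the site 0, where u 0 = 1 and all other values are at most 1,
  determines E up to a bounded quantity. This makes the one-step bound \<Lambda> uniform in
  E.\<close>

lemma dual_phase_energy_bound: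
  assumes vc: "exp_decay Cv \<rho> (fourier_coeff v)" "\<rho> > 0" and dp: "dual_phase v lam \<alpha> E \<theta>"
  shows "\<bar>E\<bar> \<le> 2 + \<bar>lam\<bar> * (Cv * (2 + 2 / \<rho>))"
proof -
  from dp obtain u where u: "dual_solution v lam \<alpha> \<theta> E u" "u 0 = 1" "\<And>k. norm (u k) \<le> 1"
    by (auto simp: dual_phase_def)
  have hs: "((\<lambda>l. of_real lam * fourier_coeff v l * u (0 - l)) has_sum
      (of_real E * u 0 - of_real (2 * cos (2 * pi * (\<theta> + of_int 0 * \<alpha>))) * u 0)) UNIV"
    using u(1) unfolding dual_solution_def by blast
  have "exp_decay Cv \<rho> (\<lambda>l. fourier_coeff v l * u (- l))"
    unfolding exp_decay_def
  proof
    fix l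
    have "norm (fourier_coeff v l * u (- l)) \<le> norm (fourier_coeff v l) * 1"
      unfolding norm_mult by (intro mult_left_mono u) simp
    then show "norm (fourier_coeff v l * u (- l)) \<le> Cv * exp (- \<rho> * \<bar>real_of_int l\<bar>)"
      using exp_decayD[OF vc(1), of l] by simp
  qed
  note S = exp_decay_infsum[OF this vc(2)]
  have "of_real E - of_real (2 * cos (2 * pi * \<theta>)) = of_real lam * (\<Sum>\<^sub>\<infinity>l. fourier_coeff v l * u (- l))"
    using infsumI[OF hs] u(2) by (simp add: mult.assoc infsum_cmult_right')
  then have "norm (of_real (E - 2 * cos (2 * pi * \<theta>)) :: complex) = \<bar>lam\<bar> * norm (\<Sum>\<^sub>\<infinity>l. fourier_coeff v l * u (- l))"
    by (simp add: norm_mult)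
  also have "\<dots> \<le> \<bar>lam\<bar> * (Cv * (2 + 2 / \<rho>))" by (intro mult_left_mono S(3)) simp
  finally have "\<bar>E - 2 * cos (2 * pi * \<theta>)\<bar> \<le> \<bar>lam\<bar> * (Cv * (2 + 2 / \<rho>))" by (simp only: norm_of_real)
  moreover have "\<bar>cos (2 * pi * \<theta>)\<bar> \<le> 1" by simp
  ultimately show ?thesis by linarith
qed

theorem theorem3p4:
  fixes v :: "real \<Rightarrow> real" and \<alpha> lam lam0 C0 C1 \<epsilon>0 \<epsilon>1 :: real
  assumes v: "analytic_circle (\<lambda>x. complex_of_real (v x))"
    and \<alpha>: "\<alpha> \<in> DC"
    and lam0: "is_lambda0 v lam0"
    and lam: "\<bar>lam\<bar> < lam0"
    and params: "almost_localized v lam \<alpha> C0 C1 \<epsilon>0 \<epsilon>1"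
  shows "\<exists>C c :: real. C > 0 \<and> c > 0 \<and>
    (\<forall>E\<in>Sigma_spec v lam \<alpha>. \<forall>\<theta> r. dual_phase v lam \<alpha> E \<theta> \<and> resonance_enum \<alpha> \<epsilon>0 \<theta> r \<longrightarrow>
      (\<forall>j\<in>res_index \<alpha> \<epsilon>0 \<theta>. \<forall>n N \<epsilon>.
        n = \<bar>real_of_int (r j)\<bar> + 1 \<and> N = res_abs \<alpha> \<epsilon>0 \<theta> r (Suc j) \<and> \<epsilon> = c * n powr (- C) \<longrightarrow>
        (\<exists>(\<Phi> :: real \<Rightarrow> complex^2^2) q1 q q3 q4.
          (\<forall>i k. analytic_circle (\<lambda>x. \<Phi> x $ i $ k)) \<and>
          (\<forall>x. det (\<Phi> x) = 1) \<and>
          mat_extends_to_strip \<epsilon> \<Phi> \<and> mat_strip_norm \<epsilon> \<Phi> \<le> C * n powr C \<and>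
          (\<forall>x. \<Phi> (x + \<alpha>) ** schroedinger_cocycle v lam E x ** matrix_inv (\<Phi> x) =
             mat2 (exp (2 * of_real pi * \<i> * of_real \<theta>)) 0 0 (exp (- (2 * of_real pi * \<i> * of_real \<theta>)))
             + mat2 (q1 x) (q x) (q3 x) (q4 x)) \<and>
          extends_to_strip \<epsilon> q1 \<and> strip_norm \<epsilon> q1 \<le> C * exp_neg c N \<and>
          extends_to_strip \<epsilon> q3 \<and> strip_norm \<epsilon> q3 \<le> C * exp_neg c N \<and>
          extends_to_strip \<epsilon> q4 \<and> strip_norm \<epsilon> q4 \<le> C * exp_neg c N \<and>
          extends_to_strip \<epsilon> q \<and>
          strip_norm \<epsilon> q \<le> C * exp (- c * n * (ln (1 + n)) powr (- C)))))"
proof -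
  obtain Cv \<sigma> where \<sigma>: "\<sigma> > 0" and decay: "exp_decay Cv \<sigma> (fourier_coeff v)"
    and fs_v: "\<And>x. fs (fourier_coeff v) (of_real x) = of_real (v x)"
    using fourier_coeff_decay[OF v] by metis
  obtain \<kappa> \<tau> where \<kappa>: "\<kappa> > 0" "\<And>m::int. m \<noteq> 0 \<Longrightarrow> \<kappa> / \<bar>real_of_int m\<bar> ^ \<tau> \<le> circle_norm (of_int m * \<alpha>)"
    using DC_lower_bound[OF \<alpha>] by metis
  have pos: "\<epsilon>0 > 0" "\<epsilon>1 > 0" using params by (auto simp: almost_localized_def)
  define s where "s = min \<sigma> \<epsilon>1 / 2"
  define C' where "C' = max C0 1"
  define D1 where "D1 = max C1 (exp (\<epsilon>1 * C'))"
  \<comment> \<open>One rate for all three sequences: at most that of the Fourier coefficients of v,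
    of the localized solution, and s/2 of the truncation defect.\<close>
  define \<rho> where "\<rho> = min 1 (s / 2)"
  \<comment> \<open>A bound for |E|, plus one for the potential on the strip of width \<rho>/(4 pi),
    plus 1 for the second row of the cocycle.\<close>
  define \<Lambda> where "\<Lambda> = 2 + \<bar>lam\<bar> * (Cv * (2 + 2 / \<rho>)) + \<bar>lam\<bar> * (Cv * (2 + 4 / \<rho>)) + 1"
  define Cg where "Cg = \<bar>lam\<bar> * (Cv * D1 * (2 + 2 / s)) + 1"
  define cg where "cg = s / (4 * C')"
  define Xg where "Xg = \<epsilon>1 * C'"
  have s: "s > 0" "s \<le> \<sigma>" "s \<le> \<epsilon>1" using \<sigma> pos by (auto simp: s_def)
  have \<rho>: "\<rho> > 0" "\<rho> \<le> 1" "\<rho> \<le> s / 2" "\<rho> \<le> \<sigma>" "\<rho> \<le> \<epsilon>1" using s by (auto simp: \<rho>_def)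
  have C': "C' \<ge> 1" by (simp add: C'_def)
  have D1: "D1 \<ge> 1"
  proof -
    have "1 \<le> exp (\<epsilon>1 * C')" using pos C' by simp
    then show ?thesis unfolding D1_def by linarith
  qed
  have Cv: "Cv \<ge> 0" by (rule exp_decay_nonneg[OF decay])
  have vc\<rho>: "exp_decay Cv \<rho> (fourier_coeff v)" by (rule exp_decay_mono[OF decay order_refl \<rho>(4)])
  have nonneg: "\<bar>lam\<bar> * (Cv * (2 + 2 / \<rho>)) \<ge> 0" "\<bar>lam\<bar> * (Cv * (2 + 4 / \<rho>)) \<ge> 0" "\<bar>lam\<bar> * (Cv * D1 * (2 + 2 / s)) \<ge> 0"
    using Cv \<rho> D1 s by auto
  interpret resonance_setting \<alpha> \<kappa> lam \<rho> Cv D1 \<Lambda> \<tau> "fourier_coeff v" v \<epsilon>0 Cg cg Xg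
    by unfold_locales (use \<kappa> \<rho> vc\<rho> D1 nonneg fs_v pos s C' in \<open>auto simp: \<Lambda>_def Cg_def cg_def Xg_def\<close>)
  \<comment> \<open>The only passage from almost localization to the approximate waves; the
    constants on this side depend on v, lam, \<alpha> and the localization parameters alone.\<close>
  have adm: "adm E \<theta> r" if dp: "dual_phase v lam \<alpha> E \<theta>" and r: "resonance_enum \<alpha> \<epsilon>0 \<theta> r" for E \<theta> r
    unfolding adm_def
  proof (intro conjI ballI r)
    fix j assume j: "j \<in> res_index \<alpha> \<epsilon>0 \<theta>"
    define N where "N = res_abs \<alpha> \<epsilon>0 \<theta> r (Suc j)"
    from approximate_dual_solution[OF decay \<sigma> params s_def C'_def D1_def dp r j nn_def[of r j] N_def]
    obtain a g where ag: "a 0 = 1" "exp_decay D1 (\<epsilon>1 / nn r j) a"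
      "exp_decay (\<bar>lam\<bar> * (Cv * D1 * (2 + 2 / s)) * exp (\<epsilon>1 * C' * nn r j) * exp_neg (s / (4 * C')) N) (s / 2) g"
      "\<And>k. ((\<lambda>l. of_real lam * fourier_coeff v l * a (k - l)) has_sum
        (of_real E * a k - of_real (2 * cos (2 * pi * (\<theta> + of_int k * \<alpha>))) * a k - g k)) UNIV"
      by blast
    have "bloch_wave \<alpha> \<kappa> lam \<rho> Cv D1 \<Lambda> \<tau> (fourier_coeff v) E \<theta> (nn r j) (dl \<theta> r j) a g"
    proof
      show "1 \<le> nn r j" by (rule nn_ge_1)
      show "exp_decay D1 (\<rho> / nn r j) a"
        by (rule exp_decay_mono[OF ag(2)]) (use \<rho> nn_ge_1[of r j] in \<open>auto intro: divide_right_mono\<close>)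
      show "exp_decay (dl \<theta> r j) \<rho> g"
      proof (rule exp_decay_mono[OF ag(3)])
        show "\<bar>lam\<bar> * (Cv * D1 * (2 + 2 / s)) * exp (\<epsilon>1 * C' * nn r j) * exp_neg (s / (4 * C')) N \<le> dl \<theta> r j"
          unfolding dl_def N_def[symmetric]
          unfolding Cg_def cg_def Xg_def
          by (intro mult_right_mono exp_neg_nonneg) auto
      qed (use \<rho> in auto)
      show "\<bar>E\<bar> + \<bar>lam\<bar> * (Cv * (2 + 4 / \<rho>)) + 1 \<le> \<Lambda>"
        using dual_phase_energy_bound[OF vc\<rho> \<rho>(1) dp] by (simp add: \<Lambda>_def)
    qed (use ag in auto)
    then show "\<exists>a g. bloch_wave \<alpha> \<kappa> lam \<rho> Cv D1 \<Lambda> \<tau> (fourier_coeff v) E \<theta> (nn r j) (dl \<theta> r j) a g" by blast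
  qed
  obtain CM q where CM: "CM \<ge> 1"
    "\<And>E \<theta> r j. adm E \<theta> r \<Longrightarrow> j \<in> res_index \<alpha> \<epsilon>0 \<theta> \<Longrightarrow> growth E \<real> (Kn (nn r j)) (CM * nn r j ^ q)"
    using polynomial_growth by blast
  interpret resonance_growth \<alpha> \<kappa> lam \<rho> Cv D1 \<Lambda> \<tau> "fourier_coeff v" v \<epsilon>0 Cg cg Xg CM q
    by unfold_locales (use CM in auto)
  obtain C c where Cc: "C > 0" "c > 0"
    "\<And>E \<theta> r j n N. adm E \<theta> r \<Longrightarrow> j \<in> res_index \<alpha> \<epsilon>0 \<theta> \<Longrightarrow> n = nn r j \<Longrightarrow> N = res_abs \<alpha> \<epsilon>0 \<theta> r (Suc j) \<Longrightarrow>
      conjugable v lam \<alpha> E \<theta> (c * n powr (- C)) (C * n powr C) (C * exp_neg c N) (C * exp (- c * n * (ln (1 + n)) powr (- C)))"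
    using conjugable_at_every_scale by blast
  show ?thesis
  proof (rule exI[of _ C], rule exI[of _ c], intro conjI ballI allI impI, goal_cases)
    case (3 E \<theta> r j n N \<epsilon>)
    then have "conjugable v lam \<alpha> E \<theta> \<epsilon> (C * n powr C) (C * exp_neg c N) (C * exp (- c * n * (ln (1 + n)) powr (- C)))"
      using Cc(3)[OF adm[of E \<theta> r], of j n N] by (simp add: nn_def)
    then show ?case unfolding conjugable_def .
  qed (use Cc in auto)
qed

end
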